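(* Let $(\mathbf{X},d)$ be a complete length space, let $\Omega\subsetneq\mathbf{X}$ be a bounded domain, and let $(\overline{\Omega},d,\mu)$ be a complete bounded metric measure space with $\mu$ a doubling measure. Let $f$ be a positive Borel measurable function on $\overline{\Omega}$ with $\inf_\Omega f>0$, let $g:\partial\Omega\to\mathbb{R}$ be bounded, and let $$u(x)=\inf_{y\in\partial\Omega}\{L_f(x,y)+g(y)\},\qquad x\in\overline{\Omega}.$$ (1) If $\overline{\Omega}$ and $f$ satisfy (A1), then $u$ is $(1-\frac{Q}{p})$-Hölder continuous in $\overline{\Omega}$ with respect to the metric $d$. (2) If $\overline{\Omega}$ and $f$ satisfy (A2), then $u$ is Lipschitz continuous in $\overline{\Omega}$ with respect to the metric $d$.
   Context: Doubling: $\mu$ is a locally finite Borel measure, balls have positive finite measure, and there is $C_d\ge1$ with $\mu(B_{2r}(x))\le C_d\,\mu(B_r(x))$ for all $x$ and $r>0$. $Q=\log_2 C_d$ is called the homogeneous dimension; one has $\mu(B_r(x))/\mu(B_R(x))\ge C(r/R)^Q$ for all balls $B_r(x)\subset B_R(x)$. A Borel function $\rho\ge 0$ (with values in $[0,\infty]$) is an upper gradient of $w$ if $|w(\gamma(a))-w(\gamma(b))|\le\int_\gamma\rho\,ds$ for every rectifiable curve $\gamma:[a,b]\to\overline\Omega$. For $1\le p<\infty$, $(\overline{\Omega},d,\mu)$ supports a $p$-Poincaré inequality if there are $C>0$, $\lambda\ge1$ such that for every measurable $w$, every upper gradient $\rho$ of $w$ and every ball $B$, $\frac{1}{\mu(B)}\int_B|w-w_B|\,d\mu\le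 C\,\mathrm{diam}(B)\big(\frac{1}{\mu(\lambda B)}\int_{\lambda B}\rho^p\,d\mu\big)^{1/p}$, where $w_B$ is the mean of $w$ over $B$ and $\lambda B$ is the ball with the same center and $\lambda$ times the radius. For $p=\infty$ the right-hand side is $C\,\mathrm{diam}(B)\,\|\rho\|_{L^\infty(\lambda B)}$. (A1): $\overline{\Omega}$ satisfies a $p$-Poincaré inequality for some finite $p>\max\{1,Q\}$ and $f\in L^p(\overline{\Omega})$. (A2): $\overline{\Omega}$ satisfies an $\infty$-Poincaré inequality and $f\in L^\infty(\overline{\Omega})$. Here $f$ is a fixed everywhere-defined Borel function, not an a.e.-equivalence class. For $x,y\in\overline{\Omega}$, $\Gamma_f(x,y)$ is the set of rectifiable curves $\gamma:[0,\ell]\to\overline{\Omega}$, parametrized by arc length, with $\gamma(0)=x$, $\gamma(\ell)=y$ and $\int_\gamma f\,ds<\infty$ (the constant curve is allowed when $x=y$), and $L_f(x,y):=\inf\{\int_\gamma f\,ds:\gamma\in\Gamma_f(x,y)\}$. *)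

theory Defs
  imports "HOL-Analysis.Analysis" "HOL-Probability.Essential_Supremum"
begin

section \<open>Curves in metric spaces\<close>

definition curve_length :: "(real \<Rightarrow> 'a::metric_space) \<Rightarrow> real \<Rightarrow> real \<Rightarrow> ennreal" where
  "curve_length \<gamma> a b =
     Sup {(\<Sum>i<n. ennreal (dist (\<gamma> (t i)) (\<gamma> (t (Suc i))))) | (n::nat) (t::nat \<Rightarrow> real).
            (\<forall>i\<le>n. t i \<in> {a..b}) \<and> (\<forall>i<n. t i \<le> t (Suc i))}"

definition rectifiable_curve :: "'a::metric_space set \<Rightarrow> (real \<Rightarrow> 'a) \<Rightarrow> real \<Rightarrow> real \<Rightarrow> bool" where
  "rectifiable_curve S \<gamma> a b \<longleftrightarrow>
     a \<le> b \<and> continuous_on {a..b} \<gamma> \<and> \<gamma> ` {a..b} \<subseteq> S \<and> curve_length \<gamma> a b < \<infinity>"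

definition arc_length_parametrized :: "(real \<Rightarrow> 'a::metric_space) \<Rightarrow> real \<Rightarrow> bool" where
  "arc_length_parametrized \<gamma> l \<longleftrightarrow>
     (\<forall>s t. 0 \<le> s \<longrightarrow> s \<le> t \<longrightarrow> t \<le> l \<longrightarrow> curve_length \<gamma> s t = ennreal (t - s))"

text \<open>On a rectifiable curve the length function \<open>t \<mapsto> curve_length \<gamma> a t\<close> is continuous, so
  every \<open>s\<close> between \<open>0\<close> and the length of the curve is attained; \<open>\<gamma>\<close> is constant where the length
  function is, so the value below does not depend on the choice.\<close>

definition arc_length_reparam :: "(real \<Rightarrow> 'a::metric_space) \<Rightarrow> real \<Rightarrow> real \<Rightarrow> real \<Rightarrow> 'a" where
  "arc_length_reparam \<gamma> a b s = \<gamma> (SOME t. t \<in> {a..b} \<and> curve_length \<gamma> a t = ennreal s)"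

definition curve_integral ::
    "('a::metric_space \<Rightarrow> ennreal) \<Rightarrow> (real \<Rightarrow> 'a) \<Rightarrow> real \<Rightarrow> real \<Rightarrow> ennreal" where
  "curve_integral \<rho> \<gamma> a b =
     (\<integral>\<^sup>+s\<in>{0..enn2real (curve_length \<gamma> a b)}. \<rho> (arc_length_reparam \<gamma> a b s) \<partial>lborel)"

definition length_space :: "'a::metric_space set \<Rightarrow> bool" where
  "length_space S \<longleftrightarrow>
     (\<forall>x\<in>S. \<forall>y\<in>S. ennreal (dist x y) =
        Inf {curve_length \<gamma> a b | \<gamma> a b. rectifiable_curve S \<gamma> a b \<and> \<gamma> a = x \<and> \<gamma> b = y})"

section \<open>Metric measure spaces\<close>

text \<open>A metric measure space is given by a Borel measure \<open>M\<close> on a subset \<open>S\<close> of a metric space; its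
  balls are the open balls of the subspace \<open>S\<close>.\<close>

definition doubling_measure_on :: "'a::metric_space set \<Rightarrow> real \<Rightarrow> 'a measure \<Rightarrow> bool" where
  "doubling_measure_on S Cd M \<longleftrightarrow>
     sets M = sets (restrict_space borel S) \<and> 1 \<le> Cd \<and>
     (\<forall>x\<in>S. \<forall>r>0. 0 < emeasure M (ball x r \<inter> S) \<and> emeasure M (ball x r \<inter> S) < \<infinity>) \<and>
     (\<forall>x\<in>S. \<forall>r>0. emeasure M (ball x (2 * r) \<inter> S) \<le> ennreal Cd * emeasure M (ball x r \<inter> S))"

definition upper_gradient_on ::
    "'a::metric_space set \<Rightarrow> ('a \<Rightarrow> ennreal) \<Rightarrow> ('a \<Rightarrow> real) \<Rightarrow> bool" where
  "upper_gradient_on S \<rho> w \<longleftrightarrow>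
     \<rho> \<in> borel_measurable (restrict_space borel S) \<and>
     (\<forall>\<gamma> a b. rectifiable_curve S \<gamma> a b \<longrightarrow>
        ennreal \<bar>w (\<gamma> a) - w (\<gamma> b)\<bar> \<le> curve_integral \<rho> \<gamma> a b)"

definition ennreal_powr :: "ennreal \<Rightarrow> real \<Rightarrow> ennreal" where \<comment> \<open>used for positive exponents only\<close>
  "ennreal_powr x p = (if x = \<infinity> then \<infinity> else ennreal (enn2real x powr p))"

definition mean_oscillation :: "'a measure \<Rightarrow> 'a set \<Rightarrow> ('a \<Rightarrow> real) \<Rightarrow> ennreal" where
  "mean_oscillation M B w =
     (let wB = (LINT z:B|M. w z) / measure M B
      in (\<integral>\<^sup>+z\<in>B. ennreal \<bar>w z - wB\<bar> \<partial>M) / emeasure M B)"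

text \<open>Measurable functions are measurable for the completion of the Borel measure, as is usual for
  Borel regular measures. The inequalities are required for the functions that have a mean over the
  ball, i.e. are integrable there.\<close>

definition poincare_on :: "'a::metric_space set \<Rightarrow> 'a measure \<Rightarrow> real \<Rightarrow> bool" where
  "poincare_on S M p \<longleftrightarrow> 1 \<le> p \<and>
     (\<exists>C>0. \<exists>lam\<ge>1. \<forall>w \<rho> x r.
        w \<in> borel_measurable (completion M) \<longrightarrow> upper_gradient_on S \<rho> w \<longrightarrow> x \<in> S \<longrightarrow> 0 < r \<longrightarrow>
        set_integrable (completion M) (ball x r \<inter> S) w \<longrightarrow>
        mean_oscillation (completion M) (ball x r \<inter> S) w
          \<le> ennreal (C * diameter (ball x r \<inter> S)) *
             ennreal_powr ((\<integral>\<^sup>+z\<in>ball x (lam * r) \<inter> S. ennreal_powr (\<rho> z) p \<partial>M)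
                             / emeasure M (ball x (lam * r) \<inter> S)) (1 / p))"

definition poincare_infinity_on :: "'a::metric_space set \<Rightarrow> 'a measure \<Rightarrow> bool" where
  "poincare_infinity_on S M \<longleftrightarrow>
     (\<exists>C>0. \<exists>lam\<ge>1. \<forall>w \<rho> x r.
        w \<in> borel_measurable (completion M) \<longrightarrow> upper_gradient_on S \<rho> w \<longrightarrow> x \<in> S \<longrightarrow> 0 < r \<longrightarrow>
        set_integrable (completion M) (ball x r \<inter> S) w \<longrightarrow>
        mean_oscillation (completion M) (ball x r \<inter> S) w
          \<le> ennreal (C * diameter (ball x r \<inter> S)) *
             esssup (restrict_space M (ball x (lam * r) \<inter> S)) \<rho>)"

section \<open>The distance induced by \<open>f\<close> and the value function\<close>

definition admissible_curves ::
    "'a::metric_space set \<Rightarrow> ('a \<Rightarrow> real) \<Rightarrow> 'a \<Rightarrow> 'a \<Rightarrow> ((real \<Rightarrow> 'a) \<times> real) set" where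
  "admissible_curves S f x y =
     {(\<gamma>, l). rectifiable_curve S \<gamma> 0 l \<and> arc_length_parametrized \<gamma> l \<and> \<gamma> 0 = x \<and> \<gamma> l = y \<and>
        curve_integral (\<lambda>z. ennreal (f z)) \<gamma> 0 l < \<infinity>}"

text \<open>The infimum is \<open>\<infinity>\<close> if there is no admissible curve.\<close>

definition induced_length ::
    "'a::metric_space set \<Rightarrow> ('a \<Rightarrow> real) \<Rightarrow> 'a \<Rightarrow> 'a \<Rightarrow> ennreal" where
  "induced_length S f x y =
     (INF (\<gamma>, l)\<in>admissible_curves S f x y. curve_integral (\<lambda>z. ennreal (f z)) \<gamma> 0 l)"

definition value_function ::
    "'a::metric_space set \<Rightarrow> ('a \<Rightarrow> real) \<Rightarrow> ('a \<Rightarrow> real) \<Rightarrow> 'a \<Rightarrow> ereal" where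
  "value_function \<Omega> f g x =
     (INF y\<in>frontier \<Omega>. enn2ereal (induced_length (closure \<Omega>) f x y) + ereal (g y))"

definition holder_on :: "real \<Rightarrow> 'a::metric_space set \<Rightarrow> ('a \<Rightarrow> real) \<Rightarrow> bool" where
  "holder_on \<alpha> S h \<longleftrightarrow>
     (\<exists>C\<ge>0. \<forall>x\<in>S. \<forall>y\<in>S. \<bar>h x - h y\<bar> \<le> C * dist x y powr \<alpha>)"

end

(*
  Up to enlarging f we may assume that f <= h + infinity * 1_E with h lower semicontinuous and E a
  null G_delta set: in case (A1) take E empty and h a Vitali-Caratheodory majorant in L^p, in case
  (A2) take h constant. Any bounded function with upper gradient h + infinity * 1_E' (E' null) then
  has mean oscillation at most A r^alpha on balls of radius r, where alpha = 1 - Q/p or alpha = 1.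

  Applied to the truncated h-distance from a small ball, measured along curves that spend no time in
  a null set, telescoping over concentric balls shows that almost every point of B(x,r) is joined
  to B(x,r/2) by such a curve of cost at most K r^alpha. To pass to given end points x and y one
  starts at a point near both and extends a curve at both ends towards x and y. In the limit the
  curve still avoids E, provided quantitative bounds on the time spent in neighbourhoods of E are
  fixed during the construction; the null sets being a sigma-ideal, they can be chosen so that the
  construction never stops. Hence L_f(x,y) <= C d(x,y)^alpha for all x, y, and u inherits this
  modulus of continuity from the triangle inequality for L_f.
*)

theory Submission
  imports Defs
begin

section \<open>Curves\<close>

text \<open>The values of \<open>f\<close> on null sets matter, because
  \<open>induced_length\<close> integrates \<open>f\<close> along single curves, while the Poincare
  inequalities do not see null sets. The majorant of \<open>f\<close> is shaped by this. It is lower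
  semicontinuous, so that Fatou's lemma bounds the cost of a limit of curves. It is at least 1, so
  that cost bounds time and curves of bounded cost form a compact family. Its infinite part sits on
  a decreasing intersection of open sets \<open>V k\<close>: spending no time there means that for
  every \<open>j\<close> the time in some \<open>V k\<close> is at most \<open>1 / (j + 1)\<close>.
  Each single bound of this kind survives limits, but the choice of \<open>k\<close> may be lost.
  Hence the set of points reached by such curves need not be closed, and the measurability of the
  truncated path distance takes a capacitability argument; hence also the bounds on the final curve
  must be fixed stage by stage. Connections are available from almost every point only, which is why
  the final curve cannot be started at a prescribed end point.\<close>

abbreviation (input) chord_sum :: "(real \<Rightarrow> 'a::metric_space) \<Rightarrow> (nat \<Rightarrow> real) \<Rightarrow> nat \<Rightarrow> ennreal" where
  "chord_sum \<gamma> t n \<equiv> \<Sum>i<n. ennreal (dist (\<gamma> (t i)) (\<gamma> (t (Suc i))))"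

abbreviation (input) borel_on :: "'a::topological_space set \<Rightarrow> ('a \<Rightarrow> 'b::topological_space) set" where
  "borel_on S \<equiv> borel_measurable (restrict_space borel S)"

section \<open>Additivity and continuity of the length of a curve\<close>

lemma curve_length_ge_sum:
  assumes "\<And>i. i \<le> n \<Longrightarrow> t i \<in> {a..b}" "\<And>i. i < n \<Longrightarrow> t i \<le> t (Suc i)"
  shows "chord_sum \<gamma> t n \<le> curve_length \<gamma> a b"
  unfolding curve_length_def by (rule Sup_upper) (use assms in blast)

lemma curve_length_least:
  assumes "\<And>n t. (\<And>i. i \<le> n \<Longrightarrow> t i \<in> {a..b}) \<Longrightarrow> (\<And>i. i < n \<Longrightarrow> t i \<le> t (Suc i)) \<Longrightarrow>
     chord_sum \<gamma> t n \<le> c"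
  shows "curve_length \<gamma> a b \<le> c"
  unfolding curve_length_def by (rule Sup_least) (use assms in blast)

lemma dist_le_curve_length:
  assumes "a \<le> s" "s \<le> t" "t \<le> b"
  shows "ennreal (dist (\<gamma> s) (\<gamma> t)) \<le> curve_length \<gamma> a b"
  using curve_length_ge_sum[of 1 "\<lambda>i. if i = 0 then s else t" a b \<gamma>] assms by auto

lemma curve_length_mono:
  assumes "a \<le> a'" "b' \<le> b"
  shows "curve_length \<gamma> a' b' \<le> curve_length \<gamma> a b"
proof (rule curve_length_least)
  fix n :: nat and t :: "nat \<Rightarrow> real"
  assume 1: "\<And>i. i \<le> n \<Longrightarrow> t i \<in> {a'..b'}" and 2: "\<And>i. i < n \<Longrightarrow> t i \<le> t (Suc i)"
  have "t i \<in> {a..b}" if "i \<le> n" for i using 1[OF that] assms by auto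
  then show "chord_sum \<gamma> t n \<le> curve_length \<gamma> a b"
    using 2 by (intro curve_length_ge_sum) auto
qed

lemma curve_length_refl [simp]: "curve_length \<gamma> a a = 0"
proof -
  have "curve_length \<gamma> a a \<le> 0"
  proof (rule curve_length_least)
    fix n :: nat and t :: "nat \<Rightarrow> real"
    assume 1: "\<And>i. i \<le> n \<Longrightarrow> t i \<in> {a..a}"
    have "t i = a" if "i \<le> n" for i using 1[OF that] by simp
    then show "chord_sum \<gamma> t n \<le> 0" by simp
  qed
  then show ?thesis by simp
qed

text \<open>Clamping the points of a partition to either side of \<open>b\<close> splits its chord
  sum, by the triangle inequality at \<open>b\<close>. Conversely, partitions of the two halves are
  put one after the other, which only adds the chord that joins them.\<close>

lemma curve_length_add:
  assumes "a \<le> b" "b \<le> c"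
  shows "curve_length \<gamma> a c = curve_length \<gamma> a b + curve_length \<gamma> b c"
proof (rule antisym)
  show "curve_length \<gamma> a c \<le> curve_length \<gamma> a b + curve_length \<gamma> b c"
  proof (rule curve_length_least)
    fix n :: nat and t :: "nat \<Rightarrow> real"
    assume 1: "\<And>i. i \<le> n \<Longrightarrow> t i \<in> {a..c}" and 2: "\<And>i. i < n \<Longrightarrow> t i \<le> t (Suc i)"
    have *: "dist (\<gamma> x) (\<gamma> y) \<le> dist (\<gamma> (min x b)) (\<gamma> (min y b)) + dist (\<gamma> (max x b)) (\<gamma> (max y b))"
      if "x \<le> y" for x y
      using that dist_triangle[of "\<gamma> x" "\<gamma> y" "\<gamma> b"] by (auto simp: min_def max_def)
    have "chord_sum \<gamma> t n
      \<le> (\<Sum>i<n. ennreal (dist (\<gamma> (min (t i) b)) (\<gamma> (min (t (Suc i)) b)))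
           + ennreal (dist (\<gamma> (max (t i) b)) (\<gamma> (max (t (Suc i)) b))))"
      by (intro sum_mono) (use * 2 in \<open>auto simp flip: ennreal_plus intro!: ennreal_leI\<close>)
    also have "\<dots> = (\<Sum>i<n. ennreal (dist (\<gamma> (min (t i) b)) (\<gamma> (min (t (Suc i)) b))))
           + (\<Sum>i<n. ennreal (dist (\<gamma> (max (t i) b)) (\<gamma> (max (t (Suc i)) b))))"
      by (simp add: sum.distrib)
    also have "\<dots> \<le> curve_length \<gamma> a b + curve_length \<gamma> b c"
    proof (intro add_mono)
      show "(\<Sum>i<n. ennreal (dist (\<gamma> (min (t i) b)) (\<gamma> (min (t (Suc i)) b)))) \<le> curve_length \<gamma> a b"
        by (rule curve_length_ge_sum[where t="\<lambda>i. min (t i) b"]) (use 1 2 assms in \<open>force simp: min_def\<close>)+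
      show "(\<Sum>i<n. ennreal (dist (\<gamma> (max (t i) b)) (\<gamma> (max (t (Suc i)) b)))) \<le> curve_length \<gamma> b c"
        by (rule curve_length_ge_sum[where t="\<lambda>i. max (t i) b"]) (use 1 2 assms in \<open>force simp: max_def\<close>)+
    qed
    finally show "chord_sum \<gamma> t n \<le> \<dots>" .
  qed
  have pair: "chord_sum \<gamma> t n + chord_sum \<gamma> s m
      \<le> curve_length \<gamma> a c"
    if 1: "\<And>i. i \<le> n \<Longrightarrow> t i \<in> {a..b}" "\<And>i. i < n \<Longrightarrow> t i \<le> t (Suc i)"
      and 2: "\<And>i. i \<le> m \<Longrightarrow> s i \<in> {b..c}" "\<And>i. i < m \<Longrightarrow> s i \<le> s (Suc i)" for n t m s
  proof -
    \<comment> \<open>Index \<open>n\<close> of \<open>u\<close> is the end of \<open>t\<close> and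
      index \<open>n + 1\<close> the start of \<open>s\<close>, so the joining chord is the extra
      term in the sum over \<open>Suc m\<close>.\<close>
    define u where "u i = (if i \<le> n then t i else s (i - Suc n))" for i
    have "chord_sum \<gamma> t n + chord_sum \<gamma> s m
      \<le> chord_sum \<gamma> u n + (\<Sum>i<Suc m. ennreal (dist (\<gamma> (u (n+i))) (\<gamma> (u (Suc (n+i))))))"
      unfolding sum.lessThan_Suc_shift by (intro add_mono) (auto simp: u_def intro!: sum_mono add_increasing)
    also have "\<dots> = (\<Sum>i<n + Suc m. ennreal (dist (\<gamma> (u i)) (\<gamma> (u (Suc i)))))"
      unfolding sum.nat_group[symmetric]
      using sum.atLeastLessThan_concat[of 0 n "n + Suc m" "\<lambda>i. ennreal (dist (\<gamma> (u i)) (\<gamma> (u (Suc i))))"]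
        sum.shift_bounds_nat_ivl[of "\<lambda>i. ennreal (dist (\<gamma> (u i)) (\<gamma> (u (Suc i))))" 0 n "Suc m"]
      by (simp add: atLeast0LessThan add.commute)
    also have "\<dots> \<le> curve_length \<gamma> a c"
    proof (rule curve_length_ge_sum)
      show "u i \<in> {a..c}" if "i \<le> n + Suc m" for i
      proof -
        have "i - Suc n \<le> m" using that by linarith
        then show ?thesis using 1(1)[of i] 2(1)[of "i - Suc n"] assms by (auto simp: u_def)
      qed
      show "u i \<le> u (Suc i)" if "i < n + Suc m" for i
      proof (cases "i < n")
        case True then show ?thesis using 1(2)[of i] by (simp add: u_def)
      next
        case False
        show ?thesis
        proof (cases "i = n")
          case True then show ?thesis using 1(1)[of n] 2(1)[of 0] by (auto simp: u_def)
        next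
          case F: False
          with False have "i - n = Suc (i - Suc n)" "i - Suc n < m" using that by auto
          then show ?thesis using 2(2)[of "i - Suc n"] False F by (simp add: u_def)
        qed
      qed
    qed
    finally show ?thesis .
  qed
  define A where "A a b = {chord_sum \<gamma> t n | (n::nat) (t::nat \<Rightarrow> real).
            (\<forall>i\<le>n. t i \<in> {a..b}) \<and> (\<forall>i<n. t i \<le> t (Suc i))}" for a b
  have cl: "curve_length \<gamma> a b = (SUP x\<in>A a b. x)" for a b by (simp add: curve_length_def A_def)
  have "0 \<in> A a b" if "a \<le> b" for a b
    unfolding A_def using that by (auto intro!: exI[of _ "0::nat"] exI[of _ "\<lambda>_. a"])
  then have ne: "A a b \<noteq> {}" "A b c \<noteq> {}" using assms by blast+
  have p: "x + y \<le> curve_length \<gamma> a c" if "x \<in> A a b" "y \<in> A b c" for x y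
    using that pair unfolding A_def by blast
  show "curve_length \<gamma> a b + curve_length \<gamma> b c \<le> curve_length \<gamma> a c"
    unfolding cl[of a b] cl[of b c] ennreal_SUP_add_left[OF ne(1), symmetric]
  proof (rule SUP_least)
    fix x assume x: "x \<in> A a b"
    have "x + Sup (A b c) = (SUP y\<in>A b c. x + y)"
      using ennreal_SUP_add_right[OF ne(2), of x "\<lambda>y. y"] by simp
    also have "\<dots> \<le> curve_length \<gamma> a c" by (intro SUP_least p x)
    finally show "x + (SUP y\<in>A b c. y) \<le> curve_length \<gamma> a c" by simp
  qed
qed

text \<open>A chord sum above \<open>M\<close> changes continuously when its points are clamped to
  \<open>{a + \<delta>..b - \<delta>}\<close>, so a slight shrinking of the interval loses little
  length. Continuity of the length function rests on this.\<close>

lemma curve_length_interior: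
  assumes c: "continuous_on {a..b} \<gamma>" and ab: "a < b" and M: "M < curve_length \<gamma> a b"
  obtains \<delta> where "0 < \<delta>" "a + \<delta> \<le> b - \<delta>" "M < curve_length \<gamma> (a + \<delta>) (b - \<delta>)"
proof -
  obtain n t where t: "\<And>i. i \<le> n \<Longrightarrow> t i \<in> {a..b}" "\<And>i. i < n \<Longrightarrow> t i \<le> t (Suc i)"
     and s: "M < chord_sum \<gamma> t n"
    using M unfolding curve_length_def less_Sup_iff by blast
  define k where "k \<delta> x = max (a + \<delta>) (min (b - \<delta>) x)" for \<delta> x :: real
  have ev: "\<forall>\<^sub>F \<delta> in at_right 0. 0 < \<delta> \<and> \<delta> < (b - a) / 2"
    using ab by (intro eventually_conj eventually_at_right_less order_tendstoD(2)[OF tendsto_ident_at]) auto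
  have lim: "((\<lambda>\<delta>. \<gamma> (k \<delta> (t i))) \<longlongrightarrow> \<gamma> (t i)) (at_right 0)" if "i \<le> n" for i
  proof (rule continuous_on_tendsto_compose[OF c])
    have "((\<lambda>\<delta>. k \<delta> (t i)) \<longlongrightarrow> max (a + 0) (min (b - 0) (t i))) (at_right 0)"
      unfolding k_def by (intro tendsto_intros)
    then show "((\<lambda>\<delta>. k \<delta> (t i)) \<longlongrightarrow> t i) (at_right 0)" using t(1)[OF that]
      by (simp add: max_absorb2 min_absorb2)
    show "t i \<in> {a..b}" using t(1)[OF that] .
    show "\<forall>\<^sub>F \<delta> in at_right 0. k \<delta> (t i) \<in> {a..b}"
      using ev by eventually_elim (auto simp: k_def max_def min_def)
  qed
  have "((\<lambda>\<delta>. \<Sum>i<n. ennreal (dist (\<gamma> (k \<delta> (t i))) (\<gamma> (k \<delta> (t (Suc i)))))) \<longlongrightarrow>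
      chord_sum \<gamma> t n) (at_right 0)"
    by (intro tendsto_sum tendsto_ennrealI tendsto_dist lim) auto
  from order_tendstoD(1)[OF this s] ev
  have "\<forall>\<^sub>F \<delta> in at_right 0. M < (\<Sum>i<n. ennreal (dist (\<gamma> (k \<delta> (t i))) (\<gamma> (k \<delta> (t (Suc i)))))) \<and> 0 < \<delta> \<and> \<delta> < (b - a) / 2"
    by (rule eventually_conj)
  then obtain \<delta> where d: "M < (\<Sum>i<n. ennreal (dist (\<gamma> (k \<delta> (t i))) (\<gamma> (k \<delta> (t (Suc i))))))" "0 < \<delta>" "\<delta> < (b - a) / 2"
    by (auto dest!: eventually_happens)
  have "(\<Sum>i<n. ennreal (dist (\<gamma> (k \<delta> (t i))) (\<gamma> (k \<delta> (t (Suc i)))))) \<le> curve_length \<gamma> (a + \<delta>) (b - \<delta>)"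
    by (rule curve_length_ge_sum[where t="\<lambda>i. k \<delta> (t i)"]) (use d t in \<open>fastforce simp: k_def max_def min_def\<close>)+
  with d show ?thesis by (intro that[of \<delta>]) auto
qed

text \<open>At the supremum \<open>t0\<close> of the parameters with length at most
  \<open>s\<close>, a jump of the length function on either side would contradict
  \<open>curve_length_interior\<close>, so the value \<open>s\<close> is taken there.\<close>

lemma curve_length_attained:
  assumes r: "rectifiable_curve S \<gamma> a b" and s: "0 \<le> s" "ennreal s \<le> curve_length \<gamma> a b"
  shows "\<exists>t\<in>{a..b}. curve_length \<gamma> a t = ennreal s"
proof -
  have ab: "a \<le> b" and c: "continuous_on {a..b} \<gamma>" and fin: "curve_length \<gamma> a b < \<infinity>"
    using r by (auto simp: rectifiable_curve_def)
  define V where "V t = curve_length \<gamma> a t" for t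
  define P where "P = {t\<in>{a..b}. V t \<le> ennreal s}"
  define t0 where "t0 = Sup P"
  have aP: "a \<in> P" using ab by (auto simp: P_def V_def)
  have bdd: "bdd_above P" by (auto simp: P_def)
  have t0: "a \<le> t0" "t0 \<le> b"
    using aP bdd unfolding t0_def by (auto intro!: cSup_upper cSup_least simp: P_def)
  have le: "V t0 \<le> ennreal s"
  proof (rule ccontr)
    assume "\<not> ?thesis"
    then have *: "ennreal s < curve_length \<gamma> a t0" by (simp add: V_def)
    then have "a < t0" using t0 by (cases "a = t0") auto
    then obtain \<delta> where \<delta>: "0 < \<delta>" "a + \<delta> \<le> t0 - \<delta>" "ennreal s < curve_length \<gamma> (a + \<delta>) (t0 - \<delta>)"
      using curve_length_interior[OF continuous_on_subset[OF c] _ *] t0 by auto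
    obtain t where t: "t \<in> P" "t0 - \<delta> < t"
      using less_cSup_iff[OF _ bdd, of "t0 - \<delta>"] aP \<delta>(1) unfolding t0_def by auto
    have "curve_length \<gamma> (a + \<delta>) (t0 - \<delta>) \<le> V t"
      unfolding V_def using \<delta> t by (intro curve_length_mono) auto
    then show False using t \<delta> by (auto simp: P_def)
  qed
  have "V t0 = ennreal s"
  proof (rule ccontr)
    assume "V t0 \<noteq> ennreal s"
    then have lt: "V t0 < ennreal s" using le by auto
    \<comment> \<open>If the value at \<open>t0\<close> fell short by \<open>e\<close>, every
      interval to the right of \<open>t0\<close> would have length above \<open>e\<close>, and
      cutting off a short one would lose more than \<open>curve_length_interior\<close>
      allows.\<close>
    define e where "e = ennreal s - V t0"
    have e: "0 < e" "V t0 + e = ennreal s"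
      using lt by (auto simp: e_def diff_gr0_ennreal ennreal_diff_add_assoc intro: diff_add_cancel_ennreal less_imp_le add_diff_inverse_ennreal)
    have "t0 \<noteq> b" using lt s by (auto simp: V_def)
    then have t0b: "t0 < b" using t0 by auto
    have far: "e < curve_length \<gamma> t0 t" if "t0 < t" "t \<le> b" for t
    proof -
      have "t \<notin> P" using that bdd cSup_upper[of t P] by (auto simp: t0_def)
      then have "ennreal s < V t" using that t0 by (auto simp: P_def)
      then have "V t0 + e < V t0 + curve_length \<gamma> t0 t"
        using curve_length_add[of a t0 t \<gamma>] t0 that e by (simp add: V_def)
      then show ?thesis by (metis add_left_mono not_le)
    qed
    define D where "D = curve_length \<gamma> t0 b"
    have D: "D < \<infinity>" using curve_length_mono[of a t0 b b \<gamma>] t0 fin by (auto simp: D_def intro: le_less_trans)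
    have "e < D" using far t0b by (auto simp: D_def)
    then have "D - e < D" using e D by (intro ennreal_between) auto
    then obtain \<delta> where \<delta>: "0 < \<delta>" "t0 + \<delta> \<le> b - \<delta>" "D - e < curve_length \<gamma> (t0 + \<delta>) (b - \<delta>)"
      using curve_length_interior[OF continuous_on_subset[OF c] t0b, of "D - e"] t0 unfolding D_def by auto
    have "D = curve_length \<gamma> t0 (t0 + \<delta>) + curve_length \<gamma> (t0 + \<delta>) b"
      unfolding D_def using \<delta> by (intro curve_length_add) auto
    moreover have "curve_length \<gamma> (t0 + \<delta>) (b - \<delta>) \<le> curve_length \<gamma> (t0 + \<delta>) b"
      using \<delta> by (intro curve_length_mono) auto
    moreover have "e < curve_length \<gamma> t0 (t0 + \<delta>)" using far \<delta> by auto
    ultimately have "e + (D - e) < D"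
      using \<delta>(3) D by (metis add_strict_mono order_less_le_trans)
    then show False using \<open>e < D\<close> by (simp add: add_diff_inverse_ennreal less_imp_le)
  qed
  then show ?thesis using t0 by (auto simp: V_def)
qed


section \<open>Parametrization by arc length and Lipschitz curves\<close>

text \<open>\<open>U\<close> is the choice made inside \<open>arc_length_reparam\<close>, a right
  inverse of the length function \<open>V\<close>. As \<open>V\<close> controls distances on the
  curve, \<open>\<eta>\<close> takes the same value whichever parameter is chosen.\<close>

lemma reparam_props:
  assumes r: "rectifiable_curve S \<gamma> a b"
    and L_def: "L = enn2real (curve_length \<gamma> a b)" and \<eta>_def: "\<eta> = arc_length_reparam \<gamma> a b"
    and V_def: "V = (\<lambda>t. enn2real (curve_length \<gamma> a t))"
  obtains U where "\<And>s. s \<in> {0..L} \<Longrightarrow> U s \<in> {a..b} \<and> V (U s) = s \<and> \<eta> s = \<gamma> (U s)"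
    "\<And>s t. s \<in> {a..b} \<Longrightarrow> t \<in> {a..b} \<Longrightarrow> dist (\<gamma> s) (\<gamma> t) \<le> \<bar>V s - V t\<bar>"
    "\<And>t. t \<in> {a..b} \<Longrightarrow> V t \<in> {0..L}"
    "\<And>s t. a \<le> s \<Longrightarrow> s \<le> t \<Longrightarrow> t \<le> b \<Longrightarrow> curve_length \<gamma> s t = ennreal (V t - V s)"
    "V a = 0" "V b = L"
    "\<And>t. t \<in> {a..b} \<Longrightarrow> \<eta> (V t) = \<gamma> t"
proof -
  have ab: "a \<le> b" and fin: "curve_length \<gamma> a b < \<infinity>"
    using r by (auto simp: rectifiable_curve_def)
  have finV: "curve_length \<gamma> s t < \<infinity>" if "a \<le> s" "t \<le> b" for s t
    using curve_length_mono[of a s t b \<gamma>] that fin by (auto intro: le_less_trans)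
  define U where "U s = (SOME t. t \<in> {a..b} \<and> curve_length \<gamma> a t = ennreal s)" for s
  have eV: "ennreal (V t) = curve_length \<gamma> a t" if "t \<le> b" for t
    unfolding V_def using finV[of a t] that by (intro ennreal_enn2real) auto
  have U1: "U s \<in> {a..b} \<and> curve_length \<gamma> a (U s) = ennreal s" if "s \<in> {0..L}" for s
    unfolding U_def
  proof (rule someI_ex)
    have "ennreal s \<le> ennreal L" using that by (intro ennreal_leI) auto
    also have "ennreal L = curve_length \<gamma> a b" unfolding L_def using fin by (intro ennreal_enn2real) auto
    finally have "ennreal s \<le> curve_length \<gamma> a b" .
    then show "\<exists>t. t \<in> {a..b} \<and> curve_length \<gamma> a t = ennreal s"
      using curve_length_attained[OF r, of s] that by auto
  qed
  have U: "U s \<in> {a..b} \<and> V (U s) = s \<and> \<eta> s = \<gamma> (U s)" if "s \<in> {0..L}" for s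
    using U1[OF that] that by (auto simp: V_def \<eta>_def arc_length_reparam_def U_def)
  have mono: "V s \<le> V t" if "s \<le> t" "t \<le> b" for s t
    using curve_length_mono[of a a s t \<gamma>] that finV[of a t] unfolding V_def by (intro enn2real_mono) auto
  have cl: "curve_length \<gamma> s t = ennreal (V t - V s)" if "a \<le> s" "s \<le> t" "t \<le> b" for s t
  proof -
    have "ennreal (V s) + curve_length \<gamma> s t = ennreal (V t)"
      using curve_length_add[of a s t \<gamma>] that by (simp add: eV)
    then have "ennreal (V s) + curve_length \<gamma> s t = ennreal (V s) + ennreal (V t - V s)"
      using mono[of s t] that by (simp flip: ennreal_plus add: V_def)
    then show ?thesis by (simp add: ennreal_add_left_cancel)
  qed
  have d1: "dist (\<gamma> s) (\<gamma> t) \<le> V t - V s" if "a \<le> s" "s \<le> t" "t \<le> b" for s t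
    using dist_le_curve_length[of s s t t \<gamma>] cl[of s t] that mono[of s t] by (simp add: ennreal_le_iff)
  have d: "dist (\<gamma> s) (\<gamma> t) \<le> \<bar>V s - V t\<bar>" if "s \<in> {a..b}" "t \<in> {a..b}" for s t
    using d1[of s t] d1[of t s] that by (cases "s \<le> t") (auto simp: dist_commute)
  have V0L: "V t \<in> {0..L}" if "t \<in> {a..b}" for t
    using mono[of t b] that by (auto simp: V_def L_def)
  have "\<eta> (V t) = \<gamma> t" if "t \<in> {a..b}" for t
    using d[of "U (V t)" t] U[OF V0L[OF that]] that by simp
  moreover have "V a = 0" "V b = L" by (simp_all add: V_def L_def)
  ultimately show ?thesis
    using U d V0L cl by (intro that[of U])
qed

text \<open>Curves of this kind are defined on all of \<open>\<real>\<close>, and only their restriction to \<open>{0..T}\<close> matters.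
  They may stand still, so their cost is in general larger than the integral by arc length; this
  class of curves, unlike the arc length parametrized ones, is closed under pointwise limits.\<close>

definition lip_curve :: "'a::metric_space set \<Rightarrow> (real \<Rightarrow> 'a) \<Rightarrow> real \<Rightarrow> bool" where
  "lip_curve S \<gamma> T \<longleftrightarrow> 0 \<le> T \<and> range \<gamma> \<subseteq> S \<and> (\<forall>s t. dist (\<gamma> s) (\<gamma> t) \<le> \<bar>s - t\<bar>)"

definition cost :: "('a \<Rightarrow> ennreal) \<Rightarrow> (real \<Rightarrow> 'a) \<Rightarrow> real \<Rightarrow> ennreal" where
  "cost \<rho> \<gamma> T = (\<integral>\<^sup>+t\<in>{0..T}. \<rho> (\<gamma> t) \<partial>lborel)"

lemma clamp_dist: "\<bar>max 0 (min L s) - max 0 (min L t)\<bar> \<le> \<bar>s - t\<bar>" for L s t :: real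
  by (auto simp: max_def min_def)

text \<open>Serves where all rectifiable curves have to be considered, as for upper gradients: a
  single Lipschitz curve represents the given one for all densities at once.\<close>

lemma rectifiable_curve_lip:
  assumes r: "rectifiable_curve S \<gamma> a b"
  obtains \<eta> T where "lip_curve S \<eta> T" "\<eta> 0 = \<gamma> a" "\<eta> T = \<gamma> b"
    "\<And>\<rho>. curve_integral \<rho> \<gamma> a b = cost \<rho> \<eta> T"
proof -
  define L where "L = enn2real (curve_length \<gamma> a b)"
  define \<eta> where "\<eta> = arc_length_reparam \<gamma> a b"
  define V where "V = (\<lambda>t. enn2real (curve_length \<gamma> a t))"
  have S: "\<gamma> ` {a..b} \<subseteq> S" and ab: "a \<le> b" using r by (auto simp: rectifiable_curve_def)
  obtain U where U: "\<And>s. s \<in> {0..L} \<Longrightarrow> U s \<in> {a..b} \<and> V (U s) = s \<and> \<eta> s = \<gamma> (U s)"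
    and d: "\<And>s t. s \<in> {a..b} \<Longrightarrow> t \<in> {a..b} \<Longrightarrow> dist (\<gamma> s) (\<gamma> t) \<le> \<bar>V s - V t\<bar>"
    and V0L: "\<And>t. t \<in> {a..b} \<Longrightarrow> V t \<in> {0..L}"
    and cl: "\<And>s t. a \<le> s \<Longrightarrow> s \<le> t \<Longrightarrow> t \<le> b \<Longrightarrow> curve_length \<gamma> s t = ennreal (V t - V s)"
    and V: "V a = 0" "V b = L" and \<eta>V: "\<And>t. t \<in> {a..b} \<Longrightarrow> \<eta> (V t) = \<gamma> t"
    by (rule reparam_props[OF r L_def \<eta>_def V_def]) (rule that; assumption)
  have L: "0 \<le> L" by (simp add: L_def)
  \<comment> \<open>Clamping the parameter extends the arc length parametrization to the whole line
    by its end values.\<close>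
  define c where "c s = max 0 (min L s)" for s
  have c: "c s \<in> {0..L}" for s using L by (auto simp: c_def)
  have "dist (\<eta> (c s)) (\<eta> (c t)) \<le> \<bar>s - t\<bar>" for s t
  proof -
    have "dist (\<eta> (c s)) (\<eta> (c t)) \<le> \<bar>c s - c t\<bar>"
      using d[of "U (c s)" "U (c t)"] U[OF c[of s]] U[OF c[of t]] by metis
    also have "\<dots> \<le> \<bar>s - t\<bar>" unfolding c_def by (rule clamp_dist)
    finally show ?thesis .
  qed
  moreover have "\<eta> (c s) \<in> S" for s using U[OF c[of s]] S by auto
  ultimately have "lip_curve S (\<eta> \<circ> c) L" using L by (auto simp: lip_curve_def)
  moreover have "c 0 = 0" "c L = L" using L by (auto simp: c_def)
  then have "(\<eta> \<circ> c) 0 = \<gamma> a" "(\<eta> \<circ> c) L = \<gamma> b"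
    using \<eta>V[of a] \<eta>V[of b] V ab by auto
  moreover have "curve_integral \<rho> \<gamma> a b = cost \<rho> (\<eta> \<circ> c) L" for \<rho>
    unfolding curve_integral_def cost_def L_def[symmetric] \<eta>_def[symmetric]
    by (intro nn_integral_cong) (auto simp: c_def indicator_def)
  ultimately show ?thesis using that by blast
qed

text \<open>If \<open>G\<close> is the distribution function of \<open>\<nu>\<close>, then \<open>x - G x\<close> is nondecreasing, and \<open>\<nu>\<close> and its
  interval measure add up to Lebesgue measure.\<close>

lemma nonexpanding_le_lborel:
  assumes \<nu>: "finite_measure \<nu>" "sets \<nu> = sets borel"
    and le: "\<And>c d::real. c \<le> d \<Longrightarrow> emeasure \<nu> {c<..d} \<le> ennreal (d - c)"
    and A: "A \<in> sets borel"
  shows "emeasure \<nu> A \<le> emeasure lborel A"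
proof -
  interpret finite_measure \<nu> by fact
  note [simp] = \<nu>(2)
  have [simp]: "space \<nu> = UNIV" using sets_eq_imp_space_eq[OF \<nu>(2)] by simp
  define G where "G x = measure \<nu> {..x}" for x
  have G: "G d - G c = measure \<nu> {c<..d}" if "c \<le> d" for c d
    using finite_measure_Union[of "{..c}" "{c<..d}"] that by (auto simp: G_def ivl_disj_un ivl_disj_int)
  have Gle: "G d - G c \<le> d - c" if "c \<le> d" for c d
    using le[OF that] that by (auto simp: G emeasure_eq_measure)
  have G0: "0 \<le> G d - G c" if "c \<le> d" for c d using G[OF that] by simp
  define K where "K x = x - G x" for x
  have Kmono: "K c \<le> K d" if "c \<le> d" for c d using Gle[OF that] by (simp add: K_def)
  have lipG: "1-lipschitz_on UNIV G"
  proof (rule lipschitz_onI)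
    show "dist (G x) (G y) \<le> 1 * dist x y" for x y
      using Gle[of x y] Gle[of y x] G0[of x y] G0[of y x] by (cases "x \<le> y") (auto simp: dist_real_def)
  qed simp
  have cK: "continuous_on UNIV K" unfolding K_def
    by (intro continuous_intros lipschitz_on_continuous_on[OF lipG])
  define \<kappa> where "\<kappa> = interval_measure K"
  have \<kappa>: "emeasure \<kappa> {c..d} = ennreal (K d - K c)" if "c \<le> d" for c d
    unfolding \<kappa>_def by (rule emeasure_interval_measure_Icc[OF that Kmono cK])
  define \<sigma> where "\<sigma> = measure_of UNIV (sets borel) (\<lambda>A. emeasure \<nu> A + emeasure \<kappa> A)"
  have sk[simp]: "sets \<kappa> = sets borel" by (simp add: \<kappa>_def)
  have \<sigma>: "emeasure \<sigma> B = emeasure \<nu> B + emeasure \<kappa> B" if "B \<in> sets borel" for B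
    unfolding \<sigma>_def
  proof (rule emeasure_measure_of[OF refl])
    show "countably_additive (sets (measure_of UNIV (sets borel) (\<lambda>A. emeasure \<nu> A + emeasure \<kappa> A)))
       (\<lambda>A. emeasure \<nu> A + emeasure \<kappa> A)"
      by (auto simp: countably_additive_def suminf_add[symmetric] suminf_emeasure sets.sigma_sets_eq
        simp flip: space_borel)
  qed (use that in \<open>auto simp: positive_def sets.sigma_sets_eq simp flip: space_borel dest: sets.sets_into_space\<close>)
  \<comment> \<open>Atoms are excluded separately, because \<open>\<nu>\<close> is controlled on
    half-open intervals and \<open>lborel_eqI\<close> asks for open ones.\<close>
  have pt: "emeasure \<nu> {u} = 0" for u
  proof -
    have "measure \<nu> {u} \<le> e" if "e > 0" for e
    proof -
      have "measure \<nu> {u} \<le> measure \<nu> {u - e<..u}" using that by (intro finite_measure_mono) auto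
      also have "\<dots> \<le> e" using le[of "u - e" u] that by (simp add: emeasure_eq_measure)
      finally show ?thesis .
    qed
    then have "measure \<nu> {u} \<le> 0" by (meson dense_ge)
    then show ?thesis by (simp add: emeasure_eq_measure measure_le_0_iff)
  qed
  have "lborel = \<sigma>"
  proof (rule lborel_eqI)
    show "sets \<sigma> = sets borel" unfolding \<sigma>_def
      by (simp add: sets.sigma_sets_eq flip: space_borel)
    fix l u :: real assume "\<And>b. b \<in> Basis \<Longrightarrow> l \<bullet> b \<le> u \<bullet> b"
    then have lu: "l \<le> u" by simp
    have "emeasure \<nu> {l<..<u} = emeasure \<nu> {l<..u}"
    proof (cases "l < u")
      case True
      then have "{l<..u} = {l<..<u} \<union> {u}" by auto
      then show ?thesis using plus_emeasure[of "{l<..<u}" \<nu> "{u}"] pt by auto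
    qed (use lu in auto)
    also have "\<dots> = ennreal (G u - G l)" using lu by (simp add: G emeasure_eq_measure)
    finally have 1: "emeasure \<nu> {l<..<u} = ennreal (G u - G l)" .
    have k0: "emeasure \<kappa> {x} = 0" for x using \<kappa>[of x x] by simp
    have "emeasure \<kappa> {l<..<u} = emeasure \<kappa> ({l..u})"
    proof (cases "l < u")
      case True
      then have "{l..u} = {l<..<u} \<union> {l,u}" by auto
      moreover have "emeasure \<kappa> {l,u} = 0"
      proof -
        have "{l} \<union> {u} \<in> null_sets \<kappa>" by (intro null_sets.Un null_setsI) (auto simp: k0)
        then show ?thesis by (auto simp: null_sets_def insert_commute)
      qed
      ultimately show ?thesis using emeasure_Un_null_set[of "{l<..<u}" \<kappa> "{l,u}"]
        by (auto simp: null_sets_def)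
    qed (use lu k0 in auto)
    then have 2: "emeasure \<kappa> {l<..<u} = ennreal (K u - K l)" using \<kappa>[OF lu] by simp
    have "emeasure \<sigma> {l<..<u} = ennreal (u - l)"
      using 1 2 G0[OF lu] Kmono[OF lu] by (simp add: \<sigma> ennreal_plus[symmetric] K_def del: ennreal_plus)
    then show "emeasure \<sigma> (box l u) = (\<Prod>b\<in>Basis. (u - l) \<bullet> b)" by (simp add: box_real)
  qed
  then show ?thesis using \<sigma>[OF A] by simp
qed


lemma lip_curve_curve_length:
  assumes lip: "\<And>s t. s \<in> {a..b} \<Longrightarrow> t \<in> {a..b} \<Longrightarrow> dist (\<gamma> s) (\<gamma> t) \<le> \<bar>s - t\<bar>" and "a \<le> b"
  shows "curve_length \<gamma> a b \<le> ennreal (b - a)"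
proof (rule curve_length_least)
  fix n :: nat and t :: "nat \<Rightarrow> real"
  assume 1: "\<And>i. i \<le> n \<Longrightarrow> t i \<in> {a..b}" and 2: "\<And>i. i < n \<Longrightarrow> t i \<le> t (Suc i)"
  have "chord_sum \<gamma> t n \<le> (\<Sum>i<n. ennreal (t (Suc i) - t i))"
  proof (intro sum_mono ennreal_leI)
    fix i assume "i \<in> {..<n}"
    then show "dist (\<gamma> (t i)) (\<gamma> (t (Suc i))) \<le> t (Suc i) - t i"
      using lip[of "t i" "t (Suc i)"] 1[of i] 1[of "Suc i"] 2[of i] by simp
  qed
  also have "\<dots> = ennreal (\<Sum>i<n. t (Suc i) - t i)"
    using 2 by (intro sum_ennreal) auto
  also have "(\<Sum>i<n. t (Suc i) - t i) = t n - t 0" by (rule sum_lessThan_telescope)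
  also have "ennreal \<dots> \<le> ennreal (b - a)" using 1[of n] 1[of 0] by (intro ennreal_leI) auto
  finally show "chord_sum \<gamma> t n \<le> ennreal (b - a)" .
qed

lemma lip_curve_continuous:
  assumes "lip_curve S \<gamma> T" shows "continuous_on A \<gamma>"
proof -
  have "1-lipschitz_on A \<gamma>" using assms by (intro lipschitz_onI) (auto simp: lip_curve_def dist_real_def)
  then show ?thesis by (rule lipschitz_on_continuous_on)
qed

lemma lip_curve_measurable:
  assumes "lip_curve S \<gamma> T" "\<rho> \<in> borel_on S"
  shows "(\<lambda>t. \<rho> (\<gamma> t)) \<in> borel_measurable borel"
proof -
  have "\<gamma> \<in> borel_measurable borel"
    using lip_curve_continuous[OF assms(1)] by (rule borel_measurable_continuous_onI)
  moreover have "range \<gamma> \<subseteq> S" using assms(1) by (auto simp: lip_curve_def)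
  ultimately have "\<gamma> \<in> measurable borel (restrict_space borel S)" by (intro measurable_restrict_space2) auto
  then show ?thesis using assms(2) by (rule measurable_compose)
qed

text \<open>Passing to arc length only speeds the curve up: the inverse \<open>U\<close> of the
  length function is expanding, so it carries Lebesgue measure on \<open>{0..L}\<close> to a measure
  below Lebesgue measure, and the integral does not grow.\<close>

lemma induced_length_le_cost:
  assumes l: "lip_curve S \<gamma> T" and f: "f \<in> borel_on S"
  shows "induced_length S f (\<gamma> 0) (\<gamma> T) \<le> cost (\<lambda>z. ennreal (f z)) \<gamma> T"
proof (cases "cost (\<lambda>z. ennreal (f z)) \<gamma> T = \<infinity>")
  case False
  have T: "0 \<le> T" and S: "range \<gamma> \<subseteq> S" and lip: "\<And>s t. dist (\<gamma> s) (\<gamma> t) \<le> \<bar>s - t\<bar>"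
    using l by (auto simp: lip_curve_def)
  have r: "rectifiable_curve S \<gamma> 0 T"
    unfolding rectifiable_curve_def using T S lip_curve_continuous[OF l] lip_curve_curve_length[OF lip T]
    by (auto intro: le_less_trans)
  define L where "L = enn2real (curve_length \<gamma> 0 T)"
  define \<eta> where "\<eta> = arc_length_reparam \<gamma> 0 T"
  define V where "V = (\<lambda>t. enn2real (curve_length \<gamma> 0 t))"
  obtain U where U: "\<And>s. s \<in> {0..L} \<Longrightarrow> U s \<in> {0..T} \<and> V (U s) = s \<and> \<eta> s = \<gamma> (U s)"
    and d: "\<And>s t. s \<in> {0..T} \<Longrightarrow> t \<in> {0..T} \<Longrightarrow> dist (\<gamma> s) (\<gamma> t) \<le> \<bar>V s - V t\<bar>"
    and V0L: "\<And>t. t \<in> {0..T} \<Longrightarrow> V t \<in> {0..L}"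
    and cl: "\<And>s t. 0 \<le> s \<Longrightarrow> s \<le> t \<Longrightarrow> t \<le> T \<Longrightarrow> curve_length \<gamma> s t = ennreal (V t - V s)"
    and V: "V 0 = 0" "V T = L" and \<eta>V: "\<And>t. t \<in> {0..T} \<Longrightarrow> \<eta> (V t) = \<gamma> t"
    by (rule reparam_props[OF r L_def \<eta>_def V_def]) (rule that; assumption)
  have L: "0 \<le> L" by (simp add: L_def)
  have Vmono: "V s \<le> V t" if "0 \<le> s" "s \<le> t" "t \<le> T" for s t
    unfolding V_def
  proof (rule enn2real_mono)
    show "curve_length \<gamma> 0 s \<le> curve_length \<gamma> 0 t" using that by (intro curve_length_mono) auto
    have "curve_length \<gamma> 0 t \<le> curve_length \<gamma> 0 T" using that by (intro curve_length_mono) auto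
    then show "curve_length \<gamma> 0 t < top" using r by (auto simp: rectifiable_curve_def intro: le_less_trans)
  qed
  have Vlip: "V t - V s \<le> t - s" if "0 \<le> s" "s \<le> t" "t \<le> T" for s t
  proof -
    have "ennreal (V t - V s) \<le> ennreal (t - s)"
      using cl[OF that] lip_curve_curve_length[OF lip that(2)] by simp
    then show ?thesis using that by (simp add: ennreal_le_iff)
  qed
  have \<eta>lip: "dist (\<eta> s) (\<eta> t) \<le> \<bar>s - t\<bar>" if "s \<in> {0..L}" "t \<in> {0..L}" for s t
    using d[of "U s" "U t"] U[OF that(1)] U[OF that(2)] by metis
  have Umono: "U s < U t" if "s \<in> {0..L}" "t \<in> {0..L}" "s < t" for s t
  proof (rule ccontr)
    assume "\<not> U s < U t"
    then have "V (U t) \<le> V (U s)" using U[OF that(1)] U[OF that(2)] by (intro Vmono) auto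
    then show False using U[OF that(1)] U[OF that(2)] that by simp
  qed
  have Uexp: "t - s \<le> U t - U s" if "s \<in> {0..L}" "t \<in> {0..L}" "s \<le> t" for s t
  proof (cases "s = t")
    case False
    then have "U s \<le> U t" using Umono[OF that(1,2)] that by simp
    then show ?thesis using Vlip[of "U s" "U t"] U[OF that(1)] U[OF that(2)] by simp
  qed simp
  have \<eta>cl: "curve_length \<eta> s t = ennreal (t - s)" if "0 \<le> s" "s \<le> t" "t \<le> L" for s t
  proof (rule antisym)
    have st: "s \<in> {0..L}" "t \<in> {0..L}" using that by auto
    show "curve_length \<eta> s t \<le> ennreal (t - s)"
      using that by (intro lip_curve_curve_length \<eta>lip) auto
    have Ust: "U s \<le> U t" using Uexp[OF st] that by simp
    have "ennreal (t - s) = curve_length \<gamma> (U s) (U t)"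
      using cl[of "U s" "U t"] U[OF st(1)] U[OF st(2)] Ust by simp
    also have "\<dots> \<le> curve_length \<eta> s t"
    proof (rule curve_length_least)
      fix n :: nat and p :: "nat \<Rightarrow> real"
      assume 1: "\<And>i. i \<le> n \<Longrightarrow> p i \<in> {U s..U t}" and 2: "\<And>i. i < n \<Longrightarrow> p i \<le> p (Suc i)"
      have p: "p i \<in> {0..T}" if "i \<le> n" for i using 1[OF that] U[OF st(1)] U[OF st(2)] by auto
      have "chord_sum \<gamma> p n = (\<Sum>i<n. ennreal (dist (\<eta> (V (p i))) (\<eta> (V (p (Suc i))))))"
        using p \<eta>V by (intro sum.cong) auto
      also have "\<dots> \<le> curve_length \<eta> s t"
      proof (rule curve_length_ge_sum[where t="\<lambda>i. V (p i)"])
        show "V (p i) \<in> {s..t}" if "i \<le> n" for i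
          using Vmono[of "U s" "p i"] Vmono[of "p i" "U t"] 1[OF that] p[OF that] U[OF st(1)] U[OF st(2)] by auto
        show "V (p i) \<le> V (p (Suc i))" if "i < n" for i
          using 2[OF that] p[of i] p[of "Suc i"] that by (intro Vmono) auto
      qed
      finally show "chord_sum \<gamma> p n \<le> curve_length \<eta> s t" .
    qed
    finally show "ennreal (t - s) \<le> curve_length \<eta> s t" .
  qed
  have \<eta>S: "\<eta> ` {0..L} \<subseteq> S" using U S by auto
  have "1-lipschitz_on {0..L} \<eta>" using \<eta>lip by (intro lipschitz_onI) (auto simp: dist_real_def)
  then have \<eta>cont: "continuous_on {0..L} \<eta>" by (rule lipschitz_on_continuous_on)
  have alp: "arc_length_parametrized \<eta> L" using \<eta>cl by (auto simp: arc_length_parametrized_def)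
  have r\<eta>: "rectifiable_curve S \<eta> 0 L"
    using L \<eta>cont \<eta>S \<eta>cl[of 0 L] by (auto simp: rectifiable_curve_def)
  \<comment> \<open>The length function of \<open>\<eta>\<close> is the identity, so the choice in
    \<open>arc_length_reparam\<close> is forced and reparametrizing \<open>\<eta>\<close> returns
    it.\<close>
  have self: "arc_length_reparam \<eta> 0 L s = \<eta> s" if "s \<in> {0..L}" for s
  proof -
    have "(SOME t. t \<in> {0..L} \<and> curve_length \<eta> 0 t = ennreal s) = s"
      by (rule some_equality) (use that \<eta>cl in auto)
    then show ?thesis by (simp add: arc_length_reparam_def)
  qed
  define W where "W s = (if s \<in> {0..L} then U s else 0)" for s
  have W: "W \<in> borel_measurable (restrict_space borel {0..L})"
  proof (rule borel_measurable_mono_on_fnc)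
    show "mono_on {0..L} W"
    proof (rule mono_onI)
      fix s t assume "s \<in> {0..L}" "t \<in> {0..L}" "s \<le> t"
      then show "W s \<le> W t" using Uexp[of s t] by (simp add: W_def)
    qed
  qed
  define m where "m = restrict_space lborel {0..L}"
  have "finite_measure m" unfolding m_def
    by (intro finite_measureI) (simp add: space_restrict_space emeasure_restrict_space L)
  have Wm: "W \<in> measurable m borel" unfolding m_def using W by (simp add: measurable_def sets_restrict_space space_restrict_space)
  define \<nu> where "\<nu> = distr m borel W"
  have \<nu>fin: "finite_measure \<nu>" unfolding \<nu>_def using \<open>finite_measure m\<close> Wm by (rule finite_measure.finite_measure_distr)
  have \<nu>le: "emeasure \<nu> {c<..d} \<le> ennreal (d - c)" if "c \<le> d" for c d
  proof -
    \<comment> \<open>By \<open>Uexp\<close> two points of \<open>X\<close> are at most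
      \<open>d - c\<close> apart, so \<open>X\<close> lies in an interval of that length.\<close>
    define X where "X = {s\<in>{0..L}. c < U s \<and> U s \<le> d}"
    have "W -` {c<..d} \<inter> space m = X" by (auto simp: X_def m_def W_def space_restrict_space)
    then have "emeasure \<nu> {c<..d} = emeasure m X" unfolding \<nu>_def using Wm by (subst emeasure_distr) auto
    also have "\<dots> = emeasure lborel X" unfolding m_def
      by (rule emeasure_restrict_space) (auto simp: X_def)
    also have "\<dots> \<le> ennreal (d - c)"
    proof (cases "X = {}")
      case False
      have bdd: "bdd_above X" "bdd_below X" by (auto simp: X_def)
      have "Sup X - Inf X \<le> d - c"
      proof -
        have "s \<le> t + (d - c)" if "s \<in> X" "t \<in> X" for s t
          using Uexp[of t s] that \<open>c \<le> d\<close> by (cases "t \<le> s") (auto simp: X_def)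
        then have "Sup X \<le> t + (d - c)" if "t \<in> X" for t using False that by (intro cSup_least) auto
        then have "Sup X - (d - c) \<le> Inf X" using False by (intro cInf_greatest) (auto simp: algebra_simps)
        then show ?thesis by simp
      qed
      moreover have "X \<subseteq> {Inf X..Sup X}" using bdd by (auto intro: cInf_lower cSup_upper)
      moreover have "Inf X \<le> Sup X" using False bdd by (meson cInf_le_cSup)
      ultimately have "emeasure lborel X \<le> ennreal (Sup X - Inf X)"
        by (metis emeasure_lborel_Icc emeasure_mono sets_lborel borel_closed closed_real_atLeastAtMost)
      then show ?thesis using \<open>Sup X - Inf X \<le> d - c\<close> by (meson ennreal_leI order.trans)
    qed simp
    finally show ?thesis .
  qed
  have \<nu>sets: "sets \<nu> = sets borel" by (simp add: \<nu>_def)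
  have le: "emeasure \<nu> A \<le> emeasure lborel A" for A
    using nonexpanding_le_lborel[OF \<nu>fin \<nu>sets \<nu>le, of A] \<nu>sets
    by (cases "A \<in> sets borel") (auto simp: emeasure_notin_sets)
  have "\<nu> \<le> lborel"
    using le \<nu>sets by (subst le_measure) (auto simp: le_fun_def)
  define F where "F t = ennreal (f (\<gamma> t)) * indicator {0..T} t" for t
  have [measurable]: "(\<lambda>t. f (\<gamma> t)) \<in> borel_measurable borel" by (rule lip_curve_measurable[OF l f])
  have F: "F \<in> borel_measurable borel" unfolding F_def by measurable
  have "curve_integral (\<lambda>z. ennreal (f z)) \<eta> 0 L = (\<integral>\<^sup>+s\<in>{0..L}. F (W s) \<partial>lborel)"
    unfolding curve_integral_def using \<eta>cl[of 0 L] L U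
    by (intro nn_integral_cong) (auto simp: self F_def W_def indicator_def)
  also have "\<dots> = (\<integral>\<^sup>+s. F (W s) \<partial>m)"
    unfolding m_def by (simp add: nn_integral_restrict_space)
  also have "\<dots> = (\<integral>\<^sup>+t. F t \<partial>\<nu>)"
    unfolding \<nu>_def using Wm F by (subst nn_integral_distr) auto
  also have "\<dots> \<le> (\<integral>\<^sup>+t. F t \<partial>lborel)"
    using \<nu>sets \<open>\<nu> \<le> lborel\<close> by (intro nn_integral_mono_measure) auto
  also have "\<dots> = cost (\<lambda>z. ennreal (f z)) \<gamma> T" by (simp add: cost_def F_def)
  finally have *: "curve_integral (\<lambda>z. ennreal (f z)) \<eta> 0 L \<le> cost (\<lambda>z. ennreal (f z)) \<gamma> T" .
  have "\<eta> 0 = \<gamma> 0" "\<eta> L = \<gamma> T" using \<eta>V[of 0] \<eta>V[of T] V T by auto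
  then have "(\<eta>, L) \<in> admissible_curves S f (\<gamma> 0) (\<gamma> T)"
    using r\<eta> alp * False by (auto simp: admissible_curves_def less_top[symmetric] top_unique)
  then have "induced_length S f (\<gamma> 0) (\<gamma> T) \<le> curve_integral (\<lambda>z. ennreal (f z)) \<eta> 0 L"
    unfolding induced_length_def by (rule INF_lower2) simp
  with * show ?thesis by simp
qed simp

section \<open>Compactness of Lipschitz curves\<close>

text \<open>Sequential, because it meets Fatou's lemma along sequences of curves, and relative to
  \<open>S\<close>, because the majorant of \<open>f\<close> is only constrained there.\<close>

definition seq_lsc :: "'a::topological_space set \<Rightarrow> ('a \<Rightarrow> ennreal) \<Rightarrow> bool" where
  "seq_lsc S \<phi> \<longleftrightarrow> (\<forall>X x. range X \<subseteq> S \<longrightarrow> x \<in> S \<longrightarrow> X \<longlonglongrightarrow> x \<longrightarrow> \<phi> x \<le> liminf (\<lambda>n. \<phi> (X n)))"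

lemma seq_lscD: "seq_lsc S \<phi> \<Longrightarrow> (\<And>n::nat. X n \<in> S) \<Longrightarrow> x \<in> S \<Longrightarrow> X \<longlonglongrightarrow> x \<Longrightarrow> \<phi> x \<le> liminf (\<lambda>n. \<phi> (X n))"
  unfolding seq_lsc_def by blast

lemma seq_lsc_const: "seq_lsc S (\<lambda>_. c)"
  by (simp add: seq_lsc_def Liminf_const)

lemma seq_lsc_cmult_indicator:
  fixes S :: "'a::topological_space set"
  assumes "open V" shows "seq_lsc S (\<lambda>x. c * indicator V x)"
  unfolding seq_lsc_def
proof (intro allI impI)
  fix X :: "nat \<Rightarrow> 'a" and x assume X: "X \<longlonglongrightarrow> x"
  show "c * indicator V x \<le> liminf (\<lambda>n. c * indicator V (X n))"
  proof (cases "x \<in> V")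
    case True
    then have "\<forall>\<^sub>F n in sequentially. X n \<in> V" using X assms by (auto simp: topological_tendstoD)
    then have "\<forall>\<^sub>F n in sequentially. c \<le> c * indicator V (X n)" by eventually_elim simp
    then show ?thesis using True by (auto intro: Liminf_bounded)
  qed simp
qed

lemma seq_lsc_indicator: "open V \<Longrightarrow> seq_lsc S (indicator V)"
  using seq_lsc_cmult_indicator[of V S 1] by simp

lemma liminf_le_const:
  fixes f :: "nat \<Rightarrow> 'b::complete_linorder"
  assumes "\<forall>\<^sub>F n in sequentially. f n \<le> b" shows "liminf f \<le> b"
proof -
  have "liminf f \<le> limsup f" by (rule Liminf_le_Limsup) simp
  also have "\<dots> \<le> b" using assms by (rule Limsup_bounded)
  finally show ?thesis .
qed

text \<open>Arzela-Ascoli: Tychonoff's theorem gives convergence at the rational times, and the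
  common Lipschitz constant spreads it to all times. Since the curves live on the whole line, limits
  at a fixed time make sense although the \<open>T n\<close> vary.\<close>

lemma seq_compact_lip_curves:
  fixes S :: "'a::complete_space set" and T :: "nat \<Rightarrow> real"
  assumes S: "compact S" and g: "\<And>n. lip_curve S (\<gamma> n) (T n)" and T: "\<And>n. T n \<le> \<tau>"
  obtains r \<gamma>' T' where "strict_mono r" "lip_curve S \<gamma>' T'" "T' \<le> \<tau>"
    "\<And>t. (\<lambda>n. \<gamma> (r n) t) \<longlonglongrightarrow> \<gamma>' t" "(\<lambda>n. T (r n)) \<longlonglongrightarrow> T'"
proof -
  have lip: "dist (\<gamma> n s) (\<gamma> n t) \<le> \<bar>s - t\<bar>" and inS: "\<gamma> n s \<in> S" and T0: "0 \<le> T n" for n s t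
    using g[of n] by (auto simp: lip_curve_def)
  have "compact {0..\<tau>}" by simp
  then obtain T' r1 where r1: "T' \<in> {0..\<tau>}" "strict_mono r1" "(T \<circ> r1) \<longlonglongrightarrow> T'"
    unfolding compact_eq_seq_compact_metric
    by (rule seq_compactE[of _ T]) (use T T0 in auto)
  define q :: "nat \<Rightarrow> real" where "q = from_nat_into \<rat>"
  have q: "range q = \<rat>" unfolding q_def by (rule range_from_nat_into) (auto simp: countable_rat intro: Rats_0)
  \<comment> \<open>Sequences in \<open>S\<close> with one entry for each rational time; the
    countable product is metrizable, so its compactness yields convergent subsequences.\<close>
  define K where "K = {x::nat \<Rightarrow> 'a. \<forall>k. x k \<in> S}"
  have "compactin (product_topology (\<lambda>_. euclidean) UNIV) (PiE UNIV (\<lambda>_::nat. S))"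
    using S by (simp add: compactin_PiE)
  then have "compact (PiE UNIV (\<lambda>_::nat. S))"
    by (simp add: euclidean_product_topology)
  moreover have "PiE UNIV (\<lambda>_::nat. S) = K" by (auto simp: K_def PiE_def)
  ultimately have K: "compact K" by simp
  define X where "X n k = \<gamma> (r1 n) (q k)" for n k
  have "X n \<in> K" for n by (auto simp: X_def K_def inS)
  then obtain l r2 where r2: "strict_mono r2" "(X \<circ> r2) \<longlonglongrightarrow> l"
    using K unfolding compact_eq_seq_compact_metric seq_compact_def by metis
  define r where "r = r1 \<circ> r2"
  have r: "strict_mono r" using r1 r2 by (simp add: r_def strict_mono_o)
  have "(\<lambda>n. (X \<circ> r2) n k) \<longlonglongrightarrow> l k" for k
    by (rule continuous_on_tendsto_compose[OF continuous_on_product_coordinates r2(2)]) auto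
  then have qc: "convergent (\<lambda>n. \<gamma> (r n) (q k))" for k
    by (auto simp: convergent_def X_def r_def)
  have "Cauchy (\<lambda>n. \<gamma> (r n) t)" for t
  proof (rule metric_CauchyI)
    fix e :: real assume e: "e > 0"
    obtain p where p: "p \<in> \<rat>" "t < p" "p < t + e / 3" using Rats_dense_in_real[of t "t + e/3"] e by auto
    then obtain k where k: "q k = p" using q by (metis imageE)
    have "Cauchy (\<lambda>n. \<gamma> (r n) p)" using qc[of k] k by (simp add: convergent_Cauchy)
    then obtain N where N: "\<And>m n. m \<ge> N \<Longrightarrow> n \<ge> N \<Longrightarrow> dist (\<gamma> (r m) p) (\<gamma> (r n) p) < e / 3"
      using e by (meson metric_CauchyD divide_pos_pos zero_less_numeral)
    have "dist (\<gamma> (r m) t) (\<gamma> (r n) t) < e" if "m \<ge> N" "n \<ge> N" for m n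
    proof -
      have "dist (\<gamma> (r m) t) (\<gamma> (r n) t) \<le> dist (\<gamma> (r m) t) (\<gamma> (r m) p) + dist (\<gamma> (r m) p) (\<gamma> (r n) p) + dist (\<gamma> (r n) p) (\<gamma> (r n) t)"
        by (meson add_mono dist_triangle order.refl order.trans)
      also have "\<dots> < e" using lip[of "r m" t p] lip[of "r n" p t] N[OF that] p by auto
      finally show ?thesis .
    qed
    then show "\<exists>M. \<forall>m\<ge>M. \<forall>n\<ge>M. dist (\<gamma> (r m) t) (\<gamma> (r n) t) < e" by blast
  qed
  then have "\<exists>l. (\<lambda>n. \<gamma> (r n) t) \<longlonglongrightarrow> l" for t by (simp add: Cauchy_convergent_iff convergent_def)
  then obtain \<gamma>' where \<gamma>': "\<And>t. (\<lambda>n. \<gamma> (r n) t) \<longlonglongrightarrow> \<gamma>' t" by metis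
  have "\<gamma>' t \<in> S" for t
    using closed_sequentially[OF compact_imp_closed[OF S] _ \<gamma>'[of t]] inS by simp
  moreover have "dist (\<gamma>' s) (\<gamma>' t) \<le> \<bar>s - t\<bar>" for s t
    using tendsto_dist[OF \<gamma>'[of s] \<gamma>'[of t]] by (rule LIMSEQ_le_const2) (use lip in auto)
  ultimately have "lip_curve S \<gamma>' T'" using r1 by (auto simp: lip_curve_def)
  moreover have "(\<lambda>n. T (r n)) \<longlonglongrightarrow> T'"
    using LIMSEQ_subseq_LIMSEQ[OF r1(3) r2(1)] by (simp add: r_def o_def)
  ultimately show ?thesis using that r \<gamma>' r1 by auto
qed

lemma cost_liminf:
  fixes S :: "'a::metric_space set"
  assumes g: "\<And>n. lip_curve S (\<gamma> n) (T n)" and g': "lip_curve S \<gamma>' T'"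
    and lim: "\<And>t. (\<lambda>n. \<gamma> n t) \<longlonglongrightarrow> \<gamma>' t" and T: "T \<longlonglongrightarrow> T'"
    and \<phi>: "\<phi> \<in> borel_on S" and lsc: "seq_lsc S \<phi>"
  shows "cost \<phi> \<gamma>' T' \<le> liminf (\<lambda>n. cost \<phi> (\<gamma> n) (T n))"
proof -
  have [measurable]: "(\<lambda>t. \<phi> (\<gamma> n t)) \<in> borel_measurable borel" "(\<lambda>t. \<phi> (\<gamma>' t)) \<in> borel_measurable borel" for n
    using lip_curve_measurable[OF g \<phi>] lip_curve_measurable[OF g' \<phi>] by auto
  \<comment> \<open>The end time is dropped: \<open>t < T'\<close> puts \<open>t\<close> into
    \<open>{0..T n}\<close> eventually, which may fail for \<open>t = T'\<close>.\<close>
  have "cost \<phi> \<gamma>' T' = (\<integral>\<^sup>+t\<in>{0..<T'}. \<phi> (\<gamma>' t) \<partial>lborel)"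
    unfolding cost_def
    by (rule nn_integral_cong_AE, rule AE_mp[OF AE_lborel_singleton[of T']]) (auto simp: indicator_def)
  also have "\<dots> \<le> (\<integral>\<^sup>+t. liminf (\<lambda>n. \<phi> (\<gamma> n t) * indicator {0..T n} t) \<partial>lborel)"
  proof (rule nn_integral_mono)
    fix t
    show "\<phi> (\<gamma>' t) * indicator {0..<T'} t \<le> liminf (\<lambda>n. \<phi> (\<gamma> n t) * indicator {0..T n} t)"
    proof (cases "t \<in> {0..<T'}")
      case True
      have "\<phi> (\<gamma>' t) \<le> liminf (\<lambda>n. \<phi> (\<gamma> n t))"
        using g g' by (intro seq_lscD[OF lsc _ _ lim]) (auto simp: lip_curve_def)
      also have "\<dots> = liminf (\<lambda>n. \<phi> (\<gamma> n t) * indicator {0..T n} t)"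
      proof (rule Liminf_eq)
        have "\<forall>\<^sub>F n in sequentially. t < T n" using True T by (auto simp: order_tendstoD)
        then show "\<forall>\<^sub>F n in sequentially. \<phi> (\<gamma> n t) = \<phi> (\<gamma> n t) * indicator {0..T n} t"
          by eventually_elim (use True in auto)
      qed
      finally show ?thesis using True by simp
    qed simp
  qed
  also have "\<dots> \<le> liminf (\<lambda>n. cost \<phi> (\<gamma> n) (T n))"
    unfolding cost_def by (rule nn_integral_liminf) measurable
  finally show ?thesis .
qed

text \<open>One subsequence serves all \<open>\<phi>\<close> and \<open>b\<close> at once, so that
  the bounds for \<open>h\<close> and for countably many open sets pass to the same limit
  curve.\<close>

lemma lip_curve_limit:
  fixes S :: "'a::complete_space set" and T :: "nat \<Rightarrow> real"
  assumes S: "compact S" and g: "\<And>n. lip_curve S (\<gamma> n) (T n)" and T: "\<And>n. T n \<le> \<tau>"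
  obtains r \<gamma>' T' where "strict_mono (r::nat\<Rightarrow>nat)" "lip_curve S \<gamma>' T'" "T' \<le> \<tau>"
    "(\<lambda>n. \<gamma> (r n) 0) \<longlonglongrightarrow> \<gamma>' 0" "(\<lambda>n. \<gamma> (r n) (T (r n))) \<longlonglongrightarrow> \<gamma>' T'"
    "\<And>\<phi> b. \<phi> \<in> borel_on S \<Longrightarrow> seq_lsc S \<phi> \<Longrightarrow>
       (\<forall>\<^sub>F n in sequentially. cost \<phi> (\<gamma> n) (T n) \<le> b) \<Longrightarrow> cost \<phi> \<gamma>' T' \<le> b"
proof -
  obtain r \<gamma>' T' where *: "strict_mono r" "lip_curve S \<gamma>' T'" "T' \<le> \<tau>"
    "\<And>t. (\<lambda>n. \<gamma> (r n) t) \<longlonglongrightarrow> \<gamma>' t" "(\<lambda>n. T (r n)) \<longlonglongrightarrow> T'"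
    by (rule seq_compact_lip_curves[OF assms]) (rule that; assumption)
  \<comment> \<open>The end times vary as well; the Lipschitz bound compares the end point with the
    position at the fixed time \<open>T'\<close>.\<close>
  have e: "(\<lambda>n. \<gamma> (r n) (T (r n))) \<longlonglongrightarrow> \<gamma>' T'"
  proof (rule iffD2[OF tendsto_dist_iff])
    have "(\<lambda>n. \<bar>T' - T (r n)\<bar> + dist (\<gamma> (r n) T') (\<gamma>' T')) \<longlonglongrightarrow> \<bar>T' - T'\<bar> + dist (\<gamma>' T') (\<gamma>' T')"
      by (intro tendsto_intros *)
    then have l: "(\<lambda>n. \<bar>T' - T (r n)\<bar> + dist (\<gamma> (r n) T') (\<gamma>' T')) \<longlonglongrightarrow> 0" by simp
    have "dist (\<gamma> (r n) (T (r n))) (\<gamma>' T') \<le> \<bar>T' - T (r n)\<bar> + dist (\<gamma> (r n) T') (\<gamma>' T')" for n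
    proof -
      have "dist (\<gamma> (r n) T') (\<gamma> (r n) (T (r n))) \<le> \<bar>T' - T (r n)\<bar>" using g by (simp add: lip_curve_def)
      then show ?thesis using dist_triangle3[of "\<gamma> (r n) (T (r n))" "\<gamma>' T'" "\<gamma> (r n) T'"] by simp
    qed
    then show "(\<lambda>n. dist (\<gamma> (r n) (T (r n))) (\<gamma>' T')) \<longlonglongrightarrow> 0"
      by (intro tendsto_sandwich[OF _ _ tendsto_const l]) auto
  qed
  have c: "cost \<phi> \<gamma>' T' \<le> b" if "\<phi> \<in> borel_on S" "seq_lsc S \<phi>"
       "\<forall>\<^sub>F n in sequentially. cost \<phi> (\<gamma> n) (T n) \<le> b" for \<phi> b
  proof -
    have "cost \<phi> \<gamma>' T' \<le> liminf (\<lambda>n. cost \<phi> (\<gamma> (r n)) (T (r n)))"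
      by (rule cost_liminf[OF g *(2) *(4,5) that(1,2)])
    also have "\<dots> \<le> b"
      by (rule liminf_le_const) (rule eventually_subseq[OF *(1) that(3)])
    finally show ?thesis .
  qed
  show ?thesis by (rule that[OF *(1-3) *(4) e c])
qed

section \<open>Reversal and concatenation of curves\<close>

lemma lip_curve_const: "x \<in> S \<Longrightarrow> lip_curve S (\<lambda>_. x) 0"
  by (auto simp: lip_curve_def)

lemma cost_zero [simp]: "cost \<phi> \<gamma> 0 = 0"
proof -
  have "cost \<phi> \<gamma> 0 = (\<integral>\<^sup>+t. 0 \<partial>(lborel :: real measure))"
    unfolding cost_def by (rule nn_integral_cong_AE, rule AE_mp[OF AE_lborel_singleton[of 0]]) (auto simp: indicator_def)
  then show ?thesis by simp
qed

lemma cost_reverse: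
  assumes \<gamma>: "lip_curve S \<gamma> T" and \<phi>: "\<phi> \<in> borel_on S"
  shows "lip_curve S (\<lambda>t. \<gamma> (T - t)) T" "cost \<phi> (\<lambda>t. \<gamma> (T - t)) T = cost \<phi> \<gamma> T"
proof -
  show 1: "lip_curve S (\<lambda>t. \<gamma> (T - t)) T" 
    unfolding lip_curve_def
  proof (intro conjI allI)
    fix s t show "dist (\<gamma> (T - s)) (\<gamma> (T - t)) \<le> \<bar>s - t\<bar>"
      using \<gamma> unfolding lip_curve_def by (smt (verit))
  qed (use \<gamma> in \<open>auto simp: lip_curve_def\<close>)
  have [measurable]: "(\<lambda>t. \<phi> (\<gamma> t)) \<in> borel_measurable borel" by (rule lip_curve_measurable[OF \<gamma> \<phi>])
  have "cost \<phi> \<gamma> T = (\<integral>\<^sup>+t. \<phi> (\<gamma> (T + (-1) * t)) * indicator {0..T} (T + (-1) * t) \<partial>lborel)"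
    unfolding cost_def by (subst nn_integral_real_affine[of _ "-1" T]) auto
  also have "\<dots> = cost \<phi> (\<lambda>t. \<gamma> (T - t)) T"
    unfolding cost_def by (intro nn_integral_cong) (auto simp: indicator_def)
  finally show "cost \<phi> (\<lambda>t. \<gamma> (T - t)) T = cost \<phi> \<gamma> T" by simp
qed

lemma cost_concat:
  fixes S :: "'a::metric_space set"
  assumes \<gamma>: "lip_curve S \<gamma> T" and \<eta>: "lip_curve S \<eta> U" and eq: "\<gamma> T = \<eta> 0"
  defines "\<kappa> \<equiv> \<lambda>t. if t \<le> T then \<gamma> t else \<eta> (t - T)"
  shows "lip_curve S \<kappa> (T + U)" "\<kappa> 0 = \<gamma> 0" "\<kappa> (T + U) = \<eta> U"
    "\<And>\<phi>. \<phi> \<in> borel_on S \<Longrightarrow> cost \<phi> \<kappa> (T + U) = cost \<phi> \<gamma> T + cost \<phi> \<eta> U"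
proof -
  have T: "0 \<le> T" "0 \<le> U" using \<gamma> \<eta> by (auto simp: lip_curve_def)
  have g: "dist (\<gamma> s) (\<gamma> t) \<le> \<bar>s - t\<bar>" "dist (\<eta> s) (\<eta> t) \<le> \<bar>s - t\<bar>" for s t
    using \<gamma> \<eta> by (auto simp: lip_curve_def)
  have x: "dist (\<gamma> s) (\<eta> (t - T)) \<le> t - s" if "s \<le> T" "T < t" for s t
  proof -
    have "dist (\<gamma> s) (\<eta> (t - T)) \<le> dist (\<gamma> s) (\<gamma> T) + dist (\<eta> 0) (\<eta> (t - T))"
      using dist_triangle[of "\<gamma> s" "\<eta> (t - T)" "\<gamma> T"] eq by simp
    also have "\<dots> \<le> (T - s) + (t - T)" using g(1)[of s T] g(2)[of 0 "t - T"] that by (intro add_mono) auto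
    finally show ?thesis by simp
  qed
  have "dist (\<kappa> s) (\<kappa> t) \<le> \<bar>s - t\<bar>" for s t
    using g(1)[of s t] g(2)[of "s - T" "t - T"] x[of s t] x[of t s]
    unfolding \<kappa>_def by (cases "s \<le> T"; cases "t \<le> T") (auto simp: dist_commute)
  then show l: "lip_curve S \<kappa> (T + U)" using \<gamma> \<eta> T by (auto simp: lip_curve_def \<kappa>_def)
  show "\<kappa> 0 = \<gamma> 0" using T by (simp add: \<kappa>_def)
  show "\<kappa> (T + U) = \<eta> U" using T eq by (cases "U = 0") (auto simp: \<kappa>_def)
  fix \<phi> :: "'a \<Rightarrow> ennreal" assume \<phi>: "\<phi> \<in> borel_on S"
  have [measurable]: "(\<lambda>t. \<phi> (\<gamma> t)) \<in> borel_measurable borel" "(\<lambda>t. \<phi> (\<eta> t)) \<in> borel_measurable borel"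
    "(\<lambda>t. \<phi> (\<kappa> t)) \<in> borel_measurable borel"
    using lip_curve_measurable[OF \<gamma> \<phi>] lip_curve_measurable[OF \<eta> \<phi>] lip_curve_measurable[OF l \<phi>] by auto
  \<comment> \<open>The two pieces overlap in the single instant \<open>T\<close>, a null
    set.\<close>
  have "cost \<phi> \<kappa> (T + U) = (\<integral>\<^sup>+t. \<phi> (\<gamma> t) * indicator {0..T} t + \<phi> (\<eta> (t - T)) * indicator {0..U} (t - T) \<partial>lborel)"
    unfolding cost_def
    by (rule nn_integral_cong_AE, rule AE_mp[OF AE_lborel_singleton[of T]])
       (use T in \<open>auto simp: indicator_def \<kappa>_def intro!: AE_I2\<close>)
  also have "\<dots> = cost \<phi> \<gamma> T + (\<integral>\<^sup>+t. \<phi> (\<eta> (t - T)) * indicator {0..U} (t - T) \<partial>lborel)"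
    unfolding cost_def by (subst nn_integral_add) auto
  also have "(\<integral>\<^sup>+t. \<phi> (\<eta> (t - T)) * indicator {0..U} (t - T) \<partial>lborel) = cost \<phi> \<eta> U"
    unfolding cost_def by (subst (2) nn_integral_real_affine[of _ 1 "-T"]) auto
  finally show "cost \<phi> \<kappa> (T + U) = cost \<phi> \<gamma> T + cost \<phi> \<eta> U" .
qed

lemma lip_curve_concat:
  fixes S :: "'a::metric_space set"
  assumes "lip_curve S \<gamma> T" "lip_curve S \<eta> U" "\<gamma> T = \<eta> 0"
  obtains \<kappa> where "lip_curve S \<kappa> (T + U)" "\<kappa> 0 = \<gamma> 0" "\<kappa> (T + U) = \<eta> U"
    "\<And>\<phi>. \<phi> \<in> borel_on S \<Longrightarrow> cost \<phi> \<kappa> (T + U) = cost \<phi> \<gamma> T + cost \<phi> \<eta> U"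
  by (rule that[OF cost_concat[OF assms]])

section \<open>Measurability of reachable sets\<close>

text \<open>Choquet's capacitability argument: the indices \<open>k 0, k 1, \<dots>\<close> are chosen one after the other so
  that the outer measure of the projection stays above a given number.\<close>

lemma projection_completion_measurable:
  fixes P :: "nat \<Rightarrow> nat \<Rightarrow> 'c set"
  assumes M: "finite_measure M"
    and mono: "\<And>j k k'. k \<le> k' \<Longrightarrow> P j k \<subseteq> P j k'"
    and sp: "e ` X \<subseteq> space M"
    and meas: "\<And>k n. e ` {x\<in>X. \<forall>j<n. x \<in> P j (k j)} \<in> sets M"
    and int: "\<And>k. (\<Inter>n. e ` {x\<in>X. \<forall>j<n. x \<in> P j (k j)}) \<subseteq> e ` {x\<in>X. \<forall>j. x \<in> P j (k j)}"
  shows "e ` {x\<in>X. \<forall>j. \<exists>k. x \<in> P j k} \<in> sets (completion M)"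
proof -
  interpret finite_measure M by fact
  define F where "F = {x\<in>X. \<forall>j. \<exists>k. x \<in> P j k}"
  define A where "A = e ` F"
  have A: "A \<subseteq> space M" using sp by (auto simp: A_def F_def)
  have inner: "\<exists>C\<in>sets M. C \<subseteq> A \<and> b \<le> emeasure M C" if b: "b < outer_measure_of M A" for b
  proof -
    \<comment> \<open>At stage \<open>n\<close> only the values \<open>s j\<close> with
      \<open>j < n\<close> matter; the later indices stay free in \<open>F\<close>, so the next one
      can still be chosen.\<close>
    define D where "D n s = e ` {x\<in>F. \<forall>j<n. x \<in> P j (s j)}" for n :: nat and s
    have "\<exists>f. \<forall>n. b < outer_measure_of M (D n (f n)) \<and> (\<forall>j<n. f (Suc n) j = f n j)"
    proof (rule dependent_nat_choice)
      show "\<exists>s. b < outer_measure_of M (D 0 s)" using b by (simp add: D_def A_def)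
      fix s n assume s: "b < outer_measure_of M (D n s)"
      have DS: "D (Suc n) (s(n := k)) = e ` ({x\<in>F. \<forall>j<n. x \<in> P j (s j)} \<inter> P n k)" for k
        unfolding D_def by (rule arg_cong[of _ _ "image e"]) (auto simp: less_Suc_eq)
      have F: "{x\<in>F. \<forall>j<n. x \<in> P j (s j)} = (\<Union>k. {x\<in>F. \<forall>j<n. x \<in> P j (s j)} \<inter> P n k)"
        by (auto simp: F_def)
      have eq: "D n s = (\<Union>k. D (Suc n) (s(n := k)))"
        unfolding DS image_UN[symmetric] F[symmetric] by (simp add: D_def)
      have inc: "incseq (\<lambda>k. D (Suc n) (s(n := k)))"
        unfolding incseq_def DS by (intro allI impI image_mono Int_mono order.refl mono)
      have "D (Suc n) (s(n := k)) \<subseteq> space M" for k using sp by (auto simp: D_def F_def)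
      \<comment> \<open>Continuity from below holds for the outer measure of arbitrary sets, which
        makes the choice possible before measurability is known.\<close>
      from SUP_outer_measure_of_incseq[OF this inc] have "b < (SUP k. outer_measure_of M (D (Suc n) (s(n := k))))"
        using s eq by simp
      then obtain k where "b < outer_measure_of M (D (Suc n) (s(n := k)))" by (auto simp: less_SUP_iff)
      then show "\<exists>y. b < outer_measure_of M (D (Suc n) y) \<and> (\<forall>j<n. y j = s j)"
        by (intro exI[of _ "s(n := k)"]) auto
    qed
    then obtain f where f: "\<And>n. b < outer_measure_of M (D n (f n))" "\<And>n j. j < n \<Longrightarrow> f (Suc n) j = f n j" by auto
    define k where "k j = f (Suc j) j" for j
    have fk: "f n j = k j" if "j < n" for n j
      using that
    proof (induction n)
      case (Suc n)
      then show ?case using f(2)[of j n] by (cases "j = n") (auto simp: k_def)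
    qed simp
    \<comment> \<open>These sets are built from all of \<open>X\<close> instead of \<open>F\<close>,
      which makes them measurable. Continuity from above keeps the measure of their intersection at
      least \<open>b\<close>, and \<open>int\<close> places it inside \<open>A\<close>.\<close>
    define Cn where "Cn n = e ` {x\<in>X. \<forall>j<n. x \<in> P j (k j)}" for n
    have Cm: "Cn n \<in> sets M" for n unfolding Cn_def by (rule meas)
    have "b \<le> emeasure M (Cn n)" for n
    proof -
      have "D n (f n) \<subseteq> Cn n" unfolding D_def Cn_def using fk by (auto simp: F_def)
      then have "outer_measure_of M (D n (f n)) \<le> emeasure M (Cn n)"
        using outer_measure_of_mono outer_measure_of_eq[OF Cm[of n]] by metis
      then show ?thesis using f(1)[of n] by simp
    qed
    moreover have "(INF n. emeasure M (Cn n)) = emeasure M (\<Inter>n. Cn n)"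
    proof (rule INF_emeasure_decseq)
      show "range Cn \<subseteq> sets M" using Cm by auto
      show "decseq Cn" unfolding decseq_def Cn_def
        by (intro allI impI image_mono Collect_mono) (auto dest: order_less_le_trans)
    qed simp
    ultimately have "b \<le> emeasure M (\<Inter>n. Cn n)" by (metis INF_greatest)
    moreover have "(\<Inter>n. Cn n) \<subseteq> A"
    proof -
      have "e ` {x\<in>X. \<forall>j. x \<in> P j (k j)} \<subseteq> A" unfolding A_def F_def by (intro image_mono) auto
      then show ?thesis using int[of k] unfolding Cn_def by (rule order.trans[rotated])
    qed
    moreover have "(\<Inter>n. Cn n) \<in> sets M" using Cm by (intro sets.countable_INT) auto
    ultimately show ?thesis by (intro bexI[of _ "\<Inter>n. Cn n"] conjI)
  qed
  obtain B where B: "B \<in> sets M" "A \<subseteq> B" "outer_measure_of M A = emeasure M B"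
    using outer_measure_of_attain[OF A] by blast
  \<comment> \<open>Measurable subsets of \<open>A\<close> at levels that approach its outer measure
    unite to a set as large as the hull \<open>B\<close>, which traps \<open>A\<close> up to a null
    set.\<close>
  have "\<exists>C\<in>sets M. C \<subseteq> A \<and> emeasure M B \<le> emeasure M C"
  proof (cases "emeasure M B = 0")
    case True then show ?thesis by (intro bexI[of _ "{}"]) auto
  next
    case False
    then have "0 < outer_measure_of M A" using B by (simp add: zero_less_iff_neq_zero)
    from approx_from_below_dense_linorder[OF this]
    obtain u :: "nat \<Rightarrow> ennreal" where u: "\<And>n. u n < outer_measure_of M A" "u \<longlonglongrightarrow> outer_measure_of M A"
      by auto
    then have "\<forall>n. \<exists>C\<in>sets M. C \<subseteq> A \<and> u n \<le> emeasure M C" using inner by blast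
    then obtain C where C: "\<And>n. C n \<in> sets M" "\<And>n. C n \<subseteq> A" "\<And>n. u n \<le> emeasure M (C n)" by metis
    have "u n \<le> emeasure M (\<Union>n. C n)" for n
      using C by (intro order.trans[OF C(3)[of n]] emeasure_mono) auto
    then have "outer_measure_of M A \<le> emeasure M (\<Union>n. C n)" using u(2) by (intro LIMSEQ_le_const2[of u]) auto
    then show ?thesis using C B by (intro bexI[of _ "\<Union>n. C n"]) auto
  qed
  then obtain C where C: "C \<in> sets M" "C \<subseteq> A" "emeasure M B \<le> emeasure M C" by blast
  have "emeasure M (B - C) = 0"
    using C B emeasure_Diff[of M C B] by (auto simp: diff_eq_0_iff_ennreal less_top[symmetric])
  then have "B - C \<in> null_sets M" using B C by auto
  then have "A - C \<in> null_sets (completion M)"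
    using B by (auto simp: null_sets_completion_iff2 intro!: bexI[of _ "B - C"])
  then have "C \<union> (A - C) \<in> sets (completion M)" using C by (intro sets.Un) auto
  then show ?thesis using C by (simp add: Un_absorb1 A_def F_def)
qed

lemma cost_mono: "(\<And>t. \<phi> (\<gamma> t) \<le> \<psi> (\<gamma> t)) \<Longrightarrow> cost \<phi> \<gamma> T \<le> cost \<psi> \<gamma> T"
  unfolding cost_def by (intro nn_integral_mono mult_right_mono) auto

lemma cost_one: "0 \<le> T \<Longrightarrow> cost (\<lambda>_. 1) \<gamma> T = ennreal T"
  by (simp add: cost_def)

lemma cost_ge_time:
  assumes "lip_curve S \<gamma> T" "\<And>x. x \<in> S \<Longrightarrow> 1 \<le> h x"
  shows "ennreal T \<le> cost h \<gamma> T"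
proof -
  have "ennreal T = cost (\<lambda>_. 1) \<gamma> T" using assms(1) by (simp add: cost_one lip_curve_def)
  also have "\<dots> \<le> cost h \<gamma> T" using assms by (intro cost_mono) (auto simp: lip_curve_def)
  finally show ?thesis .
qed

lemma cost_add:
  assumes "lip_curve S \<gamma> T" "\<phi> \<in> borel_on S" "\<psi> \<in> borel_on S"
  shows "cost (\<lambda>x. \<phi> x + \<psi> x) \<gamma> T = cost \<phi> \<gamma> T + cost \<psi> \<gamma> T"
  using lip_curve_measurable[OF assms(1,2)] lip_curve_measurable[OF assms(1,3)]
  unfolding cost_def by (simp add: distrib_right nn_integral_add)

lemma cost_cmult:
  assumes "lip_curve S \<gamma> T" "\<phi> \<in> borel_on S"
  shows "cost (\<lambda>x. c * \<phi> x) \<gamma> T = c * cost \<phi> \<gamma> T"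
  using lip_curve_measurable[OF assms]
  unfolding cost_def by (simp add: mult.assoc nn_integral_cmult)

lemma indicator_borel_restrict: "V \<in> sets borel \<Longrightarrow> (indicator V :: _ \<Rightarrow> ennreal) \<in> borel_on S"
  by (rule measurable_restrict_space1) simp

text \<open>Continuity from above for the time that the curve spends in \<open>V k\<close>. Together
  with the converse below it turns avoidance of the intersection into countably many bounds, each
  stable under limits.\<close>

lemma cost_indicator_decseq:
  fixes V :: "nat \<Rightarrow> 'a::metric_space set"
  assumes \<gamma>: "lip_curve S \<gamma> T" and V: "\<And>k. V k \<in> sets borel" "decseq V"
    and E: "cost (indicator (\<Inter>k. V k)) \<gamma> T = 0" and e: "0 < (e::real)"
  shows "\<exists>k. cost (indicator (V k)) \<gamma> T \<le> ennreal e"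
proof -
  have [measurable]: "\<gamma> \<in> borel_measurable borel"
    using lip_curve_continuous[OF \<gamma>] by (rule borel_measurable_continuous_onI)
  define B where "B k = {0..T} \<inter> \<gamma> -` V k" for k
  have B: "B k \<in> sets lborel" for k
    unfolding B_def using V(1) measurable_sets_borel[OF \<open>\<gamma> \<in> borel_measurable borel\<close> V(1)] by auto
  have c: "cost (indicator W) \<gamma> T = emeasure lborel ({0..T} \<inter> \<gamma> -` W)" if "W \<in> sets borel" for W
  proof -
    have "{0..T} \<inter> \<gamma> -` W \<in> sets lborel"
      using measurable_sets_borel[OF \<open>\<gamma> \<in> borel_measurable borel\<close> that] by auto
    moreover have "cost (indicator W) \<gamma> T = (\<integral>\<^sup>+t. indicator ({0..T} \<inter> \<gamma> -` W) t \<partial>lborel)"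
      unfolding cost_def by (intro nn_integral_cong) (auto simp: indicator_def)
    ultimately show ?thesis by simp
  qed
  have "(\<lambda>k. emeasure lborel (B k)) \<longlonglongrightarrow> emeasure lborel (\<Inter>k. B k)"
  proof (rule Lim_emeasure_decseq)
    show "decseq B" using V(2) by (auto simp: decseq_def B_def)
    show "emeasure lborel (B k) \<noteq> \<infinity>" for k
      using emeasure_mono[of "B k" "{0..T}" lborel] by (auto simp: B_def top_unique emeasure_lborel_Icc_eq split: if_splits)
  qed (use B in auto)
  moreover have "(\<Inter>k. B k) = {0..T} \<inter> \<gamma> -` (\<Inter>k. V k)" by (auto simp: B_def)
  ultimately have "(\<lambda>k. emeasure lborel (B k)) \<longlonglongrightarrow> 0"
    using E c[of "\<Inter>k. V k"] V(1) by (simp add: sets.countable_INT)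
  from order_tendstoD(2)[OF this, of "ennreal e"] e have "\<forall>\<^sub>F k in sequentially. emeasure lborel (B k) < ennreal e" by simp
  then obtain k where "emeasure lborel (B k) < ennreal e" by (auto dest: eventually_happens)
  then show ?thesis using c[OF V(1)] by (auto simp: B_def intro!: exI[of _ k])
qed

lemma cost_indicator_Inter_zero:
  assumes "\<And>j. \<exists>k. cost (indicator (V k)) \<gamma> T \<le> ennreal (e j)" "e \<longlonglongrightarrow> 0"
  shows "cost (indicator (\<Inter>k. V k)) \<gamma> T = 0"
proof -
  have "cost (indicator (\<Inter>k. V k)) \<gamma> T \<le> ennreal (e j)" for j
  proof -
    obtain k where "cost (indicator (V k)) \<gamma> T \<le> ennreal (e j)" using assms(1) by blast
    moreover have "cost (indicator (\<Inter>k. V k)) \<gamma> T \<le> cost (indicator (V k)) \<gamma> T"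
      by (intro cost_mono) (auto simp: indicator_def)
    ultimately show ?thesis by simp
  qed
  moreover have "(\<lambda>j. ennreal (e j)) \<longlonglongrightarrow> ennreal 0" by (intro tendsto_ennrealI assms)
  ultimately have "cost (indicator (\<Inter>k. V k)) \<gamma> T \<le> ennreal 0" by (intro LIMSEQ_le_const) auto
  then show ?thesis by simp
qed

text \<open>\<open>cost (indicator E)\<close> is the time spent in \<open>E\<close>: the curves may
  touch \<open>E\<close>, but not for a positive amount of time.\<close>

definition reach :: "'a::metric_space set \<Rightarrow> ('a \<Rightarrow> ennreal) \<Rightarrow> 'a set \<Rightarrow> 'a set \<Rightarrow> real \<Rightarrow> 'a set" where
  "reach S h E K \<tau> = {\<gamma> T | \<gamma> T. lip_curve S \<gamma> T \<and> \<gamma> 0 \<in> K \<and> cost h \<gamma> T \<le> ennreal \<tau> \<and> cost (indicator E) \<gamma> T = 0}"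

text \<open>The set is a projection from the space of curves. Avoidance means that for every
  \<open>j\<close> some \<open>k\<close> has time in \<open>V k\<close> at most
  \<open>1 / (j + 1)\<close>; each single bound is closed under limits of curves and monotone in
  \<open>k\<close>, which is the situation of
  \<open>projection_completion_measurable\<close>.\<close>

lemma reach_measurable:
  fixes S :: "'a::complete_space set" and V :: "nat \<Rightarrow> 'a set"
  assumes S: "compact S" and M: "finite_measure M" "sets M = sets (restrict_space borel S)"
    and h: "h \<in> borel_on S" "seq_lsc S h" "\<And>x. x \<in> S \<Longrightarrow> 1 \<le> h x"
    and V: "\<And>k. open (V k)" "decseq V" and K: "closed K" and \<tau>: "0 \<le> \<tau>"
  shows "reach S h (\<Inter>k. V k) K \<tau> \<in> sets (completion M)"
proof -
  define X where "X = {(\<gamma>, T). lip_curve S \<gamma> T \<and> \<gamma> 0 \<in> K \<and> cost h \<gamma> T \<le> ennreal \<tau>}"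
  define e where "e = (\<lambda>(\<gamma>::real \<Rightarrow> 'a, T::real). \<gamma> T)"
  define P where "P j k = {(\<gamma>, T). cost (indicator (V k)) \<gamma> T \<le> ennreal (1 / real (Suc j))}" for j k
  have sp: "space M = S" using sets_eq_imp_space_eq[OF M(2)] by (simp add: space_restrict_space)
  have Vb: "V k \<in> sets borel" for k using V by simp
  have XT: "T \<le> \<tau>" if "(\<gamma>, T) \<in> X" for \<gamma> T
  proof -
    have "ennreal T \<le> ennreal \<tau>" using cost_ge_time[of S \<gamma> T h] that h(3) by (auto simp: X_def intro: order.trans)
    then show ?thesis using \<tau> by (simp add: ennreal_le_iff)
  qed
  \<comment> \<open>Used twice: with the first \<open>n\<close> indices it shows that the
    projections are closed, and with all indices and a constant end point that one curve satisfies
    all the bounds at once.\<close>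
  have lim: "l \<in> e ` {x\<in>X. \<forall>j\<in>J. x \<in> P j (k j)}"
    if x: "\<And>n. x n \<in> X" and J: "\<And>j. j \<in> J \<Longrightarrow> \<forall>\<^sub>F n in sequentially. x n \<in> P j (k j)" and l: "(\<lambda>n. e (x n)) \<longlonglongrightarrow> l"
    for x l k J
  proof -
    define \<gamma> where "\<gamma> n = fst (x n)" for n
    define T where "T n = snd (x n)" for n
    have xn: "x n = (\<gamma> n, T n)" for n by (simp add: \<gamma>_def T_def)
    have g: "lip_curve S (\<gamma> n) (T n)" "T n \<le> \<tau>" "\<gamma> n 0 \<in> K" "cost h (\<gamma> n) (T n) \<le> ennreal \<tau>" for n
      using x[of n] XT[of "\<gamma> n" "T n"] by (auto simp: xn X_def)
    obtain r \<gamma>' T' where *: "strict_mono (r::nat\<Rightarrow>nat)" "lip_curve S \<gamma>' T'" "T' \<le> \<tau>"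
      "(\<lambda>n. \<gamma> (r n) 0) \<longlonglongrightarrow> \<gamma>' 0" "(\<lambda>n. \<gamma> (r n) (T (r n))) \<longlonglongrightarrow> \<gamma>' T'"
      "\<And>\<phi> b. \<phi> \<in> borel_on S \<Longrightarrow> seq_lsc S \<phi> \<Longrightarrow>
       (\<forall>\<^sub>F n in sequentially. cost \<phi> (\<gamma> n) (T n) \<le> b) \<Longrightarrow> cost \<phi> \<gamma>' T' \<le> b"
      by (rule lip_curve_limit[OF S g(1,2)]) (rule that; assumption)
    have "\<gamma>' T' = l"
      using LIMSEQ_subseq_LIMSEQ[OF l *(1)] *(5) by (intro LIMSEQ_unique[OF *(5)]) (simp add: e_def xn o_def)
    moreover have "\<gamma>' 0 \<in> K" using closed_sequentially[OF K _ *(4)] g by simp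
    moreover have "cost h \<gamma>' T' \<le> ennreal \<tau>" using g by (intro *(6) h) auto
    moreover have "(\<gamma>', T') \<in> P j (k j)" if "j \<in> J" for j
      unfolding P_def using J[OF that] Vb V
      by (auto simp: P_def xn intro!: *(6) seq_lsc_indicator indicator_borel_restrict)
    ultimately show ?thesis using *(2)
      by (intro image_eqI[of _ _ "(\<gamma>', T')"]) (auto simp: e_def X_def)
  qed
  have "e ` {x\<in>X. \<forall>j. \<exists>k. x \<in> P j k} \<in> sets (completion M)"
  proof (rule projection_completion_measurable[OF M(1)])
    show "P j k \<subseteq> P j k'" if "k \<le> k'" for j k k'
    proof -
      have "V k' \<subseteq> V k" using V(2) that by (auto simp: decseq_def)
      then have "cost (indicator (V k')) \<gamma> T \<le> cost (indicator (V k)) \<gamma> T" for \<gamma> T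
        by (intro cost_mono) (auto simp: indicator_def)
      then show ?thesis unfolding P_def by (auto intro: order.trans)
    qed
    show "e ` X \<subseteq> space M" unfolding sp by (auto simp: e_def X_def lip_curve_def)
    show "e ` {x\<in>X. \<forall>j<n. x \<in> P j (k j)} \<in> sets M" for k n
    proof -
      have "closed (e ` {x\<in>X. \<forall>j\<in>{..<n}. x \<in> P j (k j)})"
        unfolding closed_sequential_limits
      proof (intro allI impI, elim conjE)
        fix z l assume z: "\<forall>n'. z n' \<in> e ` {x\<in>X. \<forall>j\<in>{..<n}. x \<in> P j (k j)}" and l: "z \<longlonglongrightarrow> l"
        then have "\<forall>i. \<exists>x. x \<in> X \<and> (\<forall>j<n. x \<in> P j (k j)) \<and> z i = e x" by blast
        from choice[OF this] obtain x
          where x: "\<And>i. x i \<in> X" "\<And>i j. j < n \<Longrightarrow> x i \<in> P j (k j)" "\<And>i. z i = e (x i)" by auto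
        show "l \<in> e ` {x\<in>X. \<forall>j\<in>{..<n}. x \<in> P j (k j)}"
          by (rule lim[of x]) (use x(1,2) x(3)[symmetric] l in auto)
      qed
      then have "closed (e ` {x\<in>X. \<forall>j<n. x \<in> P j (k j)})" by (simp add: Ball_def)
      moreover have "e ` {x\<in>X. \<forall>j<n. x \<in> P j (k j)} \<subseteq> S" by (auto simp: e_def X_def lip_curve_def)
      ultimately show ?thesis unfolding M(2) sets_restrict_space
        by (intro image_eqI[of _ _ "e ` {x\<in>X. \<forall>j<n. x \<in> P j (k j)}"]) auto
    qed
    show "(\<Inter>n. e ` {x\<in>X. \<forall>j<n. x \<in> P j (k j)}) \<subseteq> e ` {x\<in>X. \<forall>j. x \<in> P j (k j)}" for k
    proof
      fix l assume "l \<in> (\<Inter>n. e ` {x\<in>X. \<forall>j<n. x \<in> P j (k j)})"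
      then have "\<forall>n. \<exists>x. x \<in> X \<and> (\<forall>j<n. x \<in> P j (k j)) \<and> l = e x" by blast
      then obtain x where x: "\<And>i. x i \<in> X" "\<And>i j. j < i \<Longrightarrow> x i \<in> P j (k j)" "\<And>i. l = e (x i)" by metis
      have "l \<in> e ` {x\<in>X. \<forall>j\<in>UNIV. x \<in> P j (k j)}"
      proof (rule lim[of x])
        show "\<forall>\<^sub>F n in sequentially. x n \<in> P j (k j)" for j
          using eventually_gt_at_top[of j] by eventually_elim (rule x(2))
      qed (use x(1) x(3)[symmetric] in auto)
      then show "l \<in> e ` {x\<in>X. \<forall>j. x \<in> P j (k j)}" by simp
    qed
  qed
  also have "e ` {x\<in>X. \<forall>j. \<exists>k. x \<in> P j k} = reach S h (\<Inter>k. V k) K \<tau>"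
  proof -
    have "(\<forall>j. \<exists>k. (\<gamma>, T) \<in> P j k) \<longleftrightarrow> cost (indicator (\<Inter>k. V k)) \<gamma> T = 0" if "lip_curve S \<gamma> T" for \<gamma> T
    proof
      assume "\<forall>j. \<exists>k. (\<gamma>, T) \<in> P j k"
      then show "cost (indicator (\<Inter>k. V k)) \<gamma> T = 0"
        by (intro cost_indicator_Inter_zero[OF _ LIMSEQ_inverse_real_of_nat]) (simp add: P_def inverse_eq_divide)
    next
      assume "cost (indicator (\<Inter>k. V k)) \<gamma> T = 0"
      then show "\<forall>j. \<exists>k. (\<gamma>, T) \<in> P j k"
        using cost_indicator_decseq[OF that Vb V(2)] by (simp add: P_def)
    qed
    then show ?thesis unfolding reach_def X_def e_def by (force simp: image_iff)
  qed
  finally show ?thesis .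
qed

section \<open>Truncated path metrics and regularity of the measure\<close>

text \<open>The weighted path distance from the set \<open>K\<close>, equal to \<infinity> where no
  Lipschitz curve from \<open>K\<close> arrives.\<close>

definition reach_cost :: "'a::metric_space set \<Rightarrow> ('a \<Rightarrow> ennreal) \<Rightarrow> 'a set \<Rightarrow> 'a \<Rightarrow> ennreal" where
  "reach_cost S \<rho> K z = (INF (\<gamma>, T)\<in>{(\<gamma>, T). lip_curve S \<gamma> T \<and> \<gamma> 0 \<in> K \<and> \<gamma> T = z}. cost \<rho> \<gamma> T)"

lemma reach_cost_le:
  assumes "lip_curve S \<gamma> T" "\<gamma> 0 \<in> K" shows "reach_cost S \<rho> K (\<gamma> T) \<le> cost \<rho> \<gamma> T"
  unfolding reach_cost_def by (rule INF_lower2[of "(\<gamma>, T)"]) (use assms in auto)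

lemma reach_cost_lessD:
  assumes "reach_cost S \<rho> K z < y"
  obtains \<gamma> T where "lip_curve S \<gamma> T" "\<gamma> 0 \<in> K" "\<gamma> T = z" "cost \<rho> \<gamma> T < y"
  using assms unfolding reach_cost_def by (auto simp: INF_less_iff)

lemma reach_cost_eq_0: "x \<in> S \<Longrightarrow> x \<in> K \<Longrightarrow> reach_cost S \<rho> K x = 0"
  using reach_cost_le[OF lip_curve_const[of x S], of K \<rho>] by simp

lemma reach_cost_step:
  fixes S :: "'a::metric_space set"
  assumes \<eta>: "lip_curve S \<eta> U" and \<rho>: "\<rho> \<in> borel_on S"
  shows "reach_cost S \<rho> K (\<eta> U) \<le> reach_cost S \<rho> K (\<eta> 0) + cost \<rho> \<eta> U"
proof (cases "cost \<rho> \<eta> U = top")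
  case False
  have "reach_cost S \<rho> K (\<eta> U) \<le> cost \<rho> \<eta> U + cost \<rho> \<gamma> T"
    if g: "lip_curve S \<gamma> T" "\<gamma> 0 \<in> K" "\<gamma> T = \<eta> 0" for \<gamma> T
  proof -
    obtain \<kappa> where c: "lip_curve S \<kappa> (T + U)" "\<kappa> 0 = \<gamma> 0" "\<kappa> (T + U) = \<eta> U"
      and c': "\<And>\<phi>. \<phi> \<in> borel_on S \<Longrightarrow> cost \<phi> \<kappa> (T + U) = cost \<phi> \<gamma> T + cost \<phi> \<eta> U"
      by (rule lip_curve_concat[OF g(1) \<eta> g(3)]) (rule that; assumption)
    show ?thesis using reach_cost_le[OF c(1), of K \<rho>] g(2) unfolding c(2,3) c'[OF \<rho>] by (simp add: add.commute)
  qed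
  \<comment> \<open>Subtraction moves the added cost out of the infimum; this is sound in
    \<open>ennreal\<close> because that cost is finite here.\<close>
  then have "reach_cost S \<rho> K (\<eta> U) - cost \<rho> \<eta> U \<le> reach_cost S \<rho> K (\<eta> 0)"
    unfolding reach_cost_def[of S \<rho> K "\<eta> 0"] using False
    by (intro INF_greatest) (auto simp: ennreal_minus_le_iff)
  then show ?thesis using False by (simp add: ennreal_minus_le_iff add.commute)
qed simp

text \<open>Truncation gives a bounded function, hence one that has means over balls, also where no
  curve of finite cost arrives.\<close>

definition trunc_reach :: "'a::metric_space set \<Rightarrow> ('a \<Rightarrow> ennreal) \<Rightarrow> 'a set \<Rightarrow> real \<Rightarrow> 'a \<Rightarrow> real" where
  "trunc_reach S \<rho> K N z = enn2real (min (ennreal N) (reach_cost S \<rho> K z))"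

lemma trunc_reach_bounds: "0 \<le> N \<Longrightarrow> 0 \<le> trunc_reach S \<rho> K N z \<and> trunc_reach S \<rho> K N z \<le> N"
  unfolding trunc_reach_def by (auto intro!: enn2real_leI)

text \<open>Along a curve the path distance changes by at most the cost, in one direction by
  concatenation and in the other by reversing the curve first; truncation respects both
  bounds.\<close>

lemma trunc_reach_upper_gradient:
  fixes S :: "'a::metric_space set"
  assumes \<rho>: "\<rho> \<in> borel_on S" and N: "0 \<le> N"
  shows "upper_gradient_on S \<rho> (trunc_reach S \<rho> K N)"
  unfolding upper_gradient_on_def
proof (intro conjI allI impI \<rho>)
  fix \<gamma> a b assume r: "rectifiable_curve S \<gamma> a b"
  obtain \<eta> T where \<eta>: "lip_curve S \<eta> T" "\<eta> 0 = \<gamma> a" "\<eta> T = \<gamma> b" and c: "curve_integral \<rho> \<gamma> a b = cost \<rho> \<eta> T"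
    using rectifiable_curve_lip[OF r] by metis
  define R where "R = reach_cost S \<rho> K"
  define m where "m z = min (ennreal N) (R z)" for z
  have 1: "R (\<gamma> b) \<le> R (\<gamma> a) + cost \<rho> \<eta> T" using reach_cost_step[OF \<eta>(1) \<rho>, of K] \<eta> by (simp add: R_def)
  have 2: "R (\<gamma> a) \<le> R (\<gamma> b) + cost \<rho> \<eta> T"
    using reach_cost_step[OF cost_reverse(1)[OF \<eta>(1) \<rho>] \<rho>, of K] cost_reverse(2)[OF \<eta>(1) \<rho>] \<eta> by (simp add: R_def)
  have ma: "m (\<gamma> b) \<le> m (\<gamma> a) + cost \<rho> \<eta> T"
    using 1 unfolding m_def min_def by (auto intro: order.trans add_increasing2)
  have mb: "m (\<gamma> a) \<le> m (\<gamma> b) + cost \<rho> \<eta> T"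
    using 2 unfolding m_def min_def by (auto intro: order.trans add_increasing2)
  have fin: "m z < top" for z by (simp add: m_def min_def le_less_trans not_le less_trans)
  have t: "ennreal (trunc_reach S \<rho> K N z) = m z" for z
    using fin[of z] by (simp add: trunc_reach_def m_def R_def)
  show "ennreal \<bar>trunc_reach S \<rho> K N (\<gamma> a) - trunc_reach S \<rho> K N (\<gamma> b)\<bar> \<le> curve_integral \<rho> \<gamma> a b"
  proof (cases "cost \<rho> \<eta> T")
    case (real c')
    then show ?thesis
      using ma mb unfolding t[symmetric] c using trunc_reach_bounds[OF N, of S \<rho> K]
      by (auto simp flip: ennreal_plus simp: ennreal_le_iff abs_le_iff)
  qed (simp add: c)
qed

text \<open>Since \<infinity> * 0 = 0 in \<open>ennreal\<close>, finite penalized cost encodes that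
  the curve spends no time in \<open>E\<close>.\<close>

lemma cost_penalized:
  fixes S :: "'a::metric_space set"
  assumes \<gamma>: "lip_curve S \<gamma> T" and h: "h \<in> borel_on S" and E: "E \<in> sets borel"
  shows "cost (\<lambda>x. h x + \<infinity> * indicator E x) \<gamma> T = cost h \<gamma> T + \<infinity> * cost (indicator E) \<gamma> T"
proof -
  have i: "(indicator E :: _ \<Rightarrow> ennreal) \<in> borel_on S"
    by (rule indicator_borel_restrict[OF E])
  then have "(\<lambda>x. \<infinity> * indicator E x :: ennreal) \<in> borel_on S" by measurable
  then show ?thesis using cost_add[OF \<gamma> h] cost_cmult[OF \<gamma> i] by simp
qed

lemma trunc_reach_measurable:
  fixes S :: "'a::complete_space set" and V :: "nat \<Rightarrow> 'a set"
  assumes S: "compact S" and M: "finite_measure M" "sets M = sets (restrict_space borel S)"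
    and h: "h \<in> borel_on S" "seq_lsc S h" "\<And>x. x \<in> S \<Longrightarrow> 1 \<le> h x"
    and V: "\<And>k. open (V k)" "decseq V" and K: "closed K"
  defines "\<rho> \<equiv> \<lambda>x. h x + \<infinity> * indicator (\<Inter>k. V k) x"
  shows "trunc_reach S \<rho> K N \<in> borel_measurable (completion M)"
proof -
  have E: "(\<Inter>k. V k) \<in> sets borel" using V by (intro sets.countable_INT) auto
  have sp: "space M = S" using sets_eq_imp_space_eq[OF M(2)] by (simp add: space_restrict_space)
  have "reach_cost S \<rho> K \<in> borel_measurable (completion M)"
  proof (rule borel_measurableI_less)
    fix y
    \<comment> \<open>A curve of penalized cost below \<open>y\<close> has cost at most some
      rational \<open>q\<close> with \<open>q < y\<close>, so the sublevel set is a countable union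
      of reachable sets.\<close>
    have "{z\<in>space (completion M). reach_cost S \<rho> K z < y} = (\<Union>q\<in>{q\<in>\<rat>. 0 \<le> q \<and> ennreal q < y}. reach S h (\<Inter>k. V k) K q)" (is "?L = ?U")
    proof (intro equalityI subsetI)
      fix z assume "z \<in> ?L"
      then obtain q0 where q0: "reach_cost S \<rho> K z < q0" "q0 < y" using dense by blast
      obtain \<gamma> T where g: "lip_curve S \<gamma> T" "\<gamma> 0 \<in> K" "\<gamma> T = z" "cost \<rho> \<gamma> T < q0"
        using q0 reach_cost_lessD by blast
      obtain q where q: "q \<in> \<rat>" "0 \<le> q" "q0 \<le> ennreal q" "ennreal q < y"
      proof -
        obtain x where x: "q0 = ennreal x" "0 \<le> x" using q0 by (cases q0) auto
        obtain y' where y': "ennreal y' \<le> y" "x < y'"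
        proof (cases y)
          case (real y') then show ?thesis using that[of y'] q0 x by (auto simp: ennreal_less_iff)
        next
          case top then show ?thesis using that[of "x + 1"] by auto
        qed
        obtain q where q: "q \<in> \<rat>" "x < q" "q < y'" using Rats_dense_in_real[OF y'(2)] by auto
        have "ennreal q < ennreal y'" using q x by (simp add: ennreal_less_iff)
        then show ?thesis using that[of q] q x y' by (auto intro: ennreal_leI)
      qed
      have "cost h \<gamma> T + \<infinity> * cost (indicator (\<Inter>k. V k)) \<gamma> T < q0"
        using g(4) cost_penalized[OF g(1) h(1) E] by (simp add: \<rho>_def)
      then have "cost h \<gamma> T \<le> ennreal q" "cost (indicator (\<Inter>k. V k)) \<gamma> T = 0"
        using q(3) by (auto simp: ennreal_top_mult split: if_splits intro: order.trans less_imp_le)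
      then show "z \<in> ?U"
        using g q unfolding reach_def by blast
    next
      fix z assume "z \<in> ?U"
      then obtain q \<gamma> T where q: "ennreal q < y" and g: "lip_curve S \<gamma> T" "\<gamma> 0 \<in> K" "z = \<gamma> T"
        "cost h \<gamma> T \<le> ennreal q" "cost (indicator (\<Inter>k. V k)) \<gamma> T = 0"
        unfolding reach_def by blast
      have "reach_cost S \<rho> K z \<le> cost \<rho> \<gamma> T" using reach_cost_le[OF g(1,2)] g(3) by simp
      also have "\<dots> = cost h \<gamma> T" using cost_penalized[OF g(1) h(1) E] g(5) by (simp add: \<rho>_def)
      also have "\<dots> < y" using g(4) q by simp
      finally show "z \<in> ?L"
        using g by (auto simp: sp lip_curve_def)
    qed
    also have "\<dots> \<in> sets (completion M)"
    proof (rule sets.countable_UN'')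
      show "countable {q\<in>\<rat>. 0 \<le> q \<and> ennreal q < y}" by (rule countable_subset[OF _ countable_rat]) auto
      show "reach S h (\<Inter>k. V k) K q \<in> sets (completion M)" if "q \<in> {q\<in>\<rat>. 0 \<le> q \<and> ennreal q < y}" for q
        using that by (intro reach_measurable[OF S M h V K]) auto
    qed
    finally show "?L \<in> sets (completion M)" .
  qed
  then show ?thesis unfolding trunc_reach_def by measurable
qed

section \<open>Regularity of finite Borel measures\<close>

text \<open>The sets with such approximations form a sigma-algebra. It contains every nonempty
  closed set, as the intersection of its open neighbourhoods of radius
  \<open>1 / (n + 1)\<close>.\<close>

lemma finite_borel_measure_regular:
  fixes N :: "'a::metric_space measure"
  assumes "finite_measure N" and sN: "sets N = sets borel" and A: "A \<in> sets borel" and e: "0 < (e::real)"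
  shows "\<exists>F U. closed F \<and> open U \<and> F \<subseteq> A \<and> A \<subseteq> U \<and> measure N (U - F) \<le> e"
proof -
  interpret finite_measure N by fact
  note [simp] = sN
  have [simp]: "space N = UNIV" using sets_eq_imp_space_eq[OF sN] by simp
  have "A \<in> sigma_sets UNIV (Collect closed)" using A by (simp add: borel_eq_closed)
  then show ?thesis using e
  proof (induction arbitrary: e rule: sigma_sets.induct)
    case (Basic A)
    then have cA: "closed A" by simp
    show ?case
    proof (cases "A = {}")
      case True then show ?thesis using Basic by (intro exI[of _ "{}"]) auto
    next
      case False
      define U where "U n = {x. infdist x A < 1 / real (Suc n)}" for n
      have oU: "open (U n)" for n unfolding U_def by (intro open_Collect_less continuous_intros)
      have "decseq (\<lambda>n. U n - A)"
        unfolding decseq_def U_def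
        by (auto intro: less_le_trans simp: frac_le)
      moreover have "(\<Inter>n. U n - A) = {}"
      proof -
        have "False" if x: "\<And>n. x \<in> U n" and "x \<notin> A" for x
        proof -
          have "0 < infdist x A" using cA False \<open>x \<notin> A\<close> in_closed_iff_infdist_zero[of A x] infdist_nonneg[of x A] by auto
          then obtain n where "1 / real (Suc n) < infdist x A" using nat_approx_posE by blast
          then show False using x[of n] by (simp add: U_def)
        qed
        then show ?thesis by blast
      qed
      moreover have "range (\<lambda>n. U n - A) \<subseteq> sets N" using oU cA by auto
      ultimately have "(\<lambda>n. measure N (U n - A)) \<longlonglongrightarrow> measure N {}"
        using finite_Lim_measure_decseq[of "\<lambda>n. U n - A"] by metis
      then have "\<forall>\<^sub>F n in sequentially. measure N (U n - A) < e" using Basic(2) by (intro order_tendstoD(2)) auto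
      then obtain n where "measure N (U n - A) < e" by (auto dest: eventually_happens)
      moreover have "A \<subseteq> U n" by (auto simp: U_def)
      ultimately show ?thesis using oU cA by (intro exI[of _ A] exI[of _ "U n"]) auto
    qed
  next
    case Empty then show ?case by (intro exI[of _ "{}"]) auto
  next
    case (Compl A)
    obtain F U where "closed F" "open U" "F \<subseteq> A" "A \<subseteq> U" "measure N (U - F) \<le> e"
      using Compl.IH[OF Compl.prems] by blast
    moreover have "(- F) - (- U) = U - F" by auto
    ultimately show ?case by (intro exI[of _ "- U"] exI[of _ "- F"]) auto
  next
    case (Union A)
    \<comment> \<open>Half of \<open>e\<close> pays for the gaps between the \<open>U i\<close> and
      the \<open>F i\<close>, the other half for keeping only finitely many \<open>F i\<close>,
      since their full union need not be closed.\<close>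
    have "\<exists>F U. closed F \<and> open U \<and> F \<subseteq> A i \<and> A i \<subseteq> U \<and> measure N (U - F) \<le> e / 2 * (1/2) ^ Suc i" for i
      using Union by (intro Union.IH) auto
    then obtain F U where FU: "\<And>i. closed (F i)" "\<And>i. open (U i)" "\<And>i. F i \<subseteq> A i" "\<And>i. A i \<subseteq> U i"
       "\<And>i. measure N (U i - F i) \<le> e / 2 * (1/2) ^ Suc i" by metis
    have s: "(\<lambda>i. e / 2 * (1/2) ^ Suc i) sums (e / 2 * 1)"
      by (intro sums_mult power_half_series)
    have sm: "summable (\<lambda>i. measure N (U i - F i))"
      by (rule summable_comparison_test[OF _ sums_summable[OF s]]) (use FU(5) in auto)
    have m[simp]: "U i \<in> sets borel" "F i \<in> sets borel" for i using FU by auto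
    have "measure N (\<Union>i. U i - F i) \<le> (\<Sum>i. measure N (U i - F i))"
      by (rule finite_measure_subadditive_countably) (use sm in auto)
    also have "\<dots> \<le> e / 2" using suminf_le[OF FU(5) sm sums_summable[OF s]] sums_unique[OF s] by simp
    finally have 1: "measure N (\<Union>i. U i - F i) \<le> e / 2" .
    define G where "G n = (\<Union>i. F i) - (\<Union>i\<le>n. F i)" for n
    have "(\<lambda>n. measure N (G n)) \<longlonglongrightarrow> measure N (\<Inter>n. G n)"
      by (rule finite_Lim_measure_decseq) (auto simp: G_def decseq_def intro!: sets.Diff)
    moreover have "(\<Inter>n. G n) = {}" by (auto simp: G_def)
    ultimately have "(\<lambda>n. measure N (G n)) \<longlonglongrightarrow> 0" by simp
    then have "\<forall>\<^sub>F n in sequentially. measure N (G n) < e / 2" using Union(3) by (intro order_tendstoD(2)) auto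
    then obtain n where n: "measure N (G n) < e / 2" by (auto dest: eventually_happens)
    have Gm: "G n \<in> sets N" "(\<Union>i. U i - F i) \<in> sets N" unfolding G_def
      by (auto intro!: sets.Diff sets.countable_UN)
    have "measure N ((\<Union>i. U i) - (\<Union>i\<le>n. F i)) \<le> measure N ((\<Union>i. U i - F i) \<union> G n)"
      using Gm by (intro finite_measure_mono) (auto simp: G_def)
    also have "\<dots> \<le> measure N (\<Union>i. U i - F i) + measure N (G n)"
      using Gm by (intro measure_Un_le)
    finally have "measure N ((\<Union>i. U i) - (\<Union>i\<le>n. F i)) \<le> e" using 1 n by simp
    moreover have "closed (\<Union>i\<le>n. F i)" "open (\<Union>i. U i)" using FU by (auto intro!: closed_UN)
    moreover have "(\<Union>i\<le>n. F i) \<subseteq> (\<Union>i. A i)" using FU(3) by blast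
    moreover have "(\<Union>i. A i) \<subseteq> (\<Union>i. U i)" using FU(4) by blast
    ultimately show ?case by blast
  qed
qed

text \<open>The measure lives on a subspace; pushing it forward along the inclusion makes regularity
  on the whole space available.\<close>

lemma outer_regular_restrict:
  fixes S :: "'a::metric_space set"
  assumes M: "finite_measure M" "sets M = sets (restrict_space borel S)" and S: "closed S"
    and A: "A \<in> sets M" and e: "0 < (e::real)"
  obtains U where "open U" "A \<subseteq> U" "measure M (U \<inter> S) \<le> measure M A + e"
proof -
  interpret finite_measure M by fact
  have sp: "space M = S" using sets_eq_imp_space_eq[OF M(2)] by (simp add: space_restrict_space)
  have id: "(\<lambda>x. x) \<in> measurable M borel"
    by (subst measurable_cong_sets[OF M(2) refl]) (rule measurable_restrict_space1, simp)
  define N where "N = distr M borel (\<lambda>x. x)"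
  have N: "finite_measure N" unfolding N_def using id by (rule finite_measure_distr)
  have mN: "measure N B = measure M (B \<inter> S)" if "B \<in> sets borel" for B
    unfolding N_def using id that by (simp add: measure_distr sp)
  have "A \<in> sets borel" "A \<subseteq> S" using A M(2) S by (auto simp: sets_restrict_space)
  then obtain F U where FU: "closed F" "open U" "F \<subseteq> A" "A \<subseteq> U" "measure N (U - F) \<le> e"
    using finite_borel_measure_regular[OF N _ _ e, of A] by (auto simp: N_def)
  have FM: "B \<inter> S \<in> sets M" if "B \<in> sets borel" for B using M(2) that by (auto simp: sets_restrict_space)
  have "measure M (U \<inter> S) \<le> measure M (A \<union> ((U - F) \<inter> S))"
    using FU A FM[of U] FM[of "U - F"] by (intro finite_measure_mono) auto
  also have "\<dots> \<le> measure M A + measure M ((U - F) \<inter> S)"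
    using FU A FM[of "U - F"] by (intro measure_Un_le) auto
  also have "measure M ((U - F) \<inter> S) \<le> e" using FU mN[of "U - F"] by simp
  finally show ?thesis using that FU by simp
qed

text \<open>Null sets are brought into this form because the time spent in an open set is lower
  semicontinuous under limits of curves.\<close>

lemma null_set_G_delta:
  fixes S :: "'a::metric_space set"
  assumes M: "finite_measure M" "sets M = sets (restrict_space borel S)" and S: "closed S"
    and A: "A \<in> null_sets M"
  obtains V :: "nat \<Rightarrow> 'a set" where "\<And>k. open (V k)" "decseq V" "A \<subseteq> (\<Inter>k. V k)" "(\<Inter>k. V k) \<inter> S \<in> null_sets M"
proof -
  interpret finite_measure M by fact
  have A0: "A \<in> sets M" "measure M A = 0" using A by (auto simp: null_sets_def measure_def)
  have "\<exists>U. open U \<and> A \<subseteq> U \<and> measure M (U \<inter> S) \<le> 1 / real (Suc k)" for k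
    using outer_regular_restrict[OF M S A0(1), of "1 / real (Suc k)"] A0(2) by (metis add_0 of_nat_0_less_iff zero_less_Suc divide_pos_pos zero_less_one)
  then obtain U where U: "\<And>k. open (U k)" "\<And>k. A \<subseteq> U k" "\<And>k. measure M (U k \<inter> S) \<le> 1 / real (Suc k)" by metis
  define V where "V k = (\<Inter>i\<le>k. U i)" for k
  have FM: "B \<inter> S \<in> sets M" if "B \<in> sets borel" for B using M(2) that by (auto simp: sets_restrict_space)
  have oV: "open (V k)" for k unfolding V_def using U by (intro open_INT) auto
  have EV: "(\<Inter>k. V k) \<in> sets borel" using oV by (intro sets.countable_INT) auto
  have "measure M ((\<Inter>k. V k) \<inter> S) \<le> 1 / real (Suc k)" for k
  proof -
    have "measure M ((\<Inter>k. V k) \<inter> S) \<le> measure M (U k \<inter> S)"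
      using FM[of "U k"] U by (intro finite_measure_mono) (auto simp: V_def)
    then show ?thesis using U(3)[of k] by simp
  qed
  moreover have "(\<lambda>k. 1 / real (Suc k)) \<longlonglongrightarrow> 0" using LIMSEQ_inverse_real_of_nat by (simp add: inverse_eq_divide)
  ultimately have "measure M ((\<Inter>k. V k) \<inter> S) \<le> 0" by (intro LIMSEQ_le_const) auto
  then have "(\<Inter>k. V k) \<inter> S \<in> null_sets M"
    using FM[OF EV] by (auto simp: null_sets_def emeasure_eq_measure measure_le_0_iff)
  moreover have "decseq V" by (auto simp: decseq_def V_def)
  moreover have "A \<subseteq> (\<Inter>k. V k)" using U by (auto simp: V_def)
  ultimately show ?thesis using that oV by blast
qed

section \<open>Doubling measures\<close>

lemma doubling_finite:
  fixes S :: "'a::metric_space set"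
  assumes d: "doubling_measure_on S Cd M" and S: "bounded S" "S \<noteq> {}"
  shows "finite_measure M" "space M = S" "\<And>x r. ball x r \<inter> S \<in> sets M"
proof -
  have sM: "sets M = sets (restrict_space borel S)" using d by (simp add: doubling_measure_on_def)
  show sp: "space M = S" using sets_eq_imp_space_eq[OF sM] by (simp add: space_restrict_space)
  show "ball x r \<inter> S \<in> sets M" for x r unfolding sM sets_restrict_space by auto
  obtain x where x: "x \<in> S" using S by blast
  obtain e where e: "\<And>y. y \<in> S \<Longrightarrow> dist x y \<le> e" using S bounded_any_center[of S x] by auto
  have "S \<subseteq> ball x (\<bar>e\<bar> + 1)" using e by force
  then have "ball x (\<bar>e\<bar> + 1) \<inter> S = S" by auto
  moreover have "emeasure M (ball x (\<bar>e\<bar> + 1) \<inter> S) < \<infinity>" using d x unfolding doubling_measure_on_def by (metis abs_ge_zero add_nonneg_pos zero_less_one)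
  ultimately show "finite_measure M" using sp by (intro finite_measureI) auto
qed

lemma doubling_measure_real:
  fixes S :: "'a::metric_space set"
  assumes d: "doubling_measure_on S Cd M" and S: "bounded S" and x: "x \<in> S" and r: "0 < r"
  shows "0 < measure M (ball x r \<inter> S)" "measure M (ball x (2 ^ k * r) \<inter> S) \<le> Cd ^ k * measure M (ball x r \<inter> S)"
proof -
  have ne: "S \<noteq> {}" using x by auto
  interpret finite_measure M by (rule doubling_finite[OF d S ne])
  have Cd: "1 \<le> Cd" using d by (simp add: doubling_measure_on_def)
  show "0 < measure M (ball x r \<inter> S)"
    using d x r unfolding doubling_measure_on_def by (auto simp: emeasure_eq_measure)
  have one: "measure M (ball x (2 * s) \<inter> S) \<le> Cd * measure M (ball x s \<inter> S)" if "0 < s" for s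
  proof -
    have "ennreal (measure M (ball x (2 * s) \<inter> S)) \<le> ennreal Cd * ennreal (measure M (ball x s \<inter> S))"
      using d x that unfolding doubling_measure_on_def emeasure_eq_measure[symmetric] by auto
    also have "\<dots> = ennreal (Cd * measure M (ball x s \<inter> S))" using Cd by (simp add: ennreal_mult)
    finally show ?thesis using Cd by (subst (asm) ennreal_le_iff) auto
  qed
  show "measure M (ball x (2 ^ k * r) \<inter> S) \<le> Cd ^ k * measure M (ball x r \<inter> S)"
  proof (induction k)
    case (Suc k)
    have "measure M (ball x (2 ^ Suc k * r) \<inter> S) \<le> Cd * measure M (ball x (2 ^ k * r) \<inter> S)"
      using one[of "2 ^ k * r"] r by (simp add: mult.assoc)
    also have "\<dots> \<le> Cd * (Cd ^ k * measure M (ball x r \<inter> S))" using Suc Cd by (intro mult_left_mono) auto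
    finally show ?case by simp
  qed simp
qed

text \<open>Doubling the radius \<open>k\<close> times reaches all of \<open>S\<close> once
  \<open>2 ^ k\<close> is at least \<open>D / r\<close>, at the price
  \<open>Cd ^ k = (2 ^ k) powr Q\<close>.\<close>

lemma doubling_mass_bound:
  fixes S :: "'a::metric_space set"
  assumes d: "doubling_measure_on S Cd M" and S: "bounded S" "S \<noteq> {}" and Q: "Q = log 2 Cd" and R: "0 < R"
  obtains c where "0 < c" "\<And>x r. x \<in> S \<Longrightarrow> 0 < r \<Longrightarrow> r \<le> R \<Longrightarrow> c * r powr Q \<le> measure M (ball x r \<inter> S)"
proof -
  interpret finite_measure M by (rule doubling_finite[OF d S])
  have sp: "space M = S" by (rule doubling_finite[OF d S])
  have Cd: "1 \<le> Cd" using d by (simp add: doubling_measure_on_def)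
  have Q0: "0 \<le> Q" using Cd by (simp add: Q)
  obtain x0 where x0: "x0 \<in> S" using S by blast
  obtain e where e: "\<And>y. y \<in> S \<Longrightarrow> dist x0 y \<le> e" using S bounded_any_center[of S x0] by auto
  \<comment> \<open>Large enough for every ball of radius \<open>D\<close> centred in
    \<open>S\<close> to contain \<open>S\<close>.\<close>
  define D where "D = max R (2 * \<bar>e\<bar> + 1)"
  have D: "R \<le> D" "0 < D" using R by (auto simp: D_def)
  have SD: "ball x s \<inter> S = S" if "x \<in> S" "D \<le> s" for x s
  proof -
    have "dist x y < s" if "y \<in> S" for y
      using dist_triangle3[of x y x0] e[OF \<open>x \<in> S\<close>] e[OF that] \<open>D \<le> s\<close> by (auto simp: D_def)
    then show ?thesis by auto
  qed
  have m0: "0 < measure M S" using doubling_measure_real(1)[OF d S(1) x0 D(2)] SD[OF x0 order.refl] by simp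
  show ?thesis
  proof (rule that[of "measure M S / (2 * D) powr Q"])
    show "0 < measure M S / (2 * D) powr Q" using m0 D by simp
    fix x r assume x: "x \<in> S" and r: "0 < r" "r \<le> R"
    define k where "k = nat \<lceil>log 2 (D / r)\<rceil>"
    have l0: "0 \<le> log 2 (D / r)" using r D by simp
    have k: "log 2 (D / r) \<le> real k" "real k \<le> log 2 (D / r) + 1" unfolding k_def using l0 by linarith+
    have "D / r = 2 powr log 2 (D / r)" using r D by simp
    also have "\<dots> \<le> 2 powr real k" using k by (intro powr_mono) auto
    finally have "D \<le> 2 ^ k * r" using r by (simp add: powr_realpow field_simps)
    then have "measure M S \<le> Cd ^ k * measure M (ball x r \<inter> S)"
      using doubling_measure_real(2)[OF d S(1) x r(1), of k] SD[OF x] by simp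
    also have "Cd ^ k = (2 powr real k) powr Q"
    proof -
      have "Cd ^ k = (2 powr Q) powr real k" using Cd by (simp add: powr_realpow Q)
      then show ?thesis by (simp only: powr_powr mult.commute)
    qed
    \<comment> \<open>Rounding \<open>k\<close> up costs at most a factor 2, hence the
      \<open>2 * D\<close> in the constant.\<close>
    also have "(2 powr real k) powr Q * measure M (ball x r \<inter> S) \<le> (2 * D / r) powr Q * measure M (ball x r \<inter> S)"
    proof (intro mult_right_mono powr_mono2 Q0)
      have "2 powr real k \<le> 2 powr (log 2 (D / r) + 1)" using k by (intro powr_mono) auto
      also have "\<dots> = 2 * D / r" using r D by (simp add: powr_add)
      finally show "2 powr real k \<le> 2 * D / r" .
    qed auto
    finally show "measure M S / (2 * D) powr Q * r powr Q \<le> measure M (ball x r \<inter> S)"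
      using r D by (simp add: powr_divide field_simps)
  qed
qed

text \<open>Takes a separated set of greatest cardinality. Its balls of half the radius are disjoint
  and have measure at least \<open>m\<close>, which bounds the cardinality, and a point left
  uncovered could be added. Doubling leads from the disjoint balls to the last bound.\<close>

lemma doubling_net:
  fixes S :: "'a::metric_space set"
  assumes d: "doubling_measure_on S Cd M" and S: "bounded S" "S \<noteq> {}" and r: "0 < r"
  obtains Z where "finite Z" "Z \<subseteq> S" "pairwise (\<lambda>x y. r \<le> dist x y) Z" "S \<subseteq> (\<Union>z\<in>Z. ball z r)"
    "(\<Sum>z\<in>Z. measure M (ball z r \<inter> S)) \<le> Cd * measure M S"
proof -
  interpret finite_measure M by (rule doubling_finite[OF d S])
  have sp: "space M = S" and bM: "\<And>x r. ball x r \<inter> S \<in> sets M" by (rule doubling_finite[OF d S])+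
  have Cd: "1 \<le> Cd" using d by (simp add: doubling_measure_on_def)
  obtain c where c: "0 < c" "\<And>x s. x \<in> S \<Longrightarrow> 0 < s \<Longrightarrow> s \<le> r \<Longrightarrow> c * s powr log 2 Cd \<le> measure M (ball x s \<inter> S)"
    using doubling_mass_bound[OF d S refl r] by metis
  define m where "m = c * (r / 2) powr log 2 Cd"
  have m: "0 < m" using c r by (simp add: m_def)
  define G where "G Z \<longleftrightarrow> finite Z \<and> Z \<subseteq> S \<and> pairwise (\<lambda>x y. r \<le> dist x y) Z" for Z
  have half: "(\<Sum>z\<in>Z. measure M (ball z (r/2) \<inter> S)) \<le> measure M S" if "G Z" for Z
  proof -
    have "disjoint_family_on (\<lambda>z. ball z (r/2) \<inter> S) Z"
      unfolding disjoint_family_on_def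
    proof (intro ballI impI)
      fix x y assume "x \<in> Z" "y \<in> Z" "x \<noteq> y"
      then have "r \<le> dist x y" using that by (auto simp: G_def pairwise_def)
      have "False" if "dist x z < r / 2" "dist y z < r / 2" for z
        using dist_triangle2[of x y z] that \<open>r \<le> dist x y\<close> by simp
      then show "ball x (r/2) \<inter> S \<inter> (ball y (r/2) \<inter> S) = {}" by auto
    qed
    then have "(\<Sum>z\<in>Z. measure M (ball z (r/2) \<inter> S)) = measure M (\<Union>z\<in>Z. ball z (r/2) \<inter> S)"
      using that bM by (intro finite_measure_finite_Union[symmetric]) (auto simp: G_def)
    also have "\<dots> \<le> measure M S" using sp sets.top[of M] by (intro finite_measure_mono) auto
    finally show ?thesis .
  qed
  have bound: "card Z \<le> nat \<lceil>measure M S / m\<rceil>" if "G Z" for Z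
  proof -
    have "real (card Z) * m \<le> (\<Sum>z\<in>Z. measure M (ball z (r/2) \<inter> S))"
      using that c(2)[of _ "r/2"] r unfolding m_def by (intro sum_bounded_below) (auto simp: G_def)
    then have "real (card Z) * m \<le> measure M S" using half[OF that] by simp
    then have "real (card Z) \<le> measure M S / m" using m by (simp add: field_simps)
    then show ?thesis by linarith
  qed
  have "G {}" by (simp add: G_def)
  obtain Z where Z: "G Z" "\<And>Z'. G Z' \<Longrightarrow> card Z' \<le> card Z"
    using ex_has_greatest_nat[of G "{}" card "Suc (nat \<lceil>measure M S / m\<rceil>)"] \<open>G {}\<close> bound by (metis le_imp_less_Suc)
  have cov: "S \<subseteq> (\<Union>z\<in>Z. ball z r)"
  proof (rule ccontr)
    assume "\<not> ?thesis"
    then have "\<exists>x\<in>S. \<forall>z\<in>Z. x \<notin> ball z r" by blast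
    then obtain x where x: "x \<in> S" "\<And>z. z \<in> Z \<Longrightarrow> r \<le> dist z x" by (auto simp: not_less)
    then have "x \<notin> Z" using r by force
    have "G (insert x Z)" using Z(1) x unfolding G_def by (auto simp: pairwise_insert dist_commute)
    then show False using Z(2)[of "insert x Z"] \<open>x \<notin> Z\<close> Z(1) by (auto simp: G_def)
  qed
  have "(\<Sum>z\<in>Z. measure M (ball z r \<inter> S)) \<le> (\<Sum>z\<in>Z. Cd * measure M (ball z (r/2) \<inter> S))"
    using doubling_measure_real(2)[OF d S(1), of _ "r/2" 1] r Z(1) by (intro sum_mono) (auto simp: G_def)
  also have "\<dots> = Cd * (\<Sum>z\<in>Z. measure M (ball z (r/2) \<inter> S))" by (simp add: sum_distrib_left)
  also have "\<dots> \<le> Cd * measure M S" using half[OF Z(1)] Cd by (intro mult_left_mono) auto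
  finally show ?thesis using that[of Z] Z(1) cov by (auto simp: G_def)
qed

lemma doubling_compact:
  fixes S :: "'a::complete_space set"
  assumes d: "doubling_measure_on S Cd M" and S: "bounded S" "S \<noteq> {}" "closed S"
  shows "compact S"
  unfolding compact_eq_totally_bounded
proof (intro conjI allI impI)
  show "complete S" using S by (simp add: complete_eq_closed)
  fix e :: real assume e: "0 < e"
  show "\<exists>k. finite k \<and> S \<subseteq> (\<Union>x\<in>k. ball x e)" by (rule doubling_net[OF d S(1,2) e]) auto
qed

section \<open>Means, oscillation and Chebyshev's inequality\<close>

lemma mean_oscillation_real:
  assumes M: "finite_measure M" and B: "B \<in> sets M" "0 < measure M B"
    and w: "w \<in> borel_measurable M" "\<And>x. \<bar>w x\<bar> \<le> N"
    and osc: "mean_oscillation M B w \<le> ennreal A" and A: "0 \<le> A"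
  defines "m \<equiv> (LINT z:B|M. w z) / measure M B"
  shows "(LINT z:B|M. \<bar>w z - m\<bar>) \<le> A * measure M B"
proof -
  interpret finite_measure M by fact
  have iw: "integrable M w" by (rule integrable_const_bound[of _ N]) (use w in auto)
  have i: "set_integrable M B (\<lambda>z. \<bar>w z - m\<bar>)"
    unfolding set_integrable_def using iw B
    by (intro integrable_mult_indicator integrable_abs Bochner_Integration.integrable_diff) auto
  have "(\<integral>\<^sup>+z\<in>B. ennreal \<bar>w z - m\<bar> \<partial>M) = (\<integral>\<^sup>+z. ennreal (indicator B z *\<^sub>R \<bar>w z - m\<bar>) \<partial>M)"
    by (intro nn_integral_cong) (auto simp: indicator_def)
  also have "\<dots> = ennreal (LINT z:B|M. \<bar>w z - m\<bar>)"
    unfolding set_lebesgue_integral_def using i unfolding set_integrable_def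
    by (intro nn_integral_eq_integral) (auto simp: indicator_def)
  finally have "ennreal (LINT z:B|M. \<bar>w z - m\<bar>) / emeasure M B \<le> ennreal A"
    using osc unfolding mean_oscillation_def m_def[symmetric] Let_def by simp
  moreover have nn: "0 \<le> (LINT z:B|M. \<bar>w z - m\<bar>)"
    unfolding set_lebesgue_integral_def by (intro integral_nonneg_AE) (auto simp: indicator_def)
  ultimately have "ennreal ((LINT z:B|M. \<bar>w z - m\<bar>) / measure M B) \<le> ennreal A"
    using B by (simp add: emeasure_eq_measure divide_ennreal)
  then show ?thesis using A B by (simp add: ennreal_le_iff field_simps)
qed

text \<open>The difference is at most the mean over \<open>B'\<close> of the deviation of
  \<open>w\<close> from its mean over \<open>B\<close>; averaging over \<open>B\<close> instead
  costs the ratio of the measures.\<close>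

lemma mean_subset_diff:
  assumes M: "finite_measure M" and B: "B \<in> sets M" "B' \<in> sets M" "B' \<subseteq> B" "0 < measure M B'"
    and w: "w \<in> borel_measurable M" "\<And>x. \<bar>w x\<bar> \<le> N"
    and osc: "mean_oscillation M B w \<le> ennreal A" and A: "0 \<le> A"
    and \<kappa>: "measure M B \<le> \<kappa> * measure M B'"
  shows "\<bar>(LINT z:B'|M. w z) / measure M B' - (LINT z:B|M. w z) / measure M B\<bar> \<le> \<kappa> * A"
proof -
  interpret finite_measure M by fact
  define m where "m = (LINT z:B|M. w z) / measure M B"
  have mB: "0 < measure M B" using B finite_measure_mono[of B' B] by simp
  have iw: "integrable M w" by (rule integrable_const_bound[of _ N]) (use w in auto)
  have i: "set_integrable M C (\<lambda>z. w z - m)" if "C \<in> sets M" for C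
    unfolding set_integrable_def using iw that
    by (intro integrable_mult_indicator Bochner_Integration.integrable_diff) auto
  have iw': "set_integrable M B' w" unfolding set_integrable_def using iw B by (intro integrable_mult_indicator) auto
  have ic: "set_integrable M B' (\<lambda>_. m)" unfolding set_integrable_def using B by (intro integrable_mult_indicator) auto
  have "(LINT z:B'|M. w z - m) = (LINT z:B'|M. w z) - (LINT z:B'|M. m)"
    using iw' ic by (rule set_integral_diff)
  also have "(LINT z:B'|M. m) = measure M B' * m"
    using B by (simp add: set_lebesgue_integral_def)
  finally have "measure M B' * \<bar>(LINT z:B'|M. w z) / measure M B' - m\<bar> = \<bar>LINT z:B'|M. w z - m\<bar>"
    using B by (simp add: abs_mult_pos' right_diff_distrib flip: abs_mult_pos)
  also have "\<dots> \<le> (LINT z:B'|M. \<bar>w z - m\<bar>)"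
    using set_integral_norm_bound[OF i[OF B(2)]] by simp
  also have "\<dots> \<le> (LINT z:B|M. \<bar>w z - m\<bar>)"
    unfolding set_lebesgue_integral_def
    using set_integrable_abs[OF i[OF B(1)]] set_integrable_abs[OF i[OF B(2)]] B(3)
    by (intro integral_mono) (auto simp: set_integrable_def indicator_def)
  also have "\<dots> \<le> A * measure M B"
    using mean_oscillation_real[OF M B(1) mB w osc A] by (simp add: m_def)
  also have "\<dots> \<le> A * (\<kappa> * measure M B')" using \<kappa> A by (intro mult_left_mono) auto
  also have "\<dots> = measure M B' * (\<kappa> * A)" by (simp only: mult.commute mult.left_commute)
  finally show ?thesis unfolding m_def[symmetric] by (rule mult_left_le_imp_le[OF _ B(4)])
qed

text \<open>Where \<open>w\<close> exceeds \<open>2 * L\<close> it deviates from its mean by more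
  than \<open>L\<close>, so Chebyshev's inequality applies.\<close>

lemma measure_superlevel:
  assumes M: "finite_measure M" and B: "B \<in> sets M" "0 < measure M B"
    and w: "w \<in> borel_measurable M" "\<And>x. \<bar>w x\<bar> \<le> N"
    and osc: "mean_oscillation M B w \<le> ennreal A" and A: "0 \<le> A"
    and L: "0 < L" "(LINT z:B|M. w z) / measure M B \<le> L"
  shows "measure M {z\<in>B. 2 * L < w z} \<le> A / L * measure M B"
proof -
  interpret finite_measure M by fact
  define m where "m = (LINT z:B|M. w z) / measure M B"
  have sp: "B \<subseteq> space M" using B sets.sets_into_space by auto
  have C: "{z\<in>B. 2 * L < w z} \<in> sets M"
  proof -
    have "{z\<in>B. 2 * L < w z} = B \<inter> {z\<in>space M. 2 * L < w z}" using sp by auto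
    also have "\<dots> \<in> sets M" using B w by measurable
    finally show ?thesis .
  qed
  have iw: "integrable M w" by (rule integrable_const_bound[of _ N]) (use w in auto)
  have i: "integrable M (\<lambda>z. indicator B z * \<bar>w z - m\<bar>)"
    using integrable_mult_indicator[OF B(1), of "\<lambda>z. \<bar>w z - m\<bar>"] iw by simp
  have "L * measure M {z\<in>B. 2 * L < w z} = (LINT z|M. indicator {z\<in>B. 2 * L < w z} z * L)"
    using C by simp
  also have "\<dots> \<le> (LINT z|M. indicator B z * \<bar>w z - m\<bar>)"
  proof (rule integral_mono)
    show "integrable M (\<lambda>z. indicator {z\<in>B. 2 * L < w z} z * L)" using C by (simp add: emeasure_eq_measure)
    show "indicator {z\<in>B. 2 * L < w z} z * L \<le> indicator B z * \<bar>w z - m\<bar>" for z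
      using L by (auto simp: indicator_def m_def[symmetric])
  qed (rule i)
  also have "\<dots> \<le> A * measure M B"
    using mean_oscillation_real[OF M B w osc A] by (simp add: m_def set_lebesgue_integral_def)
  finally show ?thesis using L by (simp add: field_simps)
qed

lemma powr_dyadic: "0 < c \<Longrightarrow> (c / 2 ^ n) powr \<alpha> = c powr \<alpha> * (2 powr (- \<alpha>)) ^ n" for c :: real
proof -
  assume c: "0 < c"
  have "c / 2 ^ n = c * 2 powr (- real n)" by (simp add: powr_minus powr_realpow divide_inverse)
  then have "(c / 2 ^ n) powr \<alpha> = c powr \<alpha> * (2 powr (- real n)) powr \<alpha>" using c by (simp add: powr_mult)
  also have "(2 powr (- real n)) powr \<alpha> = (2 powr (- \<alpha>)) powr real n" by (simp add: powr_powr mult.commute)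
  also have "\<dots> = (2 powr (- \<alpha>)) ^ n" by (simp add: powr_realpow)
  finally show ?thesis .
qed

lemma geometric_sum_le: "(\<Sum>i<n. q ^ i) \<le> 1 / (1 - q)" if "0 < q" "q < 1" for q :: real
  using that sum_le_suminf[of "\<lambda>i. q ^ i" "{..<n}"] summable_geometric[of q] suminf_geometric[of q] by simp

lemma finite_measure_completion: "finite_measure M \<Longrightarrow> finite_measure (completion M)"
  by (intro finite_measureI) (simp add: finite_measure.emeasure_finite)

text \<open>Telescoping over concentric balls bounds the mean of \<open>w\<close> over all small balls with centre near
  \<open>x0\<close>. Chebyshev's inequality on the balls of a fine net then bounds \<open>w\<close> itself, so that Lebesgue's
  differentiation theorem is not needed.\<close>

definition ae_const :: "real \<Rightarrow> real \<Rightarrow> real" where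
  "ae_const Cd \<alpha> = 2 * 4 powr \<alpha> * (2 * Cd ^ 4 + Cd / (1 - 2 powr (- \<alpha>)))"

lemma AE_le_of_oscillation:
  fixes S :: "'a::metric_space set"
  assumes d: "doubling_measure_on S Cd M" and S: "bounded S"
    and w: "w \<in> borel_measurable (completion M)" "\<And>x. 0 \<le> w x" "\<And>x. w x \<le> N"
    and osc: "\<And>x r. x \<in> S \<Longrightarrow> 0 < r \<Longrightarrow> r \<le> R \<Longrightarrow>
        mean_oscillation (completion M) (ball x r \<inter> S) w \<le> ennreal (A * r powr \<alpha>)"
    and A: "0 < A" and \<alpha>: "0 < \<alpha>" and x0: "x0 \<in> S" and r: "0 < r" "4 * r \<le> R"
    and w0: "\<And>z. z \<in> ball x0 (r / 4) \<inter> S \<Longrightarrow> w z = 0"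
  shows "AE z in M. z \<in> ball x0 r \<longrightarrow> w z \<le> ae_const Cd \<alpha> * A * r powr \<alpha>"
proof -
  have ne: "S \<noteq> {}" using x0 by auto
  note fin = doubling_finite(1)[OF d S ne] and sp = doubling_finite(2)[OF d S ne]
    and bM = doubling_finite(3)[OF d S ne]
  have Cd: "1 \<le> Cd" using d by (simp add: doubling_measure_on_def)
  define M' where "M' = completion M"
  have fin': "finite_measure M'" unfolding M'_def using fin by (rule finite_measure_completion)
  interpret finite_measure M' by fact
  have bM': "ball x s \<inter> S \<in> sets M'" for x s unfolding M'_def using bM by simp
  have wm: "w \<in> borel_measurable M'" using w by (simp add: M'_def)
  have wN: "\<bar>w x\<bar> \<le> N" for x using w(2,3)[of x] by simp
  define \<mu> where "\<mu> x s = measure M' (ball x s \<inter> S)" for x s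
  define m where "m x s = (LINT z:(ball x s \<inter> S)|M'. w z) / \<mu> x s" for x s
  have \<mu>: "0 < \<mu> x s" "\<mu> x (2 ^ k * s) \<le> Cd ^ k * \<mu> x s" if "x \<in> S" "0 < s" for x s k
    using doubling_measure_real[OF d S that] bM by (simp_all add: \<mu>_def M'_def)
  have \<mu>mono: "\<mu> x s \<le> \<mu> y t" if "ball x s \<subseteq> ball y t" for x y s t
    unfolding \<mu>_def using that bM' by (intro finite_measure_mono) auto
  have osc': "mean_oscillation M' (ball x s \<inter> S) w \<le> ennreal (A * s powr \<alpha>)"
    if "x \<in> S" "0 < s" "s \<le> R" for x s using osc[OF that] by (simp add: M'_def)
  have A0: "0 \<le> A * s powr \<alpha>" for s using A by simp
  have cmp: "\<bar>m x s - m y t\<bar> \<le> \<kappa> * (A * t powr \<alpha>)"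
    if "x \<in> S" "0 < s" "y \<in> S" "0 < t" "t \<le> R" "ball x s \<subseteq> ball y t" "\<mu> y t \<le> \<kappa> * \<mu> x s" for x y s t \<kappa>
    unfolding m_def \<mu>_def
    using that \<mu>(1)[of x s]
    by (intro mean_subset_diff[OF fin' bM' bM' _ _ wm wN osc' A0]) (auto simp: \<mu>_def)
  define q where "q = 2 powr (- \<alpha>)"
  have q: "0 < q" "q < 1" using \<alpha> by (auto simp: q_def powr_less_one)
  define B where "B = A * (4 * r) powr \<alpha>"
  have B: "0 < B" using A r by (simp add: B_def)
  \<comment> \<open>\<open>B\<close> is the oscillation bound on the ball of radius
    \<open>4 * r\<close>. The factor \<open>Cd ^ 4\<close> arises twice, from comparing the radii
    \<open>4 * r\<close> and \<open>r / 4\<close> and from moving the centre from \<open>x0\<close>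
    to \<open>z\<close>; the last term is the telescoping sum. The final bound \<open>2 * L\<close>
    is the one recorded in \<open>ae_const\<close>.\<close>
  define L where "L = B * (2 * Cd ^ 4 + Cd / (1 - q))"
  have L: "0 < L" unfolding L_def using B Cd q by (intro mult_pos_pos add_pos_nonneg) auto
  have r4: "0 < r / 4" using r by simp
  have m4: "m x0 (4 * r) \<le> Cd ^ 4 * B"
  proof -
    have "\<mu> x0 (4 * r) \<le> Cd ^ 4 * \<mu> x0 (r / 4)" using \<mu>(2)[OF x0 r4, of 4] by simp
    then have "\<bar>m x0 (r / 4) - m x0 (4 * r)\<bar> \<le> Cd ^ 4 * (A * (4 * r) powr \<alpha>)"
      using x0 r by (intro cmp subset_ball) auto
    moreover have "m x0 (r / 4) = 0"
    proof -
      have "(LINT z:(ball x0 (r/4) \<inter> S)|M'. w z) = (LINT z:(ball x0 (r/4) \<inter> S)|M'. 0)"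
        using w0 bM' by (intro set_lebesgue_integral_cong) auto
      then show ?thesis by (simp add: m_def)
    qed
    ultimately show ?thesis by (simp add: B_def)
  qed
  \<comment> \<open>The radii start at \<open>2 * r\<close>, so that the first ball around a point
    within \<open>2 * r\<close> of \<open>x0\<close> lies in the ball of radius \<open>4 * r\<close>
    around \<open>x0\<close>.\<close>
  define s where "s k = 2 * r / 2 ^ k" for k :: nat
  have s: "0 < s k" "s k \<le> 2 * r" for k using r by (auto simp: s_def field_simps)
  have sq: "s k powr \<alpha> = (2 * r) powr \<alpha> * q ^ k" for k
    unfolding s_def q_def using r by (intro powr_dyadic) simp
  have ms: "m z (s k) \<le> L" if z: "z \<in> S" "dist x0 z < 2 * r" for z k
  proof -
    have sub: "ball z (2 * r) \<subseteq> ball x0 (4 * r)"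
    proof
      fix y assume "y \<in> ball z (2 * r)"
      then show "y \<in> ball x0 (4 * r)" using z(2) dist_triangle[of x0 y z] by simp
    qed
    have sub2: "ball x0 (4 * r) \<subseteq> ball z (8 * r)"
    proof
      fix y assume "y \<in> ball x0 (4 * r)"
      then show "y \<in> ball z (8 * r)" using z(2) dist_triangle3[of z y x0] r by simp
    qed
    have "\<mu> x0 (4 * r) \<le> \<mu> z (2 ^ 2 * (2 * r))" using \<mu>mono[OF sub2] by simp
    also have "\<dots> \<le> Cd ^ 2 * \<mu> z (2 * r)" using z r by (intro \<mu>) auto
    \<comment> \<open>The power is raised to merge this term with the bound
      \<open>m4\<close>.\<close>
    also have "\<dots> \<le> Cd ^ 4 * \<mu> z (2 * r)"
      using \<mu>(1)[of z "2 * r"] z r Cd by (intro mult_right_mono power_increasing) auto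
    finally have "\<bar>m z (2 * r) - m x0 (4 * r)\<bar> \<le> Cd ^ 4 * (A * (4 * r) powr \<alpha>)"
      using x0 z r sub by (intro cmp) auto
    then have m0: "m z (s 0) \<le> 2 * Cd ^ 4 * B" using m4 by (simp add: B_def s_def)
    have step: "m z (s (Suc k)) \<le> m z (s k) + Cd * B * q ^ k" for k
    proof -
      have sk: "s k = 2 * s (Suc k)" by (simp add: s_def)
      then have "\<mu> z (s k) \<le> Cd * \<mu> z (s (Suc k))" using \<mu>(2)[OF z(1) s(1), of 1 "Suc k"] by simp
      then have "\<bar>m z (s (Suc k)) - m z (s k)\<bar> \<le> Cd * (A * s k powr \<alpha>)"
        using z s[of k] s[of "Suc k"] r sk by (intro cmp subset_ball) auto
      moreover have "A * s k powr \<alpha> \<le> B * q ^ k"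
      proof -
        have "s k powr \<alpha> = (2 * r) powr \<alpha> * q ^ k" by (rule sq)
        also have "\<dots> \<le> (4 * r) powr \<alpha> * q ^ k"
          using r \<alpha> q by (intro mult_right_mono powr_mono2) auto
        finally show ?thesis using A by (simp add: B_def mult.assoc)
      qed
      ultimately show ?thesis using Cd by (smt (verit) mult.assoc mult_left_mono)
    qed
    have "m z (s k) \<le> 2 * Cd ^ 4 * B + Cd * B * (\<Sum>i<k. q ^ i)"
    proof (induction k)
      case (Suc k) then show ?case using step[of k] by (simp add: algebra_simps)
    qed (use m0 in simp)
    also have "(\<Sum>i<k. q ^ i) \<le> 1 / (1 - q)"
      using q by (rule geometric_sum_le)
    finally show ?thesis using Cd B by (simp add: L_def algebra_simps mult_left_mono)
  qed
  have K: "2 * L = ae_const Cd \<alpha> * A * r powr \<alpha>"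
    using r by (simp add: L_def B_def ae_const_def q_def powr_mult algebra_simps)
  define bad where "bad = {z\<in>ball x0 r \<inter> S. 2 * L < w z}"
  have badM: "{z\<in>C. 2 * L < w z} \<in> sets M'" if "C \<in> sets M'" for C
  proof -
    have "{z\<in>C. 2 * L < w z} = C \<inter> {z\<in>space M'. 2 * L < w z}" using sets.sets_into_space[OF that] by auto
    also have "\<dots> \<in> sets M'" using that wm by measurable
    finally show ?thesis .
  qed
  \<comment> \<open>The total measure of the net balls is bounded independently of \<open>k\<close>,
    so the factor \<open>s k powr \<alpha>\<close> drives the bound to 0. The restriction on
    \<open>k\<close> gives \<open>s k \<le> r\<close>, which keeps the relevant centres within
    \<open>2 * r\<close> of \<open>x0\<close>.\<close>
  have "measure M' bad \<le> A * s k powr \<alpha> / L * (Cd * measure M S)" if k: "1 \<le> k" for k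
  proof -
    obtain Z where Z: "finite Z" "Z \<subseteq> S" "S \<subseteq> (\<Union>z\<in>Z. ball z (s k))"
      "(\<Sum>z\<in>Z. measure M (ball z (s k) \<inter> S)) \<le> Cd * measure M S"
      using doubling_net[OF d S ne s(1)[of k]] by metis
    have sr: "s k \<le> r"
    proof -
      have "(2::real) ^ 1 \<le> 2 ^ k" using k by (intro power_increasing) auto
      then show ?thesis using r by (simp add: s_def field_simps)
    qed
    define X where "X z = {y\<in>ball z (s k) \<inter> S. 2 * L < w y}" for z
    have XM: "X z \<in> sets M'" for z unfolding X_def by (rule badM[OF bM'])
    define Z' where "Z' = {z\<in>Z. dist x0 z < 2 * r}"
    have Z': "finite Z'" "Z' \<subseteq> Z" using Z by (auto simp: Z'_def)
    have "bad \<subseteq> (\<Union>z\<in>Z'. X z)"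
    proof
      fix y assume y: "y \<in> bad"
      then obtain z where z: "z \<in> Z" "dist z y < s k" using Z(3) by (auto simp: bad_def)
      have "dist x0 z < 2 * r" using y z sr dist_triangle2[of x0 z y] by (simp add: bad_def)
      then show "y \<in> (\<Union>z\<in>Z'. X z)"
        using y z by (auto simp: bad_def Z'_def X_def)
    qed
    then have "measure M' bad \<le> measure M' (\<Union>z\<in>Z'. X z)"
      using XM Z' by (intro finite_measure_mono sets.finite_UN) auto
    also have "\<dots> \<le> (\<Sum>z\<in>Z'. measure M' (X z))"
      using XM Z' by (intro measure_UNION_le) auto
    also have "\<dots> \<le> (\<Sum>z\<in>Z'. A * s k powr \<alpha> / L * \<mu> z (s k))"
    proof (rule sum_mono)
      fix z assume "z \<in> Z'"
      then have z: "z \<in> S" "dist x0 z < 2 * r" using Z by (auto simp: Z'_def)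
      show "measure M' (X z) \<le> A * s k powr \<alpha> / L * \<mu> z (s k)"
        unfolding \<mu>_def X_def
        using \<mu>(1)[OF z(1) s(1)[of k]] ms[OF z, of k] osc'[OF z(1) s(1)[of k]] s[of k] r
        by (intro measure_superlevel[OF fin' bM' _ wm wN _ A0 L]) (auto simp: \<mu>_def m_def)
    qed
    also have "\<dots> \<le> (\<Sum>z\<in>Z. A * s k powr \<alpha> / L * \<mu> z (s k))"
      using Z' Z(1) A L by (intro sum_mono2) (auto simp: \<mu>_def)
    also have "\<dots> = A * s k powr \<alpha> / L * (\<Sum>z\<in>Z. measure M (ball z (s k) \<inter> S))"
      using bM by (simp add: sum_distrib_left \<mu>_def M'_def)
    also have "\<dots> \<le> A * s k powr \<alpha> / L * (Cd * measure M S)"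
      using Z A L by (intro mult_left_mono) auto
    finally show ?thesis .
  qed
  moreover have "(\<lambda>k. A * s k powr \<alpha> / L * (Cd * measure M S)) \<longlonglongrightarrow> A * 0 / L * (Cd * measure M S)"
  proof (intro tendsto_intros)
    have "(\<lambda>k. (2 * r) powr \<alpha> * q ^ k) \<longlonglongrightarrow> (2 * r) powr \<alpha> * 0"
      using q by (intro tendsto_intros LIMSEQ_realpow_zero) auto
    then show "(\<lambda>k. s k powr \<alpha>) \<longlonglongrightarrow> 0" by (simp add: sq)
  qed (use L in auto)
  ultimately have "measure M' bad \<le> 0"
    by (intro LIMSEQ_le_const[of _ 0]) auto
  then have "bad \<in> null_sets M'"
    using badM[OF bM'] by (auto simp: null_sets_def bad_def emeasure_eq_measure measure_le_0_iff)
  then have "AE z in M'. z \<notin> bad" by (rule AE_not_in)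
  then have "AE z in M. z \<notin> bad" by (simp only: M'_def AE_completion_iff)
  with AE_space[of M] show ?thesis
    by eventually_elim (use K in \<open>auto simp: bad_def sp not_less\<close>)
qed

section \<open>Curves avoiding a null set\<close>

lemma lip_curve_tail:
  assumes \<gamma>: "lip_curve S \<gamma> T" and s: "0 \<le> s" "s \<le> T"
  shows "lip_curve S (\<lambda>t. \<gamma> (s + t)) (T - s)"
    "\<phi> \<in> borel_on S \<Longrightarrow> cost \<phi> (\<lambda>t. \<gamma> (s + t)) (T - s) \<le> cost \<phi> \<gamma> T"
proof -
  show 1: "lip_curve S (\<lambda>t. \<gamma> (s + t)) (T - s)"
    unfolding lip_curve_def
  proof (intro conjI allI)
    fix a b show "dist (\<gamma> (s + a)) (\<gamma> (s + b)) \<le> \<bar>a - b\<bar>"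
      using \<gamma> unfolding lip_curve_def by (metis add_diff_cancel_left)
  qed (use \<gamma> s in \<open>auto simp: lip_curve_def\<close>)
  assume \<phi>: "\<phi> \<in> borel_on S"
  have [measurable]: "(\<lambda>t. \<phi> (\<gamma> t)) \<in> borel_measurable borel" by (rule lip_curve_measurable[OF \<gamma> \<phi>])
  have "cost \<phi> \<gamma> T = (\<integral>\<^sup>+t. \<phi> (\<gamma> (s + 1 * t)) * indicator {0..T} (s + 1 * t) \<partial>lborel)"
    unfolding cost_def by (subst nn_integral_real_affine[of _ 1 s]) auto
  also have "\<dots> \<ge> cost \<phi> (\<lambda>t. \<gamma> (s + t)) (T - s)"
    unfolding cost_def using s by (intro nn_integral_mono) (auto simp: indicator_def)
  finally show "cost \<phi> (\<lambda>t. \<gamma> (s + t)) (T - s) \<le> cost \<phi> \<gamma> T" .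
qed

lemma cost_indicator_le:
  assumes "lip_curve S \<gamma> T" "\<And>x. x \<in> S \<Longrightarrow> 1 \<le> h x"
  shows "cost (indicator W) \<gamma> T \<le> cost h \<gamma> T"
proof (rule cost_mono)
  fix t
  have "(indicator W (\<gamma> t) :: ennreal) \<le> 1" by (simp add: indicator_def)
  also have "1 \<le> h (\<gamma> t)" using assms by (auto simp: lip_curve_def)
  finally show "indicator W (\<gamma> t) \<le> h (\<gamma> t)" .
qed

lemma ae_const_pos: "1 \<le> Cd \<Longrightarrow> 0 < \<alpha> \<Longrightarrow> 0 < ae_const Cd \<alpha>"
  unfolding ae_const_def by (intro mult_pos_pos add_pos_nonneg) (auto simp: powr_less_one intro!: divide_nonneg_nonneg less_imp_le)

text \<open>The form in which the Poincare inequalities are used: (A1) gives the exponent \<open>1 - Q / p\<close> and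
  (A2) the exponent \<open>1\<close>. The null set \<open>E\<close> is arbitrary because the right-hand sides of the
  inequalities do not see it.\<close>

definition oscillation_bound ::
    "'a::metric_space set \<Rightarrow> 'a measure \<Rightarrow> ('a \<Rightarrow> ennreal) \<Rightarrow> real \<Rightarrow> real \<Rightarrow> real \<Rightarrow> bool" where
  "oscillation_bound S M h R A \<alpha> \<longleftrightarrow>
     (\<forall>E w N x r. E \<in> sets borel \<longrightarrow> E \<inter> S \<in> null_sets M \<longrightarrow>
       w \<in> borel_measurable (completion M) \<longrightarrow> (\<forall>x. 0 \<le> w x \<and> w x \<le> N) \<longrightarrow>
       upper_gradient_on S (\<lambda>x. h x + \<infinity> * indicator E x) w \<longrightarrow> x \<in> S \<longrightarrow> 0 < r \<longrightarrow> r \<le> R \<longrightarrow>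
       mean_oscillation (completion M) (ball x r \<inter> S) w \<le> ennreal (A * r powr \<alpha>))"

text \<open>The path distance is truncated at twice its almost everywhere bound \<open>K\<close>, so
  where that bound holds the truncation is inactive and a curve of cost below \<open>2 * K\<close>
  exists. Keeping the end point off \<open>P\<close> is what permits further extensions; it is
  achieved by cutting off a short piece of the curve, which spends no time in an intersection of
  open sets containing \<open>P\<close>.\<close>

lemma short_connection:
  fixes S :: "'a::complete_space set"
  assumes d: "doubling_measure_on S Cd M" and S: "bounded S" "closed S"
    and h: "h \<in> borel_on S" "seq_lsc S h" "\<And>x. x \<in> S \<Longrightarrow> 1 \<le> h x"
    and osc: "oscillation_bound S M h R A \<alpha>"
    and A: "0 < A" and \<alpha>: "0 < \<alpha>" and x0: "x0 \<in> S" and r: "0 < r" "4 * r \<le> R"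
    and P: "P \<in> null_sets M" "E \<inter> S \<subseteq> P"
  shows "AE z in M. z \<in> ball x0 r \<longrightarrow> (\<exists>\<gamma> T. lip_curve S \<gamma> T \<and> \<gamma> 0 = z \<and> \<gamma> T \<in> ball x0 (r / 2) \<and> \<gamma> T \<notin> P \<and>
     cost h \<gamma> T \<le> ennreal (2 * ae_const Cd \<alpha> * A * r powr \<alpha>) \<and> cost (indicator E) \<gamma> T = 0)"
proof -
  have ne: "S \<noteq> {}" using x0 by auto
  note fin = doubling_finite(1)[OF d S(1) ne] and sp = doubling_finite(2)[OF d S(1) ne]
  have sM: "sets M = sets (restrict_space borel S)" and Cd: "1 \<le> Cd" using d by (auto simp: doubling_measure_on_def)
  have cS: "compact S" by (rule doubling_compact[OF d S(1) ne S(2)])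
  \<comment> \<open>\<open>P\<close> is merely a null set, while
    \<open>trunc_reach_measurable\<close> asks for a decreasing sequence of open sets.\<close>
  obtain V where V: "\<And>k::nat. open (V k)" "decseq V" "P \<subseteq> (\<Inter>k. V k)" "(\<Inter>k. V k) \<inter> S \<in> null_sets M"
    using null_set_G_delta[OF fin sM S(2) P(1)] by metis
  define W where "W = (\<Inter>k. V k)"
  have W: "W \<in> sets borel" unfolding W_def using V by (intro sets.countable_INT) auto
  define \<rho> where "\<rho> = (\<lambda>x. h x + \<infinity> * indicator W x)"
  have "(indicator W :: _ \<Rightarrow> ennreal) \<in> borel_on S"
    by (rule indicator_borel_restrict[OF W])
  then have \<rho>: "\<rho> \<in> borel_on S" unfolding \<rho>_def using h(1) by measurable
  define K where "K = ae_const Cd \<alpha> * A * r powr \<alpha>"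
  have K: "0 < K" unfolding K_def using ae_const_pos[OF Cd \<alpha>] A r by simp
  define w where "w = trunc_reach S \<rho> (cball x0 (r / 4)) (2 * K)"
  have w: "w \<in> borel_measurable (completion M)"
    unfolding w_def \<rho>_def W_def by (rule trunc_reach_measurable[OF cS fin sM h V(1,2)]) auto
  have wb: "0 \<le> w z" "w z \<le> 2 * K" for z unfolding w_def using trunc_reach_bounds[of "2 * K"] K by auto
  have ug: "upper_gradient_on S \<rho> w"
    unfolding w_def using K by (intro trunc_reach_upper_gradient \<rho>) auto
  have "AE z in M. z \<in> ball x0 r \<longrightarrow> w z \<le> K"
    unfolding K_def
  proof (rule AE_le_of_oscillation[OF d S(1) w wb _ A \<alpha> x0 r])
    show "mean_oscillation (completion M) (ball x r \<inter> S) w \<le> ennreal (A * r powr \<alpha>)"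
      if "x \<in> S" "0 < r" "r \<le> R" for x r
      using osc[unfolded oscillation_bound_def, rule_format, OF W _ w _ _ that] ug V(4) wb
      by (auto simp: \<rho>_def W_def)
    show "w z = 0" if "z \<in> ball x0 (r / 4) \<inter> S" for z
      using that reach_cost_eq_0[of z S "cball x0 (r/4)" \<rho>] by (simp add: w_def trunc_reach_def)
  qed
  moreover have "AE z in M. z \<notin> P" using P by (intro AE_not_in)
  moreover note AE_space[of M]
  ultimately show ?thesis
  proof eventually_elim
    case (elim z)
    show ?case
    proof
      assume "z \<in> ball x0 r"
      then have wz: "w z \<le> K" using elim by simp
      have "reach_cost S \<rho> (cball x0 (r / 4)) z < ennreal (2 * K)"
      proof (rule ccontr)
        assume "\<not> ?thesis"
        then have "w z = 2 * K" unfolding w_def trunc_reach_def using K by (simp add: min_absorb1)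
        then show False using wz K by simp
      qed
      then obtain \<gamma> T where g: "lip_curve S \<gamma> T" "\<gamma> 0 \<in> cball x0 (r / 4)" "\<gamma> T = z" "cost \<rho> \<gamma> T < ennreal (2 * K)"
        using reach_cost_lessD by blast
      have "cost h \<gamma> T + \<infinity> * cost (indicator W) \<gamma> T < ennreal (2 * K)"
        using g(4) cost_penalized[OF g(1) h(1) W] by (simp add: \<rho>_def)
      then have c: "cost h \<gamma> T \<le> ennreal (2 * K)" "cost (indicator W) \<gamma> T = 0"
        by (auto simp: ennreal_top_mult split: if_splits intro: order.trans less_imp_le)
      have T: "0 \<le> T" using g by (simp add: lip_curve_def)
      have gS: "\<gamma> t \<in> S" for t using g by (auto simp: lip_curve_def)
      \<comment> \<open>The curve starts within \<open>r / 4\<close> of \<open>x0\<close> and has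
        speed at most 1, so cutting it before time \<open>r / 4\<close> leaves the new end within
        \<open>r / 2\<close>.\<close>
      have "\<exists>s. 0 \<le> s \<and> s \<le> T \<and> s < r / 4 \<and> \<gamma> s \<notin> P"
      proof (cases "T = 0")
        case True
        then show ?thesis using elim g r by (intro exI[of _ 0]) auto
      next
        case False
        \<comment> \<open>Any positive time up to \<open>T\<close> and below \<open>r / 4\<close>
          would serve.\<close>
        define b where "b = min T (r / 5)"
        have b: "0 < b" "b \<le> T" "b < r / 4" using False T r by (auto simp: b_def)
        show ?thesis
        proof (rule ccontr)
          assume nex: "\<not> ?thesis"
          have in_W: "\<gamma> s \<in> W" if "s \<in> {0..b}" for s
          proof -
            have "0 \<le> s \<and> s \<le> T \<and> s < r / 4" using that b by auto
            then have "\<gamma> s \<in> P" using nex by blast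
            then show ?thesis using V(3) by (auto simp: W_def)
          qed
          have "ennreal b = (\<integral>\<^sup>+t. indicator {0..b} t \<partial>lborel)" using b by simp
          also have "\<dots> \<le> cost (indicator W) \<gamma> T"
            unfolding cost_def using in_W b by (intro nn_integral_mono) (auto simp: indicator_def)
          finally show False using c(2) b by simp
        qed
      qed
      then obtain s where s: "0 \<le> s" "s \<le> T" "s < r / 4" "\<gamma> s \<notin> P" by blast
      define \<eta> where "\<eta> = (\<lambda>t. \<gamma> (s + t))"
      have \<eta>: "lip_curve S \<eta> (T - s)" unfolding \<eta>_def by (rule lip_curve_tail(1)[OF g(1) s(1,2)])
      have iW: "(indicator W :: _ \<Rightarrow> ennreal) \<in> borel_on S" by (rule indicator_borel_restrict[OF W])
      \<comment> \<open>Curves in \<open>reach_cost\<close> start at the small ball, whereas here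
        \<open>z\<close> has to be the start.\<close>
      define \<kappa> where "\<kappa> = (\<lambda>t. \<eta> (T - s - t))"
      have \<kappa>: "lip_curve S \<kappa> (T - s)" unfolding \<kappa>_def by (rule cost_reverse(1)[OF \<eta> h(1)])
      have "cost h \<kappa> (T - s) \<le> cost h \<gamma> T"
        using cost_reverse(2)[OF \<eta> h(1)] lip_curve_tail(2)[OF g(1) s(1,2) h(1)] by (simp add: \<kappa>_def \<eta>_def)
      moreover have "cost (indicator E) \<kappa> (T - s) \<le> cost (indicator W) \<kappa> (T - s)"
      proof (rule cost_mono)
        fix t have "\<kappa> t \<in> S" using gS by (simp add: \<kappa>_def \<eta>_def)
        then show "(indicator E (\<kappa> t) :: ennreal) \<le> indicator W (\<kappa> t)"
          using P(2) V(3) by (auto simp: indicator_def W_def)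
      qed
      moreover have "cost (indicator W) \<kappa> (T - s) \<le> cost (indicator W) \<gamma> T"
        using cost_reverse(2)[OF \<eta> iW] lip_curve_tail(2)[OF g(1) s(1,2) iW] by (simp add: \<kappa>_def \<eta>_def)
      moreover have "\<kappa> 0 = z" using g by (simp add: \<kappa>_def \<eta>_def)
      moreover have ks: "\<kappa> (T - s) = \<gamma> s" by (simp add: \<kappa>_def \<eta>_def)
      moreover have "\<gamma> s \<in> ball x0 (r / 2)"
      proof -
        have "dist (\<gamma> 0) (\<gamma> s) \<le> \<bar>0 - s\<bar>" using g(1) unfolding lip_curve_def by blast
        then show ?thesis using g(2) s dist_triangle[of x0 "\<gamma> s" "\<gamma> 0"] by simp
      qed
      ultimately show "\<exists>\<gamma> T. lip_curve S \<gamma> T \<and> \<gamma> 0 = z \<and> \<gamma> T \<in> ball x0 (r / 2) \<and> \<gamma> T \<notin> P \<and>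
          cost h \<gamma> T \<le> ennreal (2 * ae_const Cd \<alpha> * A * r powr \<alpha>) \<and> cost (indicator E) \<gamma> T = 0"
        using \<kappa> s(4) c by (intro exI[of _ \<kappa>] exI[of _ "T - s"]) (auto simp: K_def mult.assoc)
    qed
  qed
qed


text \<open>The constant is the sum of a geometric series: two connections of cost at most
  \<open>len n\<close> for each stage \<open>n\<close>, one at either end, with radius
  \<open>2 * dist x y\<close> at stage 0.\<close>

lemma avoiding_curve:
  fixes S :: "'a::complete_space set" and V :: "nat \<Rightarrow> 'a set"
  assumes d: "doubling_measure_on S Cd M" and S: "bounded S" "closed S"
    and h: "h \<in> borel_on S" "seq_lsc S h" "\<And>x. x \<in> S \<Longrightarrow> 1 \<le> h x"
    and osc: "oscillation_bound S M h R A \<alpha>"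
    and A: "0 < A" and \<alpha>: "0 < \<alpha>" and x: "x \<in> S" and y: "y \<in> S" and xy: "x \<noteq> y" "8 * dist x y \<le> R"
    and V: "\<And>k. open (V k)" "decseq V" "(\<Inter>k. V k) \<inter> S \<in> null_sets M"
  shows "\<exists>\<gamma> T. lip_curve S \<gamma> T \<and> \<gamma> 0 = x \<and> \<gamma> T = y \<and> cost (indicator (\<Inter>k. V k)) \<gamma> T = 0 \<and>
     cost h \<gamma> T \<le> ennreal (4 * ae_const Cd \<alpha> * A * 2 powr \<alpha> / (1 - 2 powr (- \<alpha>)) * dist x y powr \<alpha>)"
proof -
  have ne: "S \<noteq> {}" using x by auto
  note fin = doubling_finite(1)[OF d S(1) ne] and sp = doubling_finite(2)[OF d S(1) ne]
    and bM = doubling_finite(3)[OF d S(1) ne]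
  interpret finite_measure M by (rule fin)
  have Cd: "1 \<le> Cd" using d by (auto simp: doubling_measure_on_def)
  have cS: "compact S" by (rule doubling_compact[OF d S(1) ne S(2)])
  define E where "E = (\<Inter>k. V k)"
  have Vb: "V k \<in> sets borel" for k using V by simp
  have Eb: "E \<in> sets borel" unfolding E_def using Vb by (intro sets.countable_INT) auto
  have iV: "(indicator (V k) :: _ \<Rightarrow> ennreal) \<in> borel_on S" for k by (rule indicator_borel_restrict[OF Vb])
  have iE: "(indicator E :: _ \<Rightarrow> ennreal) \<in> borel_on S" by (rule indicator_borel_restrict[OF Eb])
  define D where "D = dist x y"
  have D: "0 < D" using xy by (simp add: D_def)
  \<comment> \<open>With \<open>r 0 = 2 * D\<close> every point of \<open>ball x D\<close> is within
    \<open>r 0\<close> of both \<open>x\<close> and \<open>y\<close>, and a constant curve can start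
    the construction. The hypothesis on \<open>R\<close> is \<open>4 * r 0 \<le> R\<close>.\<close>
  define r where "r n = 2 * D / 2 ^ n" for n :: nat
  have r: "0 < r n" "4 * r n \<le> R" "r (Suc n) = r n / 2" for n
  proof -
    show "0 < r n" using D by (simp add: r_def)
    have "r n \<le> 2 * D" using D by (simp add: r_def field_simps)
    then show "4 * r n \<le> R" using xy by (simp add: D_def)
  qed (simp add: r_def)
  have rlim: "r \<longlonglongrightarrow> 0"
  proof -
    have "(\<lambda>n. 2 * D * (1 / 2) ^ n) \<longlonglongrightarrow> 2 * D * 0" by (intro tendsto_intros LIMSEQ_realpow_zero) auto
    moreover have "r = (\<lambda>n. 2 * D * (1 / 2) ^ n)" by (rule ext) (simp add: r_def power_divide)
    ultimately show ?thesis by simp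
  qed
  define q where "q = 2 powr (- \<alpha>)"
  have q: "0 < q" "q < 1" using \<alpha> by (auto simp: q_def powr_less_one)
  define len where "len n = 2 * ae_const Cd \<alpha> * A * r n powr \<alpha>" for n
  have ac: "0 < ae_const Cd \<alpha>" by (rule ae_const_pos[OF Cd \<alpha>])
  have len0: "0 \<le> len n" for n using ac A by (simp add: len_def)
  have lenq: "len n = len 0 * q ^ n" for n
    using powr_dyadic[of "2 * D" n \<alpha>] D by (simp add: len_def r_def q_def)
  define c where "c = 2 * len 0 / (1 - q)"
  have tail: "(\<Sum>i\<in>{j..<n}. 2 * len i) \<le> c * q ^ j" for j n
  proof (cases "j \<le> n")
    case True
    have "(\<Sum>i\<in>{j..<n}. 2 * len i) = (\<Sum>i<n - j. 2 * len (i + j))"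
      using sum.shift_bounds_nat_ivl[of "\<lambda>i. 2 * len i" 0 j "n - j"] True by (simp add: atLeast0LessThan)
    also have "\<dots> = (\<Sum>i<n - j. 2 * len 0 * q ^ j * q ^ i)"
      by (intro sum.cong refl) (subst lenq, simp add: power_add)
    also have "\<dots> = 2 * len 0 * q ^ j * (\<Sum>i<n - j. q ^ i)" by (simp add: sum_distrib_left)
    also have "\<dots> \<le> 2 * len 0 * q ^ j * (1 / (1 - q))"
      using len0 q by (intro mult_left_mono geometric_sum_le) auto
    finally show ?thesis by (simp add: c_def)
  next
    case False then show ?thesis using len0[of 0] q by (simp add: c_def)
  qed
  \<comment> \<open>The sum in the last clause allows for what is added to the curve after stage \<open>j\<close>, when the
    index \<open>k j\<close> is fixed.\<close>
  define Q where "Q n k \<gamma> T \<longleftrightarrow> lip_curve S \<gamma> T \<and> \<gamma> 0 \<in> ball x (r n) \<and> \<gamma> T \<in> ball y (r n) \<and>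
      cost h \<gamma> T \<le> ennreal (\<Sum>i<n. 2 * len i) \<and> cost (indicator E) \<gamma> T = 0 \<and>
      (\<forall>j<n. cost (indicator (V (k j))) \<gamma> T \<le> ennreal (1 / real (Suc j) + (\<Sum>i\<in>{j..<n}. 2 * len i)))"
    for n and k :: "nat \<Rightarrow> nat" and \<gamma> T
  \<comment> \<open>End points outside every given null set: otherwise the curve could not be extended. This
    survives the choice of \<open>k n\<close>, as countably many null sets cannot rule out all its values.\<close>
  define Good where "Good n k \<longleftrightarrow> (\<forall>P\<in>null_sets M. \<exists>\<gamma> T. Q n k \<gamma> T \<and> \<gamma> 0 \<notin> P \<and> \<gamma> T \<notin> P)" for n k
  have Good0: "Good 0 k" for k
    unfolding Good_def
  proof
    fix P assume P: "P \<in> null_sets M"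
    have "0 < measure M (ball x D \<inter> S)" by (rule doubling_measure_real(1)[OF d S(1) x D])
    then have "\<not> ball x D \<inter> S \<subseteq> P"
      using finite_measure_mono[of "ball x D \<inter> S" P] P by (auto simp: null_sets_def measure_def)
    then obtain z where z: "z \<in> ball x D" "z \<in> S" "z \<notin> P" by blast
    have "dist y z < 2 * D" using z(1) dist_triangle3[of y z x] by (simp add: D_def dist_commute)
    then have "Q 0 k (\<lambda>_. z) 0" using z D by (auto simp: Q_def r_def lip_curve_const)
    then show "\<exists>\<gamma> T. Q 0 k \<gamma> T \<and> \<gamma> 0 \<notin> P \<and> \<gamma> T \<notin> P" using z by blast
  qed
  have step: "\<exists>m. Good (Suc n) (k(n := m))" if G: "Good n k" for n k
  proof -
    define X where "X m P \<longleftrightarrow> (\<exists>\<gamma> T. Q n k \<gamma> T \<and> \<gamma> 0 \<notin> P \<and> \<gamma> T \<notin> P \<and> cost (indicator (V m)) \<gamma> T \<le> ennreal (1 / real (Suc n)))" for m P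
    have "\<exists>m. \<forall>P\<in>null_sets M. X m P"
    proof (rule ccontr)
      assume "\<not> ?thesis"
      then have "\<forall>m. \<exists>P. P \<in> null_sets M \<and> \<not> X m P"
        by blast
      from choice[OF this] obtain P where P: "\<And>m. P m \<in> null_sets M" "\<And>m. \<not> X m (P m)" by blast
      have "(\<Union>m. P m) \<in> null_sets M" using P(1) by (intro null_sets_UN) auto
      then obtain \<gamma> T where g: "Q n k \<gamma> T" "\<gamma> 0 \<notin> (\<Union>m. P m)" "\<gamma> T \<notin> (\<Union>m. P m)"
        using G unfolding Good_def by blast
      \<comment> \<open>A curve whose ends avoid all the failing null sets at once still spends
        little time in some \<open>V m\<close>, because it spends none in the intersection.\<close>
      obtain m where "cost (indicator (V m)) \<gamma> T \<le> ennreal (1 / real (Suc n))"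
        using cost_indicator_decseq[OF _ Vb V(2), of S \<gamma> T "1 / real (Suc n)"] g(1) by (auto simp: Q_def E_def)
      then show False using P(2)[of m] g unfolding X_def by blast
    qed
    then obtain m where m: "\<And>P. P \<in> null_sets M \<Longrightarrow> X m P"
      by blast
    have "Good (Suc n) (k(n := m))"
      unfolding Good_def
    proof
      fix P assume P: "P \<in> null_sets M"
      define P' where "P' = P \<union> E \<inter> S"
      have P': "P' \<in> null_sets M" "E \<inter> S \<subseteq> P'" using P V(3) by (auto simp: P'_def E_def)
      define C where "C a z \<longleftrightarrow> (\<exists>\<gamma> T. lip_curve S \<gamma> T \<and> \<gamma> 0 = z \<and> \<gamma> T \<in> ball a (r n / 2) \<and> \<gamma> T \<notin> P' \<and>
         cost h \<gamma> T \<le> ennreal (len n) \<and> cost (indicator E) \<gamma> T = 0)" for a z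
      have C: "AE z in M. z \<in> ball a (r n) \<longrightarrow> C a z" if "a \<in> S" for a
        unfolding C_def len_def
        by (rule short_connection[OF d S h osc A \<alpha> that r(1,2) P'])
      have "AE z in M. (z \<in> ball x (r n) \<longrightarrow> C x z) \<and> (z \<in> ball y (r n) \<longrightarrow> C y z)"
        using C[OF x] C[OF y] by eventually_elim blast
      \<comment> \<open>The points from which an extension fails form a null set; the curve is
        chosen only afterwards, with both ends outside it.\<close>
      then obtain P'' where P'': "P'' \<in> null_sets M" "{z\<in>space M. \<not> ((z \<in> ball x (r n) \<longrightarrow> C x z) \<and> (z \<in> ball y (r n) \<longrightarrow> C y z))} \<subseteq> P''"
        unfolding eventually_ae_filter by blast
      obtain \<gamma> T where g: "Q n k \<gamma> T" "\<gamma> 0 \<notin> P''" "\<gamma> T \<notin> P''" "cost (indicator (V m)) \<gamma> T \<le> ennreal (1 / real (Suc n))"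
        using m[OF P''(1)] unfolding X_def by blast
      have gl: "lip_curve S \<gamma> T" and g0: "\<gamma> 0 \<in> ball x (r n)" "\<gamma> T \<in> ball y (r n)" using g(1) by (auto simp: Q_def)
      have gS: "\<gamma> t \<in> S" for t using gl by (auto simp: lip_curve_def)
      have "C x (\<gamma> 0)" "C y (\<gamma> T)" using P''(2) g(2,3) g0 gS sp by blast+
      then obtain \<eta> U \<zeta> W where
        e: "lip_curve S \<eta> U" "\<eta> 0 = \<gamma> 0" "\<eta> U \<in> ball x (r n / 2)" "\<eta> U \<notin> P'" "cost h \<eta> U \<le> ennreal (len n)" "cost (indicator E) \<eta> U = 0"
        and z: "lip_curve S \<zeta> W" "\<zeta> 0 = \<gamma> T" "\<zeta> W \<in> ball y (r n / 2)" "\<zeta> W \<notin> P'" "cost h \<zeta> W \<le> ennreal (len n)" "cost (indicator E) \<zeta> W = 0"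
        unfolding C_def by blast
      define \<eta>' where "\<eta>' = (\<lambda>t. \<eta> (U - t))"
      have e': "lip_curve S \<eta>' U" "\<eta>' 0 = \<eta> U" "\<eta>' U = \<gamma> 0"
        and ec: "\<And>\<phi>. \<phi> \<in> borel_on S \<Longrightarrow> cost \<phi> \<eta>' U = cost \<phi> \<eta> U"
        unfolding \<eta>'_def using cost_reverse[OF e(1)] h(1) e(2) by auto
      obtain \<kappa> where k1: "lip_curve S \<kappa> (U + T)" "\<kappa> 0 = \<eta>' 0" "\<kappa> (U + T) = \<gamma> T"
        and k1c: "\<And>\<phi>. \<phi> \<in> borel_on S \<Longrightarrow> cost \<phi> \<kappa> (U + T) = cost \<phi> \<eta>' U + cost \<phi> \<gamma> T"
        by (rule lip_curve_concat[OF e'(1) gl e'(3)]) (rule that; assumption)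
      obtain \<kappa>' where k2: "lip_curve S \<kappa>' (U + T + W)" "\<kappa>' 0 = \<kappa> 0" "\<kappa>' (U + T + W) = \<zeta> W"
        and k2c': "\<And>\<phi>. \<phi> \<in> borel_on S \<Longrightarrow> cost \<phi> \<kappa>' (U + T + W) = cost \<phi> \<kappa> (U + T) + cost \<phi> \<zeta> W"
        by (rule lip_curve_concat[OF k1(1) z(1) trans[OF k1(3) z(2)[symmetric]]]) (rule that; assumption)
      have k0: "\<kappa>' 0 = \<eta> U" using k2(2) k1(2) e'(2) by simp
      have k2c: "cost \<phi> \<kappa>' (U + T + W) = cost \<phi> \<eta> U + cost \<phi> \<gamma> T + cost \<phi> \<zeta> W"
        if "\<phi> \<in> borel_on S" for \<phi>
        by (simp only: k2c'[OF that] k1c[OF that] ec[OF that])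
      have add: "a + b + c \<le> ennreal (s + 2 * len n)" if "a \<le> ennreal (len n)" "c \<le> ennreal (len n)" "b \<le> ennreal s" "0 \<le> s" for a b c s
      proof -
        have "a + b + c \<le> ennreal (len n) + ennreal s + ennreal (len n)" using that by (intro add_mono)
        also have "\<dots> = ennreal (s + 2 * len n)" using that len0 by (simp flip: ennreal_plus add: algebra_simps)
        finally show ?thesis .
      qed
      \<comment> \<open>Since \<open>h\<close> is at least 1, a connection of cost at most
        \<open>len n\<close> lasts no longer than that and adds at most \<open>len n\<close> to the
        time spent in any set.\<close>
      have iu: "cost (indicator F) \<eta> U \<le> ennreal (len n)" "cost (indicator F) \<zeta> W \<le> ennreal (len n)" for F
        using cost_indicator_le[OF e(1) h(3)] cost_indicator_le[OF z(1) h(3)] e(5) z(5) by (meson order.trans)+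
      have "Q (Suc n) (k(n := m)) \<kappa>' (U + T + W)"
        unfolding Q_def
      proof (intro conjI allI impI)
        show "\<kappa>' 0 \<in> ball x (r (Suc n))" "\<kappa>' (U + T + W) \<in> ball y (r (Suc n))" 
          unfolding r(3) k0 k2(3) using e(3) z(3) by auto
        show "cost h \<kappa>' (U + T + W) \<le> ennreal (\<Sum>i<Suc n. 2 * len i)"
          using add[OF e(5) z(5)] g(1) len0 by (simp add: k2c[OF h(1)] Q_def sum_nonneg)
        show "cost (indicator E) \<kappa>' (U + T + W) = 0"
          using e(6) z(6) g(1) by (simp add: k2c[OF iE] Q_def)
        fix j assume j: "j < Suc n"
        \<comment> \<open>For \<open>j = n\<close> the sum is empty and the bound is the one imposed
          in the choice of \<open>m\<close>.\<close>
        have b: "cost (indicator (V ((k(n := m)) j))) \<gamma> T \<le> ennreal (1 / real (Suc j) + (\<Sum>i\<in>{j..<n}. 2 * len i))"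
          using j g(1,4) by (cases "j = n") (auto simp: Q_def)
        have s: "(\<Sum>i\<in>{j..<Suc n}. 2 * len i) = (\<Sum>i\<in>{j..<n}. 2 * len i) + 2 * len n" using j by simp
        have "0 \<le> 1 / real (Suc j) + (\<Sum>i\<in>{j..<n}. 2 * len i)" using len0 by (intro add_nonneg_nonneg sum_nonneg) auto
        from add[OF iu b this]
        show "cost (indicator (V ((k(n := m)) j))) \<kappa>' (U + T + W) \<le> ennreal (1 / real (Suc j) + (\<Sum>i\<in>{j..<Suc n}. 2 * len i))"
          unfolding k2c[OF iV] s by (simp add: add.assoc)
      qed (rule k2)
      moreover have "\<kappa>' 0 \<notin> P" "\<kappa>' (U + T + W) \<notin> P" using k0 k2(3) e z by (auto simp: P'_def)
      ultimately show "\<exists>\<gamma> T. Q (Suc n) (k(n := m)) \<gamma> T \<and> \<gamma> 0 \<notin> P \<and> \<gamma> T \<notin> P" by blast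
    qed
    then show ?thesis by blast
  qed
  have "\<exists>f. \<forall>n. Good n (f n) \<and> (\<forall>j<n. f (Suc n) j = f n j)"
  proof (rule dependent_nat_choice)
    show "\<exists>k. Good 0 k" using Good0 by blast
    fix k n assume "Good n k"
    then obtain m where "Good (Suc n) (k(n := m))" using step by blast
    then show "\<exists>k'. Good (Suc n) k' \<and> (\<forall>j<n. k' j = k j)" by (intro exI[of _ "k(n := m)"]) auto
  qed
  then obtain f where f: "\<And>n. Good n (f n)" "\<And>n j. j < n \<Longrightarrow> f (Suc n) j = f n j" by auto
  define k where "k j = f (Suc j) j" for j
  have fk: "f n j = k j" if "j < n" for n j
    using that
  proof (induction n)
    case (Suc n)
    then show ?case using f(2)[of j n] by (cases "j = n") (auto simp: k_def)
  qed simp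
  have "\<forall>n. \<exists>p. Q n (f n) (fst p) (snd p)"
  proof
    fix n
    obtain \<gamma> T where "Q n (f n) \<gamma> T" using f(1)[of n] unfolding Good_def by blast
    then show "\<exists>p. Q n (f n) (fst p) (snd p)" by (intro exI[of _ "(\<gamma>, T)"]) simp
  qed
  from choice[OF this] obtain p where p: "\<And>n. Q n (f n) (fst (p n)) (snd (p n))" by blast
  define \<gamma> where "\<gamma> n = fst (p n)" for n
  define T where "T n = snd (p n)" for n
  have g: "Q n (f n) (\<gamma> n) (T n)" for n using p by (simp add: \<gamma>_def T_def)
  have gl: "lip_curve S (\<gamma> n) (T n)" for n using g by (simp add: Q_def)
  have c0: "0 \<le> c" using len0[of 0] q by (simp add: c_def)
  have gh: "cost h (\<gamma> n) (T n) \<le> ennreal c" for n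
  proof -
    have "cost h (\<gamma> n) (T n) \<le> ennreal (\<Sum>i<n. 2 * len i)" using g by (simp add: Q_def)
    also have "\<dots> \<le> ennreal c" using tail[of 0 n] by (intro ennreal_leI) (simp add: atLeast0LessThan)
    finally show ?thesis .
  qed
  have Tc: "T n \<le> c" for n
  proof -
    have "ennreal (T n) \<le> ennreal c" using cost_ge_time[OF gl h(3)] gh by (rule order.trans)
    then show ?thesis using c0 by (simp add: ennreal_le_iff)
  qed
  obtain s \<gamma>' T' where lim: "strict_mono (s::nat\<Rightarrow>nat)" "lip_curve S \<gamma>' T'" "T' \<le> c"
    "(\<lambda>n. \<gamma> (s n) 0) \<longlonglongrightarrow> \<gamma>' 0" "(\<lambda>n. \<gamma> (s n) (T (s n))) \<longlonglongrightarrow> \<gamma>' T'"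
    "\<And>\<phi> b. \<phi> \<in> borel_on S \<Longrightarrow> seq_lsc S \<phi> \<Longrightarrow>
       (\<forall>\<^sub>F n in sequentially. cost \<phi> (\<gamma> n) (T n) \<le> b) \<Longrightarrow> cost \<phi> \<gamma>' T' \<le> b"
    by (rule lip_curve_limit[OF cS gl Tc]) (rule that; assumption)
  have conv: "l = a" if "\<And>n. dist a (v n) < r n" "(\<lambda>n. v (s n)) \<longlonglongrightarrow> l" for l a v
  proof -
    have "v \<longlonglongrightarrow> a"
    proof (rule iffD2[OF tendsto_dist_iff], rule tendsto_sandwich[OF _ _ tendsto_const rlim])
      show "\<forall>\<^sub>F n in sequentially. dist (v n) a \<le> r n"
        using that(1) by (intro always_eventually allI) (metis dist_commute less_imp_le)
    qed simp
    then show ?thesis using LIMSEQ_unique[OF that(2) LIMSEQ_subseq_LIMSEQ[OF _ lim(1), of v a, unfolded o_def]] by simp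
  qed
  have "\<gamma>' 0 = x" by (rule conv[of x "\<lambda>n. \<gamma> n 0"]) (use g lim in \<open>auto simp: Q_def\<close>)
  moreover have "\<gamma>' T' = y" by (rule conv[of y "\<lambda>n. \<gamma> n (T n)"]) (use g lim in \<open>auto simp: Q_def\<close>)
  moreover have "cost h \<gamma>' T' \<le> ennreal c" by (rule lim(6)[OF h(1,2)]) (use gh in auto)
  moreover have "cost (indicator (\<Inter>k. V k)) \<gamma>' T' = 0"
  proof (rule cost_indicator_Inter_zero)
    fix j
    \<comment> \<open>For fixed \<open>j\<close> the tail of the series bounds what all later stages
      add, and this tail tends to 0 as \<open>j\<close> grows.\<close>
    have "cost (indicator (V (k j))) \<gamma>' T' \<le> ennreal (1 / real (Suc j) + c * q ^ j)"
    proof (rule lim(6)[OF iV seq_lsc_indicator[OF V(1)]])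
      have "cost (indicator (V (k j))) (\<gamma> n) (T n) \<le> ennreal (1 / real (Suc j) + c * q ^ j)" if "j < n" for n
      proof -
        have "cost (indicator (V (k j))) (\<gamma> n) (T n) \<le> ennreal (1 / real (Suc j) + (\<Sum>i\<in>{j..<n}. 2 * len i))"
          using g[of n] that fk[OF that] unfolding Q_def by metis
        also have "\<dots> \<le> ennreal (1 / real (Suc j) + c * q ^ j)" using tail[of j n] by (intro ennreal_leI) simp
        finally show ?thesis .
      qed
      then show "\<forall>\<^sub>F n in sequentially. cost (indicator (V (k j))) (\<gamma> n) (T n) \<le> ennreal (1 / real (Suc j) + c * q ^ j)"
        by (rule eventually_mono[OF eventually_gt_at_top[of j]])
    qed
    then show "\<exists>k. cost (indicator (V k)) \<gamma>' T' \<le> ennreal (1 / real (Suc j) + c * q ^ j)" by blast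
  next
    have "(\<lambda>j. inverse (real (Suc j)) + c * q ^ j) \<longlonglongrightarrow> 0 + c * 0"
      using q by (intro tendsto_intros LIMSEQ_inverse_real_of_nat LIMSEQ_realpow_zero) auto
    then show "(\<lambda>j. 1 / real (Suc j) + c * q ^ j) \<longlonglongrightarrow> 0" by (simp add: inverse_eq_divide)
  qed
  moreover have "c = 4 * ae_const Cd \<alpha> * A * 2 powr \<alpha> / (1 - 2 powr (- \<alpha>)) * dist x y powr \<alpha>"
    using D by (simp add: c_def len_def r_def q_def powr_mult D_def)
  ultimately show ?thesis using lim(2) by metis
qed

section \<open>The Poincare inequalities\<close>

lemma seq_lsc_SUP:
  fixes S :: "'a::topological_space set"
  assumes "\<And>i. seq_lsc S (\<phi> i)" shows "seq_lsc S (\<lambda>x. SUP i. \<phi> i x)"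
  unfolding seq_lsc_def
proof (intro allI impI SUP_least)
  fix X x i assume X: "range X \<subseteq> S" "x \<in> S" "X \<longlonglongrightarrow> x"
  have "\<phi> i x \<le> liminf (\<lambda>n. \<phi> i (X n))" using X by (intro seq_lscD[OF assms]) auto
  also have "\<dots> \<le> liminf (\<lambda>n. SUP i. \<phi> i (X n))"
    by (intro Liminf_mono always_eventually allI SUP_upper) auto
  finally show "\<phi> i x \<le> liminf (\<lambda>n. SUP i. \<phi> i (X n))" .
qed

lemma ennreal_powr_mono: "x \<le> y \<Longrightarrow> 0 \<le> p \<Longrightarrow> ennreal_powr x p \<le> ennreal_powr y p"
  by (cases x; cases y) (auto simp: ennreal_powr_def top_unique intro!: ennreal_leI powr_mono2)

lemma ennreal_powr_ennreal: "0 \<le> x \<Longrightarrow> ennreal_powr (ennreal x) p = ennreal (x powr p)"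
  by (simp add: ennreal_powr_def)

text \<open>The dyadic level sets of \<open>f\<close> are enlarged to open sets \<open>U k\<close>
  with excess so small that, weighted by the power \<open>p\<close> of \<open>2 ^ k\<close>, it sums
  to at most 1. As \<open>h\<close> is a supremum, its power \<open>p\<close> is at most the sum of
  the weighted indicators, whose integral is finite.\<close>

lemma lsc_majorant_Lp:
  fixes S :: "'a::metric_space set" and f :: "'a \<Rightarrow> real"
  assumes M: "finite_measure M" "sets M = sets (restrict_space borel S)" and S: "closed S"
    and f: "f \<in> borel_on S" and p: "0 < p"
    and int: "integrable M (\<lambda>x. \<bar>f x\<bar> powr p)"
  obtains h where "h \<in> borel_on S" "seq_lsc S h" "\<And>x. x \<in> S \<Longrightarrow> 1 \<le> h x"
    "\<And>x. x \<in> S \<Longrightarrow> ennreal (f x) \<le> h x" "(\<integral>\<^sup>+x. ennreal_powr (h x) p \<partial>M) < \<infinity>"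
proof -
  interpret finite_measure M by fact
  have sp: "space M = S" using sets_eq_imp_space_eq[OF M(2)] by (simp add: space_restrict_space)
  have [measurable]: "f \<in> borel_measurable M" using f by (subst measurable_cong_sets[OF M(2) refl])
  \<comment> \<open>The exponents are natural numbers, so values of \<open>f\<close> below 1 are
    raised to 1; this is what gives \<open>1 \<le> h x\<close>.\<close>
  define \<kappa> where "\<kappa> x = (LEAST k. f x \<le> 2 ^ k)" for x
  have ex: "\<exists>k. f x \<le> 2 ^ k" for x using real_arch_pow[of 2 "f x"] less_imp_le by auto
  have \<kappa>1: "f x \<le> 2 ^ \<kappa> x" for x unfolding \<kappa>_def using ex[of x] by (rule LeastI_ex)
  have \<kappa>2: "2 ^ j < f x" if "j < \<kappa> x" for j x using not_less_Least[of j "\<lambda>k. f x \<le> 2 ^ k"] that by (auto simp: \<kappa>_def)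
  have [measurable]: "\<kappa> \<in> measurable M (count_space UNIV)" unfolding \<kappa>_def by measurable
  define A where "A k = {x\<in>space M. \<kappa> x = k}" for k
  have A: "A k \<in> sets M" for k unfolding A_def by measurable
  define a where "a k = (2 ^ k :: real) powr p" for k :: nat
  have a: "0 < a k" for k by (simp add: a_def)
  define \<delta> where "\<delta> k = (1 / 2) ^ Suc k / a k" for k :: nat
  have "\<exists>U. open U \<and> A k \<subseteq> U \<and> measure M (U \<inter> S) \<le> measure M (A k) + \<delta> k" for k
    using outer_regular_restrict[OF M S A, of "\<delta> k" k] a[of k] by (auto simp: \<delta>_def)
  then obtain U where U: "\<And>k. open (U k)" "\<And>k. A k \<subseteq> U k" "\<And>k. measure M (U k \<inter> S) \<le> measure M (A k) + \<delta> k" by metis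
  have US: "U k \<inter> S \<in> sets M" for k unfolding M(2) sets_restrict_space using U(1)[of k] by auto
  define h where "h x = (SUP k. ennreal (2 ^ k) * indicator (U k) x)" for x
  have h\<kappa>: "ennreal (2 ^ \<kappa> x) \<le> h x" if "x \<in> S" for x
  proof -
    have "x \<in> U (\<kappa> x)" using U(2)[of "\<kappa> x"] that sp by (auto simp: A_def)
    then show ?thesis unfolding h_def by (intro SUP_upper2[of "\<kappa> x"]) auto
  qed
  show ?thesis
  proof (rule that)
    show "h \<in> borel_on S"
      unfolding h_def
    proof (rule borel_measurable_SUP)
      fix k :: nat
      have "(indicator (U k) :: _ \<Rightarrow> ennreal) \<in> borel_on S"
        using U by (intro indicator_borel_restrict) auto
      then show "(\<lambda>x. ennreal (2 ^ k) * indicator (U k) x) \<in> borel_on S" by measurable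
    qed auto
    show "seq_lsc S h" unfolding h_def by (intro seq_lsc_SUP seq_lsc_cmult_indicator U)
    show "1 \<le> h x" if "x \<in> S" for x
    proof -
      have "(1::ennreal) = ennreal 1" by simp
      also have "\<dots> \<le> ennreal (2 ^ \<kappa> x)" by (intro ennreal_leI) simp
      finally show ?thesis using h\<kappa>[OF that] by (rule order.trans)
    qed
    show "ennreal (f x) \<le> h x" if "x \<in> S" for x
      by (rule order.trans[OF ennreal_leI[OF \<kappa>1] h\<kappa>[OF that]])
    define G where "G x = (\<Sum>k. ennreal (a k) * indicator (U k) x)" for x
    have hG: "ennreal_powr (h x) p \<le> G x" for x
    proof (cases "G x")
      case (real T)
      have "ennreal (2 ^ k) * indicator (U k) x \<le> ennreal (T powr (1 / p))" for k
      proof (cases "x \<in> U k")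
        case True
        have "(\<Sum>i\<in>{k}. ennreal (a i) * indicator (U i) x) \<le> G x"
          unfolding G_def by (rule sum_le_suminf) auto
        moreover have "(\<Sum>i\<in>{k}. ennreal (a i) * indicator (U i) x) = ennreal (a k)" using True by simp
        ultimately have "ennreal (a k) \<le> ennreal T" using real(2) by (simp only:)
        then have "a k \<le> T" using real(1) by (simp add: ennreal_le_iff)
        then have "a k powr (1 / p) \<le> T powr (1 / p)" using a[of k] p by (intro powr_mono2) auto
        moreover have "a k powr (1 / p) = 2 ^ k" using p by (simp add: a_def powr_powr)
        ultimately have "ennreal (2 ^ k) \<le> ennreal (T powr (1 / p))" by (intro ennreal_leI) simp
        then show ?thesis using True by simp
      qed simp
      then have "h x \<le> ennreal (T powr (1 / p))" unfolding h_def by (rule SUP_least)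
      then have "ennreal_powr (h x) p \<le> ennreal_powr (ennreal (T powr (1 / p))) p" using p by (intro ennreal_powr_mono) auto
      also have "\<dots> = ennreal T" using real p by (simp add: ennreal_powr_ennreal powr_powr)
      finally show ?thesis using real by simp
    qed simp
    have "(\<integral>\<^sup>+x. ennreal_powr (h x) p \<partial>M) \<le> (\<integral>\<^sup>+x. G x \<partial>M)" by (intro nn_integral_mono hG)
    also have "\<dots> = (\<integral>\<^sup>+x. (\<Sum>k. ennreal (a k) * indicator (U k \<inter> S) x) \<partial>M)"
      unfolding G_def by (intro nn_integral_cong) (auto simp: sp indicator_def)
    also have "\<dots> = (\<Sum>k. ennreal (a k) * emeasure M (U k \<inter> S))"
      using US by (subst nn_integral_suminf) (auto simp: nn_integral_cmult_indicator)
    also have "\<dots> \<le> (\<Sum>k. ennreal (a k) * emeasure M (A k) + ennreal ((1 / 2) ^ Suc k))"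
    proof (rule suminf_le)
      fix k
      have "a k * measure M (U k \<inter> S) \<le> a k * (measure M (A k) + \<delta> k)" using U(3) a[of k] by (intro mult_left_mono) auto
      also have "\<dots> = a k * measure M (A k) + (1 / 2) ^ Suc k" using a[of k] by (simp add: \<delta>_def field_simps)
      finally have "ennreal (a k * measure M (U k \<inter> S)) \<le> ennreal (a k * measure M (A k) + (1 / 2) ^ Suc k)" by (rule ennreal_leI)
      then show "ennreal (a k) * emeasure M (U k \<inter> S) \<le> ennreal (a k) * emeasure M (A k) + ennreal ((1 / 2) ^ Suc k)"
        using a[of k] by (simp add: emeasure_eq_measure ennreal_mult)
    qed auto
    also have "\<dots> = (\<Sum>k. ennreal (a k) * emeasure M (A k)) + (\<Sum>k. ennreal ((1 / 2) ^ Suc k))"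
      by (intro suminf_add[symmetric]) auto
    also have "(\<Sum>k. ennreal ((1 / 2) ^ Suc k)) = 1"
      by (subst suminf_ennreal2) (use power_half_series in \<open>auto simp: sums_iff\<close>)
    also have "(\<Sum>k. ennreal (a k) * emeasure M (A k)) = (\<integral>\<^sup>+x. (\<Sum>k. ennreal (a k) * indicator (A k) x) \<partial>M)"
      using A by (subst nn_integral_suminf) (auto simp: nn_integral_cmult_indicator)
    \<comment> \<open>The summand 1 covers \<open>\<kappa> x = 0\<close>; otherwise minimality of
      the exponent gives \<open>2 ^ \<kappa> x < 2 * f x\<close>.\<close>
    also have "\<dots> \<le> (\<integral>\<^sup>+x. ennreal (1 + 2 powr p * \<bar>f x\<bar> powr p) \<partial>M)"
    proof (rule nn_integral_mono)
      fix x assume x: "x \<in> space M"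
      have "(\<Sum>k. ennreal (a k) * indicator (A k) x) = ennreal (a (\<kappa> x))"
        using suminf_finite[of "{\<kappa> x}" "\<lambda>k. ennreal (a k) * indicator (A k) x"] x by (auto simp: A_def)
      also have "\<dots> \<le> ennreal (1 + 2 powr p * \<bar>f x\<bar> powr p)"
      proof (rule ennreal_leI, cases "\<kappa> x")
        case 0 then show "a (\<kappa> x) \<le> 1 + 2 powr p * \<bar>f x\<bar> powr p" by (simp add: a_def)
      next
        case (Suc j)
        have "2 ^ \<kappa> x \<le> 2 * \<bar>f x\<bar>" using \<kappa>2[of j x] Suc by simp
        then have "a (\<kappa> x) \<le> (2 * \<bar>f x\<bar>) powr p" unfolding a_def using p by (intro powr_mono2) auto
        then show "a (\<kappa> x) \<le> 1 + 2 powr p * \<bar>f x\<bar> powr p" by (simp add: powr_mult)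
      qed
      finally show "(\<Sum>k. ennreal (a k) * indicator (A k) x) \<le> ennreal (1 + 2 powr p * \<bar>f x\<bar> powr p)" .
    qed
    also have "\<dots> = ennreal (LINT x|M. 1 + 2 powr p * \<bar>f x\<bar> powr p)"
      using int by (intro nn_integral_eq_integral) auto
    finally show "(\<integral>\<^sup>+x. ennreal_powr (h x) p \<partial>M) < \<infinity>" by (simp add: less_top order_le_less_trans)
  qed
qed

lemma bounded_set_integrable:
  assumes "finite_measure M" "w \<in> borel_measurable M" "\<forall>x. 0 \<le> w x \<and> w x \<le> (N::real)" "B \<in> sets M"
  shows "set_integrable M B w"
proof -
  interpret finite_measure M by fact
  have "integrable M w" by (rule integrable_const_bound[of _ N]) (use assms in auto)
  then show ?thesis unfolding set_integrable_def using assms by (intro integrable_mult_indicator) auto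
qed

lemma diameter_ball_le: "0 < r \<Longrightarrow> diameter (ball x r \<inter> S) \<le> 2 * r" for x :: "'a::metric_space"
proof (cases "ball x r \<inter> S = {}")
  case False
  have "dist y z \<le> 2 * r" if "y \<in> ball x r" "z \<in> ball x r" for y z
    using dist_triangle3[of y z x] that by simp
  then have "(SUP (y, z)\<in>(ball x r \<inter> S) \<times> (ball x r \<inter> S). dist y z) \<le> 2 * r"
    using False by (intro cSUP_least) auto
  then show ?thesis unfolding diameter_def if_not_P[OF False] .
qed simp

text \<open>The integral of the power of \<open>h\<close> over a ball is at most its total
  \<open>H\<close>, while the ball has measure at least \<open>c * (lam * r) powr Q\<close>. The
  root of the quotient is of order \<open>r powr (- Q / p)\<close>, and the diameter contributes the
  factor \<open>r\<close>.\<close>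

lemma poincare_oscillation:
  fixes S :: "'a::complete_space set"
  assumes d: "doubling_measure_on S Cd M" and S: "bounded S" "closed S" "S \<noteq> {}" and Q: "Q = log 2 Cd"
    and P: "poincare_on S M p"
    and h: "h \<in> borel_on S" and hp: "(\<integral>\<^sup>+x. ennreal_powr (h x) p \<partial>M) < \<infinity>"
  obtains A where "0 < A" "oscillation_bound S M h R A (1 - Q / p)"
proof -
  note fin = doubling_finite(1)[OF d S(1,3)] and sp = doubling_finite(2)[OF d S(1,3)]
    and bM = doubling_finite(3)[OF d S(1,3)]
  interpret finite_measure M by (rule fin)
  have p: "1 \<le> p" using P by (simp add: poincare_on_def)
  obtain C lam where C: "0 < C" "1 \<le> lam" and PI: "\<forall>w \<rho> x r.
        w \<in> borel_measurable (completion M) \<longrightarrow> upper_gradient_on S \<rho> w \<longrightarrow> x \<in> S \<longrightarrow> 0 < r \<longrightarrow>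
        set_integrable (completion M) (ball x r \<inter> S) w \<longrightarrow>
        mean_oscillation (completion M) (ball x r \<inter> S) w
          \<le> ennreal (C * diameter (ball x r \<inter> S)) *
             ennreal_powr ((\<integral>\<^sup>+z\<in>ball x (lam * r) \<inter> S. ennreal_powr (\<rho> z) p \<partial>M)
                             / emeasure M (ball x (lam * r) \<inter> S)) (1 / p)"
    using P unfolding poincare_on_def by (elim conjE exE) (rule that; assumption)
  \<comment> \<open>\<open>max R 1\<close> keeps the range of radii positive whatever
    \<open>R\<close> is.\<close>
  have lR: "0 < lam * max R 1" using C by simp
  obtain c where c: "0 < c" "\<And>x r. x \<in> S \<Longrightarrow> 0 < r \<Longrightarrow> r \<le> lam * max R 1 \<Longrightarrow> c * r powr Q \<le> measure M (ball x r \<inter> S)"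
    using doubling_mass_bound[OF d S(1,3) Q lR] by metis
  obtain H where H: "(\<integral>\<^sup>+x. ennreal_powr (h x) p \<partial>M) = ennreal H" "0 \<le> H" using hp by (cases "\<integral>\<^sup>+x. ennreal_powr (h x) p \<partial>M") auto
  define B where "B = 2 * C * (H / (c * lam powr Q)) powr (1 / p)"
  have B: "0 \<le> B" using C by (simp add: B_def)
  show ?thesis
  \<comment> \<open>One is added because \<open>B\<close> may vanish and the constant has to be
    positive.\<close>
  proof (rule that[of "B + 1"])
    show "0 < B + 1" using B by simp
    show "oscillation_bound S M h R (B + 1) (1 - Q / p)"
      unfolding oscillation_bound_def
    proof (intro allI impI)
      fix E :: "'a set" and w :: "'a \<Rightarrow> real" and N :: real and x :: 'a and r :: real
      assume E: "E \<in> sets borel" "E \<inter> S \<in> null_sets M" and w: "w \<in> borel_measurable (completion M)" "\<forall>x. 0 \<le> w x \<and> w x \<le> N"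
        and ug: "upper_gradient_on S (\<lambda>x. h x + \<infinity> * indicator E x) w" and x: "x \<in> S" and r: "0 < r" "r \<le> R"
      define D where "D = ball x (lam * r) \<inter> S"
      define I where "I = (\<integral>\<^sup>+z\<in>D. ennreal_powr (h z + \<infinity> * indicator E z) p \<partial>M)"
      define m where "m = measure M D"
      have lr: "0 < lam * r" "lam * r \<le> lam * max R 1" using C r by (auto intro: mult_left_mono)
      have m: "c * (lam * r) powr Q \<le> m" unfolding m_def D_def by (rule c(2)[OF x lr])
      have "0 < (lam * r) powr Q" using lr(1) by (metis powr_gt_zero less_irrefl)
      then have m0: "0 < c * (lam * r) powr Q" using c(1) by simp
      have "AE z in M. z \<notin> E \<inter> S" using E by (intro AE_not_in)
      with AE_space have ae: "AE z in M. ennreal_powr (h z + \<infinity> * indicator E z) p * indicator D z \<le> ennreal_powr (h z) p"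
        by eventually_elim (auto simp: sp indicator_def)
      have "I \<le> ennreal H" unfolding I_def H(1)[symmetric] by (rule nn_integral_mono_AE[OF ae])
      then have "I / emeasure M D \<le> ennreal H / ennreal m"
        by (simp add: m_def emeasure_eq_measure divide_right_mono_ennreal)
      also have "\<dots> = ennreal (H / m)" using H m m0 by (intro divide_ennreal) auto
      also have "\<dots> \<le> ennreal (H / (c * (lam * r) powr Q))" using H m m0 by (intro ennreal_leI divide_left_mono) auto
      finally have "ennreal_powr (I / emeasure M D) (1 / p) \<le> ennreal_powr (ennreal (H / (c * (lam * r) powr Q))) (1 / p)"
        using p by (intro ennreal_powr_mono) auto
      also have "\<dots> = ennreal ((H / (c * (lam * r) powr Q)) powr (1 / p))" using H m0 by (intro ennreal_powr_ennreal) auto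
      finally have 1: "ennreal_powr (I / emeasure M D) (1 / p) \<le> ennreal ((H / (c * (lam * r) powr Q)) powr (1 / p))" .
      have "mean_oscillation (completion M) (ball x r \<inter> S) w
        \<le> ennreal (C * diameter (ball x r \<inter> S)) * ennreal_powr (I / emeasure M D) (1 / p)"
        unfolding I_def D_def using bM
        by (intro PI[rule_format] w ug x r bounded_set_integrable[OF finite_measure_completion[OF fin] w]) simp
      also have "\<dots> \<le> ennreal (C * (2 * r)) * ennreal ((H / (c * (lam * r) powr Q)) powr (1 / p))"
        using C by (intro mult_mono 1 ennreal_leI mult_left_mono diameter_ball_le r) auto
      also have "\<dots> = ennreal (C * (2 * r) * (H / (c * (lam * r) powr Q)) powr (1 / p))"
        using C r by (intro ennreal_mult[symmetric]) auto
      also have "C * (2 * r) * (H / (c * (lam * r) powr Q)) powr (1 / p) = B * r powr (1 - Q / p)"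
      proof -
        have e: "H / (c * (lam * r) powr Q) = (H / (c * lam powr Q)) * r powr (- Q)"
          using C r by (simp add: powr_mult powr_minus field_simps)
        have "(H / (c * (lam * r) powr Q)) powr (1 / p) = (H / (c * lam powr Q)) powr (1 / p) * (r powr (- Q)) powr (1 / p)"
          unfolding e by (rule powr_mult)
        also have "(r powr (- Q)) powr (1 / p) = r powr (- (Q / p))" by (simp add: powr_powr)
        finally have "C * (2 * r) * (H / (c * (lam * r) powr Q)) powr (1 / p) = B * (r powr 1 * r powr (- (Q / p)))"
          using r by (simp add: B_def)
        also have "r powr 1 * r powr (- (Q / p)) = r powr (1 - Q / p)" by (subst powr_add[symmetric]) simp
        finally show ?thesis .
      qed
      also have "ennreal (B * r powr (1 - Q / p)) \<le> ennreal ((B + 1) * r powr (1 - Q / p))"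
        by (intro ennreal_leI mult_right_mono) auto
      finally show "mean_oscillation (completion M) (ball x r \<inter> S) w \<le> ennreal ((B + 1) * r powr (1 - Q / p))" .
    qed
  qed
qed

text \<open>The essential supremum of the penalized density is at most \<open>K\<close>, so the
  diameter alone determines the exponent.\<close>

lemma poincare_infinity_oscillation:
  fixes S :: "'a::complete_space set"
  assumes d: "doubling_measure_on S Cd M" and S: "bounded S" "closed S" "S \<noteq> {}"
    and P: "poincare_infinity_on S M" and K: "0 \<le> K"
  obtains A where "0 < A" "oscillation_bound S M (\<lambda>_. ennreal K) R A 1"
proof -
  note fin = doubling_finite(1)[OF d S(1,3)] and sp = doubling_finite(2)[OF d S(1,3)]
    and bM = doubling_finite(3)[OF d S(1,3)]
  have sM: "sets M = sets (restrict_space borel S)" using d by (simp add: doubling_measure_on_def)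
  obtain C lam where C: "0 < C" "1 \<le> lam" and PI: "\<forall>w \<rho> x r.
        w \<in> borel_measurable (completion M) \<longrightarrow> upper_gradient_on S \<rho> w \<longrightarrow> x \<in> S \<longrightarrow> 0 < r \<longrightarrow>
        set_integrable (completion M) (ball x r \<inter> S) w \<longrightarrow>
        mean_oscillation (completion M) (ball x r \<inter> S) w
          \<le> ennreal (C * diameter (ball x r \<inter> S)) *
             esssup (restrict_space M (ball x (lam * r) \<inter> S)) \<rho>"
    using P unfolding poincare_infinity_on_def by (elim conjE exE) (rule that; assumption)
  show ?thesis
  proof (rule that[of "2 * C * K + 1"])
    show "0 < 2 * C * K + 1" using C K by (simp add: add_nonneg_pos)
    show "oscillation_bound S M (\<lambda>_. ennreal K) R (2 * C * K + 1) 1"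
      unfolding oscillation_bound_def
    proof (intro allI impI)
      fix E :: "'a set" and w :: "'a \<Rightarrow> real" and N :: real and x :: 'a and r :: real
      assume E: "E \<in> sets borel" "E \<inter> S \<in> null_sets M" and w: "w \<in> borel_measurable (completion M)" "\<forall>x. 0 \<le> w x \<and> w x \<le> N"
        and ug: "upper_gradient_on S (\<lambda>x. ennreal K + \<infinity> * indicator E x) w" and x: "x \<in> S" and r: "0 < r"
      define D where "D = ball x (lam * r) \<inter> S"
      define \<rho> where "\<rho> = (\<lambda>x. ennreal K + \<infinity> * indicator E x)"
      have "\<rho> \<in> borel_on S" using ug by (simp add: upper_gradient_on_def \<rho>_def)
      then have "\<rho> \<in> borel_measurable M" by (subst measurable_cong_sets[OF sM refl])
      then have \<rho>: "\<rho> \<in> borel_measurable (restrict_space M D)" by (rule measurable_restrict_space1)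
      have "AE z in M. z \<notin> E \<inter> S" using E by (intro AE_not_in)
      with AE_space have "AE z in M. z \<in> D \<longrightarrow> \<rho> z \<le> ennreal K"
        by eventually_elim (auto simp: sp indicator_def \<rho>_def)
      then have "AE z in restrict_space M D. \<rho> z \<le> ennreal K"
        using bM by (subst AE_restrict_space_iff) (auto simp: D_def sp)
      then have es: "esssup (restrict_space M D) \<rho> \<le> ennreal K" using \<rho> by (intro esssup_I)
      have "mean_oscillation (completion M) (ball x r \<inter> S) w
        \<le> ennreal (C * diameter (ball x r \<inter> S)) * esssup (restrict_space M D) \<rho>"
        unfolding D_def \<rho>_def using bM
        by (intro PI[rule_format] w ug x r bounded_set_integrable[OF finite_measure_completion[OF fin] w]) simp
      also have "\<dots> \<le> ennreal (C * (2 * r)) * ennreal K"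
        using C by (intro mult_mono es ennreal_leI mult_left_mono diameter_ball_le r) auto
      also have "\<dots> = ennreal (C * (2 * r) * K)"
        using C r K by (intro ennreal_mult[symmetric]) auto
      also have "\<dots> \<le> ennreal ((2 * C * K + 1) * r)"
        using r by (intro ennreal_leI) (simp add: algebra_simps)
      finally show "mean_oscillation (completion M) (ball x r \<inter> S) w \<le> ennreal ((2 * C * K + 1) * r powr 1)"
        using r by simp
    qed
  qed
qed

section \<open>The value function\<close>

text \<open>Along a curve that spends no time in the exceptional set, the bound of \<open>f\<close>
  by \<open>h\<close> off that set suffices. The radii range up to \<open>8 * diameter S\<close>
  because \<open>avoiding_curve\<close> asks for \<open>8 * dist x y \<le> R\<close>.\<close>

lemma induced_length_holder:
  fixes S :: "'a::complete_space set" and V :: "nat \<Rightarrow> 'a set" and f :: "'a \<Rightarrow> real"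
  assumes d: "doubling_measure_on S Cd M" and S: "bounded S" "closed S"
    and h: "h \<in> borel_on S" "seq_lsc S h" "\<And>x. x \<in> S \<Longrightarrow> 1 \<le> h x"
    and osc: "oscillation_bound S M h (8 * diameter S) A \<alpha>"
    and A: "0 < A" and \<alpha>: "0 < \<alpha>"
    and V: "\<And>k. open (V k)" "decseq V" "(\<Inter>k. V k) \<inter> S \<in> null_sets M"
    and f: "f \<in> borel_on S"
    and fh: "\<And>x. x \<in> S \<Longrightarrow> x \<notin> (\<Inter>k. V k) \<Longrightarrow> ennreal (f x) \<le> h x"
  shows "\<exists>C\<ge>0. \<forall>x\<in>S. \<forall>y\<in>S. induced_length S f x y \<le> ennreal (C * dist x y powr \<alpha>)"
proof -
  define C where "C = 4 * ae_const Cd \<alpha> * A * 2 powr \<alpha> / (1 - 2 powr (- \<alpha>))"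
  have Cd: "1 \<le> Cd" using d by (auto simp: doubling_measure_on_def)
  have "2 powr (- \<alpha>) < 1" using \<alpha> by (simp add: powr_less_one)
  then have C: "0 \<le> C" unfolding C_def using ae_const_pos[OF Cd \<alpha>] A by simp
  have Eb: "(\<Inter>k. V k) \<in> sets borel" using V by (intro sets.countable_INT) auto
  have "induced_length S f x y \<le> ennreal (C * dist x y powr \<alpha>)" if x: "x \<in> S" and y: "y \<in> S" for x y
  proof (cases "x = y")
    case True
    then show ?thesis using induced_length_le_cost[OF lip_curve_const[OF x] f] by simp
  next
    case False
    have "8 * dist x y \<le> 8 * diameter S" using diameter_bounded_bound[OF S(1) x y] by simp
    then obtain \<gamma> T where g: "lip_curve S \<gamma> T" "\<gamma> 0 = x" "\<gamma> T = y" "cost (indicator (\<Inter>k. V k)) \<gamma> T = 0"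
      "cost h \<gamma> T \<le> ennreal (C * dist x y powr \<alpha>)"
      using avoiding_curve[OF d S h osc A \<alpha> x y False _ V] unfolding C_def by blast
    have "induced_length S f x y \<le> cost (\<lambda>z. ennreal (f z)) \<gamma> T"
      using induced_length_le_cost[OF g(1) f] g by simp
    also have "\<dots> \<le> cost (\<lambda>x. h x + \<infinity> * indicator (\<Inter>k. V k) x) \<gamma> T"
    proof (rule cost_mono)
      fix t
      have "\<gamma> t \<in> S" using g(1) by (auto simp: lip_curve_def)
      then show "ennreal (f (\<gamma> t)) \<le> h (\<gamma> t) + \<infinity> * indicator (\<Inter>k. V k) (\<gamma> t)"
        using fh[of "\<gamma> t"] by (cases "\<gamma> t \<in> (\<Inter>k. V k)") simp_all
    qed
    also have "\<dots> = cost h \<gamma> T" using cost_penalized[OF g(1) h(1) Eb] g(4) by simp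
    finally show ?thesis using g(5) by (rule order.trans)
  qed
  then show ?thesis using C by blast
qed

text \<open>Each kind of curve is turned into the other without raising the cost. The triangle
  inequality is proved in this form, where concatenation is simple.\<close>

lemma induced_length_eq_reach_cost:
  assumes f: "f \<in> borel_on S"
  shows "induced_length S f x y = reach_cost S (\<lambda>z. ennreal (f z)) {x} y" (is "?L = ?R")
proof (rule antisym)
  show "?L \<le> ?R"
    unfolding reach_cost_def
  proof (rule INF_greatest)
    fix p assume "p \<in> {(\<gamma>, T). lip_curve S \<gamma> T \<and> \<gamma> 0 \<in> {x} \<and> \<gamma> T = y}"
    then show "?L \<le> (case p of (\<gamma>, T) \<Rightarrow> cost (\<lambda>z. ennreal (f z)) \<gamma> T)"
      using induced_length_le_cost[OF _ f] by (cases p) auto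
  qed
  show "?R \<le> ?L"
    unfolding induced_length_def
  proof (rule INF_greatest)
    fix p assume p: "p \<in> admissible_curves S f x y"
    obtain \<gamma> l where pl: "p = (\<gamma>, l)" by (cases p)
    have r: "rectifiable_curve S \<gamma> 0 l" "\<gamma> 0 = x" "\<gamma> l = y" using p by (auto simp: pl admissible_curves_def)
    obtain \<eta> T where "lip_curve S \<eta> T" "\<eta> 0 = x" "\<eta> T = y"
      "\<And>\<rho>. curve_integral \<rho> \<gamma> 0 l = cost \<rho> \<eta> T"
      using rectifiable_curve_lip[OF r(1)] r(2,3) by metis
    then show "?R \<le> (case p of (\<gamma>, l) \<Rightarrow> curve_integral (\<lambda>z. ennreal (f z)) \<gamma> 0 l)"
      using reach_cost_le[of S \<eta> T "{x}"] by (simp add: pl)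
  qed
qed

lemma induced_length_triangle:
  assumes f: "f \<in> borel_on S"
  shows "induced_length S f x z \<le> induced_length S f x y + induced_length S f y z"
proof (cases "induced_length S f x y = top")
  case False
  define F where "F = (\<lambda>z. ennreal (f z))"
  define R where "R = reach_cost S F"
  have e: "induced_length S f a b = R {a} b" for a b unfolding R_def F_def by (rule induced_length_eq_reach_cost[OF f])
  have "F \<in> borel_on S" unfolding F_def using f by measurable
  note step = reach_cost_step[OF _ this, of _ _ "{x}", folded R_def]
  have "R {x} z - R {x} y \<le> R {y} z"
    unfolding R_def reach_cost_def[of S _ "{y}" z]
  proof (rule INF_greatest)
    fix p assume "p \<in> {(\<gamma>, T). lip_curve S \<gamma> T \<and> \<gamma> 0 \<in> {y} \<and> \<gamma> T = z}"
    then obtain \<gamma> T where p: "p = (\<gamma>, T)" "lip_curve S \<gamma> T" "\<gamma> 0 = y" "\<gamma> T = z" by (cases p) auto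
    then show "reach_cost S F {x} z - reach_cost S F {x} y \<le>
        (case p of (\<gamma>, T) \<Rightarrow> cost F \<gamma> T)"
      using step[of \<gamma> T] False by (simp add: ennreal_minus_le_iff e R_def)
  qed
  then show ?thesis using False by (simp add: e ennreal_minus_le_iff)
qed simp

text \<open>Distances are finite, so the infimum in \<open>length_space\<close> is not over the
  empty set and any two points are joined by a curve. Connectedness makes the boundary of
  \<open>\<Omega>\<close> nonempty; over an empty boundary the infimum defining \<open>u\<close>
  would be infinite.\<close>

lemma length_space_connected:
  assumes "length_space (UNIV :: 'a::metric_space set)" shows "connected (UNIV :: 'a set)"
  unfolding connected_iff_connected_component
proof (intro ballI)
  fix x y :: 'a
  let ?A = "{curve_length \<gamma> a b | \<gamma> a b. rectifiable_curve UNIV \<gamma> a b \<and> \<gamma> a = x \<and> \<gamma> b = y}"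
  have "ennreal (dist x y) = Inf ?A"
    using assms unfolding length_space_def by blast
  then have "?A \<noteq> {}" by (metis Inf_empty ennreal_neq_top)
  then obtain \<gamma> a b where g: "rectifiable_curve UNIV \<gamma> a b" "\<gamma> a = x" "\<gamma> b = y" by blast
  then have "connected (\<gamma> ` {a..b})" "a \<le> b"
    by (auto simp: rectifiable_curve_def intro!: connected_continuous_image)
  then show "connected_component UNIV x y"
    unfolding connected_component_def using g by (intro exI[of _ "\<gamma> ` {a..b}"]) auto
qed

lemma frontier_nonempty:
  fixes \<Omega> :: "'a::topological_space set"
  assumes "connected (UNIV :: 'a set)" "\<Omega> \<noteq> {}" "\<Omega> \<noteq> UNIV" "open \<Omega>"
  shows "frontier \<Omega> \<noteq> {}"
proof
  assume "frontier \<Omega> = {}"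
  then have "closure \<Omega> \<subseteq> \<Omega>" using assms(4) by (auto simp: frontier_def interior_open)
  then have "closed \<Omega>" by (simp add: closure_subset_eq)
  then have "open (- \<Omega>)" by (simp add: open_Compl)
  then show False using connectedD[OF assms(1) assms(4), of "- \<Omega>"] assms by auto
qed

text \<open>Each function in the infimum has the required modulus by the triangle inequality for
  \<open>induced_length\<close>, and the infimum inherits it. Bounded \<open>g\<close> and the
  finite bound on \<open>induced_length\<close> keep \<open>u\<close> finite.\<close>

lemma value_function_holder:
  fixes \<Omega> :: "'a::metric_space set" and f g :: "'a \<Rightarrow> real"
  assumes f: "f \<in> borel_measurable (restrict_space borel (closure \<Omega>))"
    and g: "bounded (g ` frontier \<Omega>)" and ne: "frontier \<Omega> \<noteq> {}" and C: "0 \<le> C"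
    and L: "\<And>x y. x \<in> closure \<Omega> \<Longrightarrow> y \<in> closure \<Omega> \<Longrightarrow> induced_length (closure \<Omega>) f x y \<le> ennreal (C * dist x y powr \<alpha>)"
  defines "u \<equiv> value_function \<Omega> f g"
  shows "(\<forall>x\<in>closure \<Omega>. \<bar>u x\<bar> \<noteq> \<infinity>) \<and>
    (\<forall>x\<in>closure \<Omega>. \<forall>y\<in>closure \<Omega>. \<bar>real_of_ereal (u x) - real_of_ereal (u y)\<bar> \<le> C * dist x y powr \<alpha>)"
proof -
  define l where "l x y = enn2ereal (induced_length (closure \<Omega>) f x y)" for x y
  have u: "u x = (INF y\<in>frontier \<Omega>. l x y + ereal (g y))" for x by (simp add: u_def value_function_def l_def)
  have l0: "0 \<le> l x y" for x y by (simp add: l_def)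
  have lC: "l x y \<le> ereal (C * dist x y powr \<alpha>)" if "x \<in> closure \<Omega>" "y \<in> closure \<Omega>" for x y
    using L[OF that] C unfolding l_def
    by (metis enn2ereal_ennreal less_eq_ennreal.rep_eq mult_nonneg_nonneg powr_ge_zero)
  have tri: "l x z \<le> l x y + l y z" for x y z
    using induced_length_triangle[OF f, of x z y] unfolding l_def
    by (simp add: less_eq_ennreal.rep_eq plus_ennreal.rep_eq)
  have fr: "frontier \<Omega> \<subseteq> closure \<Omega>" by (auto simp: frontier_def)
  obtain G where G: "\<And>y. y \<in> frontier \<Omega> \<Longrightarrow> \<bar>g y\<bar> \<le> G" using g by (auto simp: bounded_iff)
  obtain y0 where y0: "y0 \<in> frontier \<Omega>" using ne by blast
  have fin: "\<bar>u x\<bar> \<noteq> \<infinity>" if x: "x \<in> closure \<Omega>" for x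
  proof -
    have "ereal (- G) \<le> u x" unfolding u
    proof (rule INF_greatest)
      fix y assume "y \<in> frontier \<Omega>"
      then have "0 + ereal (- G) \<le> l x y + ereal (g y)" using G[of y] l0 by (intro add_mono) auto
      then show "ereal (- G) \<le> l x y + ereal (g y)" by simp
    qed
    moreover have "u x \<le> l x y0 + ereal (g y0)" unfolding u using y0 by (rule INF_lower)
    moreover have "l x y0 + ereal (g y0) \<le> ereal (C * dist x y0 powr \<alpha>) + ereal (g y0)"
      using lC[OF x, of y0] y0 fr by (intro add_mono) auto
    ultimately show ?thesis by (cases "u x") auto
  qed
  have diff: "real_of_ereal (u x) \<le> C * dist x y powr \<alpha> + real_of_ereal (u y)"
    if x: "x \<in> closure \<Omega>" and y: "y \<in> closure \<Omega>" for x y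
  proof -
    define c where "c = C * dist x y powr \<alpha>"
    have "u x - ereal c \<le> u y"
      unfolding u[of y]
    proof (rule INF_greatest)
      fix z assume z: "z \<in> frontier \<Omega>"
      have "u x \<le> l x z + ereal (g z)" unfolding u using z by (rule INF_lower)
      also have "\<dots> \<le> (l x y + l y z) + ereal (g z)" by (intro add_mono tri) auto
      also have "\<dots> \<le> (ereal c + l y z) + ereal (g z)" using lC[OF x y] by (intro add_mono) (auto simp: c_def)
      finally have "u x \<le> ereal c + (l y z + ereal (g z))" by (simp add: add.assoc)
      then show "u x - ereal c \<le> l y z + ereal (g z)"
        by (subst ereal_minus_le) (auto simp: add.commute)
    qed
    then show ?thesis using fin[OF x] fin[OF y] unfolding c_def[symmetric]
      by (cases "u x"; cases "u y") auto
  qed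
  have lip: "\<bar>real_of_ereal (u x) - real_of_ereal (u y)\<bar> \<le> C * dist x y powr \<alpha>"
    if "x \<in> closure \<Omega>" "y \<in> closure \<Omega>" for x y
    using diff[OF that] diff[OF that(2,1)] by (auto simp: abs_le_iff dist_commute)
  show ?thesis by (intro conjI ballI fin lip)
qed

theorem theorem1p2:
  fixes \<Omega> :: "'a::complete_space set"
    and M :: "'a measure"
    and f g :: "'a \<Rightarrow> real"
    and Cd Q :: real
    and u :: "'a \<Rightarrow> ereal"
  assumes "length_space (UNIV :: 'a set)"
    and "open \<Omega>" and "connected \<Omega>" and "\<Omega> \<noteq> {}" and "bounded \<Omega>" and "\<Omega> \<noteq> UNIV"
    and "doubling_measure_on (closure \<Omega>) Cd M"
    and "Q = log 2 Cd"
    and "f \<in> borel_measurable (restrict_space borel (closure \<Omega>))"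
    and "\<forall>x\<in>closure \<Omega>. 0 < f x"
    and "0 < (INF x\<in>\<Omega>. f x)"
    and "bounded (g ` frontier \<Omega>)"
    and "u = value_function \<Omega> f g"
  shows "(\<forall>p. max 1 Q < p \<longrightarrow> poincare_on (closure \<Omega>) M p \<longrightarrow>
              integrable M (\<lambda>x. \<bar>f x\<bar> powr p) \<longrightarrow>
              (\<forall>x\<in>closure \<Omega>. \<bar>u x\<bar> \<noteq> \<infinity>) \<and>
              holder_on (1 - Q / p) (closure \<Omega>) (\<lambda>x. real_of_ereal (u x)))
       \<and> (poincare_infinity_on (closure \<Omega>) M \<longrightarrow>
              esssup M (\<lambda>x. ennreal \<bar>f x\<bar>) < \<infinity> \<longrightarrow>
              (\<forall>x\<in>closure \<Omega>. \<bar>u x\<bar> \<noteq> \<infinity>) \<and>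
              (\<exists>C. C-lipschitz_on (closure \<Omega>) (\<lambda>x. real_of_ereal (u x))))"
proof -
  define S where "S = closure \<Omega>"
  have d: "doubling_measure_on S Cd M" and f: "f \<in> borel_on S"
    using assms(7,9) by (auto simp: S_def)
  have S: "bounded S" "closed S" "S \<noteq> {}" using assms(4,5) by (auto simp: S_def)
  note fin = doubling_finite(1)[OF d S(1,3)] and sp = doubling_finite(2)[OF d S(1,3)]
  have sM: "sets M = sets (restrict_space borel S)" and Cd: "1 \<le> Cd" using d by (auto simp: doubling_measure_on_def)
  have fM [measurable]: "f \<in> borel_measurable M" using f by (subst measurable_cong_sets[OF sM refl])
  have fr: "frontier \<Omega> \<noteq> {}"
    by (rule frontier_nonempty[OF length_space_connected[OF assms(1)] assms(4,6,2)])
  have concl: "(\<forall>x\<in>S. \<bar>u x\<bar> \<noteq> \<infinity>) \<and> (\<forall>x\<in>S. \<forall>y\<in>S. \<bar>real_of_ereal (u x) - real_of_ereal (u y)\<bar> \<le> C * dist x y powr \<alpha>)"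
    if "0 \<le> C" "\<forall>x\<in>S. \<forall>y\<in>S. induced_length S f x y \<le> ennreal (C * dist x y powr \<alpha>)" for C \<alpha>
    unfolding S_def assms(13)
    by (rule value_function_holder[OF assms(9) assms(12) fr that(1)]) (use that(2) in \<open>auto simp: S_def\<close>)
  have "(\<forall>x\<in>S. \<bar>u x\<bar> \<noteq> \<infinity>) \<and> holder_on (1 - Q / p) S (\<lambda>x. real_of_ereal (u x))"
    if p: "max 1 Q < p" and P: "poincare_on S M p" and int: "integrable M (\<lambda>x. \<bar>f x\<bar> powr p)" for p
  proof -
    have p0: "0 < p" using p by simp
    have \<alpha>: "0 < 1 - Q / p" using p by (simp add: field_simps)
    obtain h where h: "h \<in> borel_on S" "seq_lsc S h" "\<And>x. x \<in> S \<Longrightarrow> 1 \<le> h x"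
      "\<And>x. x \<in> S \<Longrightarrow> ennreal (f x) \<le> h x" "(\<integral>\<^sup>+x. ennreal_powr (h x) p \<partial>M) < \<infinity>"
      by (rule lsc_majorant_Lp[OF fin sM S(2) f p0 int]) (rule that; assumption)
    obtain A where A: "0 < A" and osc: "oscillation_bound S M h (8 * diameter S) A (1 - Q / p)"
      by (rule poincare_oscillation[OF d S assms(8) P h(1,5)]) (rule that; assumption)
    \<comment> \<open>Here \<open>h\<close> bounds \<open>f\<close> at every point of
      \<open>S\<close>, so the exceptional set is empty.\<close>
    have "\<exists>C\<ge>0. \<forall>x\<in>S. \<forall>y\<in>S. induced_length S f x y \<le> ennreal (C * dist x y powr (1 - Q / p))"
      by (rule induced_length_holder[OF d S(1,2) h(1-3) osc A \<alpha>, of "\<lambda>_. {}"]) (use f h(4) in \<open>auto simp: decseq_def\<close>)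
    then obtain C where C: "0 \<le> C" "\<forall>x\<in>S. \<forall>y\<in>S. induced_length S f x y \<le> ennreal (C * dist x y powr (1 - Q / p))" by blast
    show ?thesis unfolding holder_on_def
      by (intro conjI exI[of _ C] concl[OF C, THEN conjunct1] concl[OF C, THEN conjunct2] C(1))
  qed
  moreover have "(\<forall>x\<in>S. \<bar>u x\<bar> \<noteq> \<infinity>) \<and> (\<exists>C. C-lipschitz_on S (\<lambda>x. real_of_ereal (u x)))"
    if P: "poincare_infinity_on S M" and es: "esssup M (\<lambda>x. ennreal \<bar>f x\<bar>) < \<infinity>"
  proof -
    obtain K0 where K0: "esssup M (\<lambda>x. ennreal \<bar>f x\<bar>) = ennreal K0" "0 \<le> K0"
      using es by (cases "esssup M (\<lambda>x. ennreal \<bar>f x\<bar>)") auto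
    \<comment> \<open>The constant majorant has to be at least 1, like every \<open>h\<close>
      above.\<close>
    define K where "K = max 1 K0"
    have K: "1 \<le> K" by (simp add: K_def)
    \<comment> \<open>\<open>f\<close> may exceed \<open>K\<close> on this null set; the curves are
      made to avoid a larger null set that is an intersection of open sets.\<close>
    define N where "N = {x\<in>space M. K < f x}"
    have "AE x in M. \<not> K < f x"
      using esssup_AE[where M=M and f="\<lambda>x. ennreal \<bar>f x\<bar>"] unfolding K0(1)
      by eventually_elim (use K0(2) in \<open>auto simp: K_def\<close>)
    moreover have "{x\<in>space M. \<not> \<not> K < f x} \<in> sets M" by measurable
    ultimately have N: "N \<in> null_sets M" using AE_iff_null[of M "\<lambda>x. \<not> K < f x"] by (simp add: N_def)
    obtain V :: "nat \<Rightarrow> 'a set" where V: "\<And>k. open (V k)" "decseq V" "N \<subseteq> (\<Inter>k. V k)" "(\<Inter>k. V k) \<inter> S \<in> null_sets M"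
      by (rule null_set_G_delta[OF fin sM S(2) N]) (rule that; assumption)
    obtain A where A: "0 < A" and osc: "oscillation_bound S M (\<lambda>_. ennreal K) (8 * diameter S) A 1"
      by (rule poincare_infinity_oscillation[OF d S P order.trans[OF zero_le_one K]]) (rule that; assumption)
    have "\<exists>C\<ge>0. \<forall>x\<in>S. \<forall>y\<in>S. induced_length S f x y \<le> ennreal (C * dist x y powr 1)"
    proof (rule induced_length_holder[OF d S(1,2) _ seq_lsc_const _ osc A zero_less_one V(1,2,4) f])
      show "1 \<le> ennreal K" using K ennreal_leI[of 1 K] by simp
      show "ennreal (f x) \<le> ennreal K" if "x \<in> S" "x \<notin> (\<Inter>k. V k)" for x
        using that V(3) sp by (intro ennreal_leI) (auto simp: N_def not_less)
    qed auto
    then obtain C where C: "0 \<le> C" "\<forall>x\<in>S. \<forall>y\<in>S. induced_length S f x y \<le> ennreal (C * dist x y powr 1)" by blast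
    have "C-lipschitz_on S (\<lambda>x. real_of_ereal (u x))"
      using concl[OF C] C(1) by (intro lipschitz_onI) (auto simp: dist_real_def)
    then show ?thesis by (intro conjI exI[of _ C] concl[OF C, THEN conjunct1])
  qed
  ultimately show ?thesis unfolding S_def[symmetric] by blast
qed

end
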